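(* Let $(g,f)$ be a homogeneous pair of degree $\alpha\in\mathbb{R}-\{0\}$ on a manifold $M$ with a free $\mathbb{R}_{>0}$-action, and suppose that $g$ is definite (i.e. positive or negative definite). Let $l>0$, $M_l=f^{-1}(l)$, and let $g_l$ be the pullback of $g$ to $M_l$. Given $C\in\mathbb{R}$, set $$v(r)=\frac1r\,w\left(\frac C\alpha,C_1,C_2,r\right),$$ where $C_1,C_2\in\mathbb{R}$ are such that $\left(\frac C\alpha,C_1,C_2\right)\in\Delta_1\cup\Delta_2\cup\Delta_3$. Then the sectional curvatures satisfy: - $K^{(v\circ f)g}\ge C$ when $l\,K^{g_l}\ge\alpha C_1$, and - $K^{(v\circ f)g}\le C$ when $l\,K^{g_l}\le\alpha C_1$. Furthermore, $K^{(v\circ f)g}=C$ if $l\,K^{g_l}=\alpha C_1$.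
   Context: $K^h$ denotes the sectional curvature of a metric $h$; inequalities such as $K^h\ge C$ mean that all sectional curvatures satisfy the inequality. Homogeneous pair: $m:\mathbb{R}_{>0}\times M\to M$ is a smooth free action, $m_\lambda=m(\lambda,\cdot)$, $P_x=\frac{d}{dt}m(e^t,x)|_{t=0}$. For a pseudo-Riemannian metric $g$, a smooth $f:M\to\mathbb{R}_{>0}$ and $\alpha\in\mathbb{R}-\{0\}$, $(g,f)$ is a homogeneous pair of degree $\alpha$ if $m_\lambda^*g=\lambda^\alpha g$, $m_\lambda^*f=\lambda^\alpha f$ for all $\lambda>0$ and $g(P,\cdot)=df$. The function $w$: set $\Delta_1=\{(s,C_1,C_2)\in\mathbb{R}^3\mid s>0,\ C_1>0\}$, $\Delta_2=\{(s,C_1,C_2)\in\mathbb{R}^3\mid s=0,\ C_1\ge0\}$, $\Delta_3=\{(s,C_1,C_2)\in\mathbb{R}^3\mid s<0,\ C_1\le0\}$. For (generic) $r\in\mathbb{R}_{>0}$ define - for $(s,C_1,C_2)\in\Delta_1$: $w(s,C_1,C_2,r)=\dfrac{C_1}{s\cosh^2(\sqrt{C_1}(\log r+C_2))}$; - for $(0,C_1,C_2)\in\Delta_2$: $w(0,C_1,C_2,r)=e^{C_2}r^{\pm2\sqrt{C_1}}$ (either choice of sign is allowed); - for $(s,C_1,C_2)\in\Delta_3$ with $C_1<0$: $w(s,C_1,C_2,r)=\dfrac{C_1}{s\sin^2(\sqrt{-C_1}(\log r+C_2))}$; - for $(s,0,C_2)\in\Delta_3$: $w(s,0,C_2,r)=\dfrac{-1}{s(\log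 r+C_2)^2}$. When $\alpha C\ge0$, $v$ is defined for all $r>0$; when $\alpha C<0$, $v$ is only defined on the complement of a discrete subset of $\mathbb{R}_{>0}$, and $(v\circ f)g$ is considered on the open subset of $M$ where $v\circ f$ is defined. *)

theory Defs
  imports "HOL-Analysis.Analysis"
begin

section \<open>Smooth maps between Euclidean spaces\<close>

text \<open>Only used for open \<open>S\<close>.\<close>

primrec Ck_on :: "nat \<Rightarrow> ('a::euclidean_space \<Rightarrow> 'b::real_normed_vector) \<Rightarrow> 'a set \<Rightarrow> bool" where
  "Ck_on 0 = (\<lambda>f S. continuous_on S f)"
| "Ck_on (Suc k) = (\<lambda>f S. (\<forall>x\<in>S. f differentiable (at x)) \<and>
      (\<forall>v. Ck_on k (\<lambda>x. frechet_derivative f (at x) v) S))"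

definition smooth_on :: "'a::euclidean_space set \<Rightarrow> ('a \<Rightarrow> 'b::real_normed_vector) \<Rightarrow> bool" where
  "smooth_on S f \<longleftrightarrow> (\<forall>k. Ck_on k f S)"


section \<open>Smooth manifolds\<close>

text \<open>
  A chart \<open>(U, \<phi>)\<close> is a coordinate domain together with a coordinate map (arbitrary outside
  \<open>U\<close>).  A manifold is an abstract topology with an atlas; its dimension is that of the Euclidean
  model type.  Atlases need not be maximal.
\<close>

type_synonym ('m, 'a) chart = "'m set \<times> ('m \<Rightarrow> 'a)"
type_synonym ('m, 'a) atlas = "('m, 'a) chart set"

definition chart_inv :: "('m, 'a) chart \<Rightarrow> 'a \<Rightarrow> 'm" where
  "chart_inv c = inv_into (fst c) (snd c)"

definition topological_chart :: "'m topology \<Rightarrow> ('m, 'a::euclidean_space) chart \<Rightarrow> bool" where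
  "topological_chart X c \<longleftrightarrow> openin X (fst c) \<and> open (snd c ` fst c) \<and>
     homeomorphic_map (subtopology X (fst c)) (top_of_set (snd c ` fst c)) (snd c)"

definition smooth_manifold :: "'m topology \<Rightarrow> ('m, 'a::euclidean_space) atlas \<Rightarrow> bool" where
  "smooth_manifold X A \<longleftrightarrow>
     Hausdorff_space X \<and> second_countable X \<and>
     (\<forall>c\<in>A. topological_chart X c) \<and> (\<Union>c\<in>A. fst c) = topspace X \<and>
     (\<forall>c\<in>A. \<forall>c'\<in>A. smooth_on (snd c ` (fst c \<inter> fst c')) (snd c' \<circ> chart_inv c))"

definition smooth_map ::
  "'m topology \<Rightarrow> ('m, 'a::euclidean_space) atlas \<Rightarrow> 'n topology \<Rightarrow> ('n, 'b::euclidean_space) atlas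
    \<Rightarrow> ('m \<Rightarrow> 'n) \<Rightarrow> bool" where
  "smooth_map X A Y B F \<longleftrightarrow> continuous_map X Y F \<and>
     (\<forall>c\<in>A. \<forall>c'\<in>B. smooth_on (snd c ` (fst c \<inter> F -` fst c')) (snd c' \<circ> F \<circ> chart_inv c))"

definition prod_atlas ::
  "('m, 'a) atlas \<Rightarrow> ('n, 'b) atlas \<Rightarrow> ('m \<times> 'n, 'a \<times> 'b) atlas" where
  "prod_atlas A B = {(fst c \<times> fst c', map_prod (snd c) (snd c')) | c c'. c \<in> A \<and> c' \<in> B}"

definition open_atlas :: "'a set \<Rightarrow> ('a, 'a) atlas" where
  "open_atlas S = {(S, id)}"


section \<open>Tangent vectors and differentials\<close>

definition charts_at :: "('m, 'a) atlas \<Rightarrow> 'm \<Rightarrow> ('m, 'a) chart set" where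
  "charts_at A x = {c \<in> A. x \<in> fst c}"

definition chart_at :: "('m, 'a) atlas \<Rightarrow> 'm \<Rightarrow> ('m, 'a) chart" where
  "chart_at A x = (SOME c. c \<in> charts_at A x)"

text \<open>
  A tangent vector at \<open>x\<close> is the family of its coordinate vectors, one for each chart at \<open>x\<close>, which
  are related by the derivatives of the transition maps (and are normalised to \<open>0\<close> for the charts
  that do not contain \<open>x\<close>).
\<close>

type_synonym ('m, 'a) tvec = "('m, 'a) chart \<Rightarrow> 'a"

definition tangent_space ::
  "('m, 'a::euclidean_space) atlas \<Rightarrow> 'm \<Rightarrow> ('m, 'a) tvec set" where
  "tangent_space A x = {\<xi>.
     (\<forall>c\<in>charts_at A x. \<forall>c'\<in>charts_at A x.
        \<xi> c' = frechet_derivative (snd c' \<circ> chart_inv c) (at (snd c x)) (\<xi> c)) \<and>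
     (\<forall>c. c \<notin> charts_at A x \<longrightarrow> \<xi> c = 0)}"

definition tvec_of ::
  "('m, 'a::euclidean_space) atlas \<Rightarrow> ('m, 'a) chart \<Rightarrow> 'm \<Rightarrow> 'a \<Rightarrow> ('m, 'a) tvec" where
  "tvec_of A c x u = (\<lambda>c'. if c' \<in> charts_at A x
     then frechet_derivative (snd c' \<circ> chart_inv c) (at (snd c x)) u else 0)"

definition lincomb ::
  "real \<Rightarrow> ('m, 'a::real_vector) tvec \<Rightarrow> real \<Rightarrow> ('m, 'a) tvec \<Rightarrow> ('m, 'a) tvec" where
  "lincomb a \<xi> b \<eta> = (\<lambda>c. a *\<^sub>R \<xi> c + b *\<^sub>R \<eta> c)"

definition lin_indep :: "('m, 'a::real_vector) tvec \<Rightarrow> ('m, 'a) tvec \<Rightarrow> bool" where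
  "lin_indep \<xi> \<eta> \<longleftrightarrow> (\<forall>a b. lincomb a \<xi> b \<eta> = (\<lambda>_. 0) \<longrightarrow> a = 0 \<and> b = 0)"

definition differential ::
  "('m, 'a::euclidean_space) atlas \<Rightarrow> ('n, 'b::euclidean_space) atlas \<Rightarrow> ('m \<Rightarrow> 'n) \<Rightarrow> 'm
    \<Rightarrow> ('m, 'a) tvec \<Rightarrow> ('n, 'b) tvec" where
  "differential A B F x \<xi> = (\<lambda>c'. if c' \<in> charts_at B (F x)
     then (let c = chart_at A x in
       frechet_derivative (snd c' \<circ> F \<circ> chart_inv c) (at (snd c x)) (\<xi> c))
     else 0)"

definition dfun ::
  "('m, 'a::euclidean_space) atlas \<Rightarrow> ('m \<Rightarrow> real) \<Rightarrow> 'm \<Rightarrow> ('m, 'a) tvec \<Rightarrow> real" where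
  "dfun A f x \<xi> = (let c = chart_at A x in
     frechet_derivative (f \<circ> chart_inv c) (at (snd c x)) (\<xi> c))"

definition velocity ::
  "('m, 'a::euclidean_space) atlas \<Rightarrow> (real \<Rightarrow> 'm) \<Rightarrow> real \<Rightarrow> ('m, 'a) tvec" where
  "velocity A \<gamma> t = (\<lambda>c. if c \<in> charts_at A (\<gamma> t)
     then vector_derivative (snd c \<circ> \<gamma>) (at t) else 0)"


section \<open>Metrics and sectional curvature\<close>

type_synonym ('m, 'a) metric = "'m \<Rightarrow> ('m, 'a) tvec \<Rightarrow> ('m, 'a) tvec \<Rightarrow> real"

definition metric_coord ::
  "('m, 'a::euclidean_space) atlas \<Rightarrow> ('m, 'a) metric \<Rightarrow> ('m, 'a) chart \<Rightarrow> 'a \<Rightarrow> 'a \<Rightarrow> 'a \<Rightarrow> real" where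
  "metric_coord A g c p u v =
     g (chart_inv c p) (tvec_of A c (chart_inv c p) u) (tvec_of A c (chart_inv c p) v)"

definition pseudo_riemannian ::
  "'m topology \<Rightarrow> ('m, 'a::euclidean_space) atlas \<Rightarrow> ('m, 'a) metric \<Rightarrow> bool" where
  "pseudo_riemannian X A g \<longleftrightarrow>
     (\<forall>x\<in>topspace X.
        (\<forall>\<xi>\<in>tangent_space A x. \<forall>\<eta>\<in>tangent_space A x. g x \<xi> \<eta> = g x \<eta> \<xi>) \<and>
        (\<forall>\<xi>\<in>tangent_space A x. \<forall>\<eta>\<in>tangent_space A x. \<forall>\<zeta>\<in>tangent_space A x. \<forall>a b.
           g x (lincomb a \<xi> b \<eta>) \<zeta> = a * g x \<xi> \<zeta> + b * g x \<eta> \<zeta>) \<and>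
        (\<forall>\<xi>\<in>tangent_space A x. (\<forall>\<eta>\<in>tangent_space A x. g x \<xi> \<eta> = 0) \<longrightarrow> \<xi> = (\<lambda>_. 0))) \<and>
     (\<forall>c\<in>A. \<forall>u v. smooth_on (snd c ` fst c) (\<lambda>p. metric_coord A g c p u v))"

definition definite_metric ::
  "'m topology \<Rightarrow> ('m, 'a::euclidean_space) atlas \<Rightarrow> ('m, 'a) metric \<Rightarrow> bool" where
  "definite_metric X A g \<longleftrightarrow>
     (\<forall>x\<in>topspace X. \<forall>\<xi>\<in>tangent_space A x. \<xi> \<noteq> (\<lambda>_. 0) \<longrightarrow> g x \<xi> \<xi> > 0) \<or>
     (\<forall>x\<in>topspace X. \<forall>\<xi>\<in>tangent_space A x. \<xi> \<noteq> (\<lambda>_. 0) \<longrightarrow> g x \<xi> \<xi> < 0)"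

definition pullback ::
  "('m, 'a::euclidean_space) atlas \<Rightarrow> ('n, 'b::euclidean_space) atlas \<Rightarrow> ('m \<Rightarrow> 'n)
    \<Rightarrow> ('n, 'b) metric \<Rightarrow> ('m, 'a) metric" where
  "pullback A B F g = (\<lambda>x \<xi> \<eta>. g (F x) (differential A B F x \<xi>) (differential A B F x \<eta>))"

definition scale_metric :: "('m \<Rightarrow> real) \<Rightarrow> ('m, 'a) metric \<Rightarrow> ('m, 'a) metric" where
  "scale_metric h g = (\<lambda>x \<xi> \<eta>. h x * g x \<xi> \<eta>)"

text \<open>
  Local coordinates, with \<open>G p u v\<close> the value at the point \<open>p\<close> of the metric on \<open>u, v\<close>.
  \<open>christoffel G p u v\<close> is the Levi-Civita derivative \<open>\<nabla>\<^sub>u v\<close> of coordinate-constant vector fields,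
  given by the Koszul formula
  \<open>2 G(\<nabla>\<^sub>u v, w) = \<partial>\<^sub>u G(v, w) + \<partial>\<^sub>v G(u, w) - \<partial>\<^sub>w G(u, v)\<close>;
  \<open>riemann G p u v w\<close> is \<open>R(u, v) w = \<nabla>\<^sub>u \<nabla>\<^sub>v w - \<nabla>\<^sub>v \<nabla>\<^sub>u w\<close> for such fields (whose brackets vanish).
  With this sign, round spheres have positive sectional curvature \<open>G(R(u, v) v, u) / \<dots>\<close>.
\<close>

definition christoffel ::
  "('a::euclidean_space \<Rightarrow> 'a \<Rightarrow> 'a \<Rightarrow> real) \<Rightarrow> 'a \<Rightarrow> 'a \<Rightarrow> 'a \<Rightarrow> 'a" where
  "christoffel G p u v = (THE z. \<forall>w. 2 * G p z w =
       frechet_derivative (\<lambda>q. G q v w) (at p) u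
     + frechet_derivative (\<lambda>q. G q u w) (at p) v
     - frechet_derivative (\<lambda>q. G q u v) (at p) w)"

definition riemann ::
  "('a::euclidean_space \<Rightarrow> 'a \<Rightarrow> 'a \<Rightarrow> real) \<Rightarrow> 'a \<Rightarrow> 'a \<Rightarrow> 'a \<Rightarrow> 'a \<Rightarrow> 'a" where
  "riemann G p u v w =
       frechet_derivative (\<lambda>q. christoffel G q v w) (at p) u
     - frechet_derivative (\<lambda>q. christoffel G q u w) (at p) v
     + christoffel G p u (christoffel G p v w)
     - christoffel G p v (christoffel G p u w)"

definition sectional_coord ::
  "('a::euclidean_space \<Rightarrow> 'a \<Rightarrow> 'a \<Rightarrow> real) \<Rightarrow> 'a \<Rightarrow> 'a \<Rightarrow> 'a \<Rightarrow> real" where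
  "sectional_coord G p u v =
     G p (riemann G p u v v) u / (G p u u * G p v v - (G p u v)\<^sup>2)"

text \<open>
  The sectional curvature does not depend on the chart; it is evaluated in the chosen chart at \<open>x\<close>.
\<close>

definition sectional_curvature ::
  "('m, 'a::euclidean_space) atlas \<Rightarrow> ('m, 'a) metric \<Rightarrow> 'm \<Rightarrow> ('m, 'a) tvec \<Rightarrow> ('m, 'a) tvec \<Rightarrow> real"
  where
  "sectional_curvature A g x \<xi> \<eta> = (let c = chart_at A x in
     sectional_coord (metric_coord A g c) (snd c x) (\<xi> c) (\<eta> c))"

text \<open>
  All values of the sectional curvature at points of \<open>S\<close>, where \<open>g\<close> is a definite metric near every
  point of \<open>S\<close>, so that every tangent plane is nondegenerate.
\<close>

definition sectional_curvatures ::
  "('m, 'a::euclidean_space) atlas \<Rightarrow> 'm set \<Rightarrow> ('m, 'a) metric \<Rightarrow> real set" where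
  "sectional_curvatures A S g = {sectional_curvature A g x \<xi> \<eta> | x \<xi> \<eta>.
     x \<in> S \<and> \<xi> \<in> tangent_space A x \<and> \<eta> \<in> tangent_space A x \<and> lin_indep \<xi> \<eta>}"


section \<open>Embedded submanifolds\<close>

text \<open>
  The charts of a subset \<open>N\<close> are the topological charts of \<open>N\<close> whose inverse is a smooth immersion
  into the ambient manifold.  For an embedded submanifold this is its unique maximal atlas.
  Model types have dimension at least \<open>1\<close>: if \<open>N\<close> is a hypersurface of a curve, hence of dimension
  \<open>0\<close>, the atlas is empty, and there are no tangent planes on either manifold.
\<close>

definition submanifold_atlas ::
  "'m topology \<Rightarrow> ('m, 'a::euclidean_space) atlas \<Rightarrow> 'm set \<Rightarrow> ('m, 'b::euclidean_space) atlas" where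
  "submanifold_atlas X A N = {d. topological_chart (subtopology X N) d \<and>
     smooth_map (top_of_set (snd d ` fst d)) (open_atlas (snd d ` fst d)) X A (chart_inv d) \<and>
     (\<forall>y\<in>fst d. \<forall>c\<in>charts_at A y.
        inj (frechet_derivative (snd c \<circ> chart_inv d) (at (snd d y))))}"


section \<open>Homogeneous pairs\<close>

definition smooth_free_action ::
  "'m topology \<Rightarrow> ('m, 'a::euclidean_space) atlas \<Rightarrow> (real \<Rightarrow> 'm \<Rightarrow> 'm) \<Rightarrow> bool" where
  "smooth_free_action X A m \<longleftrightarrow>
     smooth_map (prod_topology (top_of_set {0<..}) X) (prod_atlas (open_atlas {0<..}) A) X A
       (\<lambda>(t, x). m t x) \<and>
     (\<forall>x\<in>topspace X. m 1 x = x) \<and>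
     (\<forall>s>0. \<forall>t>0. \<forall>x\<in>topspace X. m s (m t x) = m (s * t) x) \<and>
     (\<forall>t>0. \<forall>x\<in>topspace X. m t x = x \<longrightarrow> t = 1)"

definition euler_field ::
  "('m, 'a::euclidean_space) atlas \<Rightarrow> (real \<Rightarrow> 'm \<Rightarrow> 'm) \<Rightarrow> 'm \<Rightarrow> ('m, 'a) tvec" where
  "euler_field A m x = velocity A (\<lambda>t. m (exp t) x) 0"

definition homogeneous_pair ::
  "'m topology \<Rightarrow> ('m, 'a::euclidean_space) atlas \<Rightarrow> (real \<Rightarrow> 'm \<Rightarrow> 'm) \<Rightarrow> real
    \<Rightarrow> ('m, 'a) metric \<Rightarrow> ('m \<Rightarrow> real) \<Rightarrow> bool" where
  "homogeneous_pair X A m \<alpha> g f \<longleftrightarrow>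
     \<alpha> \<noteq> 0 \<and> pseudo_riemannian X A g \<and>
     smooth_map X A (top_of_set {0<..}) (open_atlas {0<..}) f \<and>
     (\<forall>t>0. \<forall>x\<in>topspace X. \<forall>\<xi>\<in>tangent_space A x. \<forall>\<eta>\<in>tangent_space A x.
        pullback A A (m t) g x \<xi> \<eta> = t powr \<alpha> * g x \<xi> \<eta>) \<and>
     (\<forall>t>0. \<forall>x\<in>topspace X. f (m t x) = t powr \<alpha> * f x) \<and>
     (\<forall>x\<in>topspace X. \<forall>\<xi>\<in>tangent_space A x. g x (euler_field A m x) \<xi> = dfun A f x \<xi>)"

definition level_set :: "'m topology \<Rightarrow> ('m \<Rightarrow> real) \<Rightarrow> real \<Rightarrow> 'm set" where
  "level_set X f l = {x \<in> topspace X. f x = l}"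


section \<open>The conformal factors\<close>

definition Delta1 :: "(real \<times> real \<times> real) set" where
  "Delta1 = {(s, C1, C2). s > 0 \<and> C1 > 0}"

definition Delta2 :: "(real \<times> real \<times> real) set" where
  "Delta2 = {(s, C1, C2). s = 0 \<and> C1 \<ge> 0}"

definition Delta3 :: "(real \<times> real \<times> real) set" where
  "Delta3 = {(s, C1, C2). s < 0 \<and> C1 \<le> 0}"

text \<open>\<open>\<sigma> \<in> {1, -1}\<close> is the free choice of sign in the case \<open>s = 0\<close>.\<close>

definition w_fun :: "real \<Rightarrow> real \<Rightarrow> real \<Rightarrow> real \<Rightarrow> real \<Rightarrow> real" where
  "w_fun \<sigma> s C1 C2 r =
     (if s > 0 then C1 / (s * (cosh (sqrt C1 * (ln r + C2)))\<^sup>2)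
      else if s = 0 then exp C2 * r powr (\<sigma> * 2 * sqrt C1)
      else if C1 < 0 then C1 / (s * (sin (sqrt (- C1) * (ln r + C2)))\<^sup>2)
      else - 1 / (s * (ln r + C2)\<^sup>2))"

text \<open>The set of \<open>r > 0\<close> at which the expression for \<open>w\<close> has no vanishing denominator.\<close>

definition w_dom :: "real \<Rightarrow> real \<Rightarrow> real \<Rightarrow> real set" where
  "w_dom s C1 C2 = {r. r > 0 \<and>
     (s < 0 \<longrightarrow> (if C1 < 0 then sin (sqrt (- C1) * (ln r + C2)) \<noteq> 0 else ln r + C2 \<noteq> 0))}"

definition v_fun :: "real \<Rightarrow> real \<Rightarrow> real \<Rightarrow> real \<Rightarrow> real \<Rightarrow> real" where
  "v_fun \<sigma> s C1 C2 r = 1 / r * w_fun \<sigma> s C1 C2 r"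

end

theory Submission
  imports Defs
begin

text \<open>
  Flowing out of \<open>M\<^sub>l\<close> along \<open>(q, t) \<mapsto> m(e\<^sup>t, q)\<close> brings \<open>g\<close> into the form \<open>e\<^bsup>\<alpha>t\<^esup> (g\<^sub>l + \<alpha> l dt\<^sup>2)\<close>, so that
  \<open>(v \<circ> f) g = \<rho>(t) (g\<^sub>l + \<alpha> l dt\<^sup>2)\<close> with \<open>\<rho>(t) = w(l e\<^bsup>\<alpha>t\<^esup>) / l\<close>.  Put \<open>s = C / \<alpha>\<close> and \<open>y = r w' / w\<close>.  In all
  cases \<open>r y' = - 2 s w\<close> and \<open>y\<^sup>2 = 4 (C\<^sub>1 - s w)\<close>.  Substituted into the curvature of a conformally product
  metric, these two equations turn \<open>K - C\<close>, for a plane whose projection to \<open>T M\<^sub>l\<close> is spanned by \<open>u\<close> and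
  \<open>u'\<close>, into a positive multiple of \<open>R\<^sub>l(u, u', u', u) - (\<alpha> C\<^sub>1 / l) \<bar>u \<and> u'\<bar>\<^sup>2\<close>.  This vanishes if \<open>u\<close> and \<open>u'\<close>
  are dependent, and otherwise has the sign of \<open>l K\<^sub>l - \<alpha> C\<^sub>1\<close>.
\<close>


section \<open>Calculus of maps of class Ck\<close>

text \<open>The product form has three causes: the action scales g, which gives the exponential
  factor; g(P, P) = df(P) = \<alpha> f; and g(P, .) = df vanishes on vectors tangent to a level set.
  Put \<kappa> = \<alpha> l and \<eta> = \<rho>' / (2 \<rho>), and let A and \<rho>^2 (A + \<kappa>
  B) be the Gram determinants of the projected plane and of the plane. The curvature numerator is
  \<rho> (R_l - \<eta>' B - \<eta>^2 A / \<kappa>). Subtracting C \<rho>^2 (A + \<kappa> B) removes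
  B exactly when \<eta>' = - C \<kappa> \<rho>, and then \<eta>^2 / \<kappa> + C \<rho> has
  derivative 0. The equation for y' is that condition, and C1 is the constant up to the factor
  \<alpha> / l; C2 translates log r, or sets the scale if s = 0. Curvature is evaluated in the chart
  chosen at each point, but the product form lives in the coordinates (q, t), so naturality under
  local diffeomorphisms is needed. On M_l it is avoided by taking q from the very chart chosen
  there. That M_l has charts at all must be proved.\<close>

abbreviation fderiv :: "('a::real_normed_vector \<Rightarrow> 'b::real_normed_vector) \<Rightarrow> 'a \<Rightarrow> 'a \<Rightarrow> 'b" where
  "fderiv f p \<equiv> frechet_derivative f (at p)"

lemma fderiv_eq: "(f has_derivative f') (at p) \<Longrightarrow> fderiv f p = f'"
  by (metis frechet_derivative_at)

lemma has_fderiv: "f differentiable at p \<Longrightarrow> (f has_derivative fderiv f p) (at p)"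
  by (simp add: frechet_derivative_works)

lemma fderiv_cong:
  assumes "open S" "p \<in> S" "\<And>q. q \<in> S \<Longrightarrow> f q = g q" "f differentiable at p"
  shows "fderiv f p = fderiv g p"
  using frechet_derivative_transform_within_open[OF assms(4,1,2)] assms(3) by simp

lemma Ck_on_cong:
  assumes "open S" "\<And>x. x \<in> S \<Longrightarrow> f x = g x" "Ck_on k f S"
  shows "Ck_on k g S"
  using assms(2,3)
proof (induction k arbitrary: f g)
  case 0
  then show ?case by (auto cong: continuous_on_cong)
next
  case (Suc k)
  have f: "f differentiable at x" if "x \<in> S" for x
    using Suc.prems(2) that by simp
  have "(g has_derivative fderiv f x) (at x)" if "x \<in> S" for x
    by (rule has_derivative_transform_within_open[OF has_fderiv[OF f[OF that]] \<open>open S\<close> that])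
       (simp add: Suc.prems(1))
  moreover have "Ck_on k (\<lambda>x. fderiv g x v) S" for v
  proof (rule Suc.IH)
    show "fderiv f x v = fderiv g x v" if "x \<in> S" for x
      using fderiv_cong[OF \<open>open S\<close> that Suc.prems(1) f[OF that]] by simp
    show "Ck_on k (\<lambda>x. fderiv f x v) S"
      using Suc.prems(2) by simp
  qed
  ultimately show ?case by (auto simp: differentiable_def)
qed

lemma Ck_on_SucI:
  assumes "open S" "\<And>x. x \<in> S \<Longrightarrow> (f has_derivative f' x) (at x)"
    and "\<And>v. Ck_on k (\<lambda>x. f' x v) S"
  shows "Ck_on (Suc k) f S"
proof -
  have "Ck_on k (\<lambda>x. fderiv f x v) S" for v
    by (rule Ck_on_cong[OF assms(1) _ assms(3)[of v]]) (simp add: fderiv_eq[OF assms(2)])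
  then show ?thesis
    using assms(2) by (auto simp: differentiable_def)
qed

lemma Ck_on_SucD: "Ck_on (Suc k) f S \<Longrightarrow> Ck_on k f S"
proof (induction k arbitrary: f)
  case 0
  then show ?case
    by (auto intro!: continuous_at_imp_continuous_on differentiable_imp_continuous_within)
next
  case (Suc k)
  then show ?case by (metis Ck_on.simps(2))
qed

lemma Ck_on_le: "Ck_on k f S \<Longrightarrow> j \<le> k \<Longrightarrow> Ck_on j f S"
  by (induction k) (auto simp: le_Suc_eq dest: Ck_on_SucD simp del: Ck_on.simps)

lemma Ck_on_continuous: "Ck_on k f S \<Longrightarrow> continuous_on S f"
  using Ck_on_le[of k f S 0] by simp

lemma Ck_on_subset: "Ck_on k f S \<Longrightarrow> T \<subseteq> S \<Longrightarrow> Ck_on k f T"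
  by (induction k arbitrary: f) (auto intro: continuous_on_subset)

lemma Ck_on_differentiable: "Ck_on (Suc k) f S \<Longrightarrow> x \<in> S \<Longrightarrow> f differentiable at x"
  by simp

lemma Ck_on_const [simp]: "Ck_on k (\<lambda>x. c) S"
  by (induction k arbitrary: c) auto

lemma Ck_on_linear: "open S \<Longrightarrow> bounded_linear f \<Longrightarrow> Ck_on k f S"
proof (cases k)
  case (Suc j)
  show "Ck_on k f S" if "open S" "bounded_linear f"
    unfolding Suc using that
    by (intro Ck_on_SucI[where f' = "\<lambda>_. f"]) (auto intro: bounded_linear_imp_has_derivative)
qed (auto intro: linear_continuous_on)

lemma Ck_on_add:
  "open S \<Longrightarrow> Ck_on k f S \<Longrightarrow> Ck_on k g S \<Longrightarrow> Ck_on k (\<lambda>x. f x + g x) S"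
proof (induction k arbitrary: f g)
  case 0
  then show ?case by (auto intro: continuous_intros)
next
  case (Suc k)
  show ?case
    by (rule Ck_on_SucI[where f' = "\<lambda>x v. fderiv f x v + fderiv g x v"])
       (use Suc in \<open>auto intro!: has_derivative_add has_fderiv\<close>)
qed

lemma Ck_on_sum:
  "open S \<Longrightarrow> (\<And>i. i \<in> I \<Longrightarrow> Ck_on k (f i) S) \<Longrightarrow> Ck_on k (\<lambda>x. \<Sum>i\<in>I. f i x) S"
  by (induction I rule: infinite_finite_induct) (auto intro: Ck_on_add)

lemma Ck_on_bilinear:
  assumes "bounded_bilinear pr"
  shows "open S \<Longrightarrow> Ck_on k f S \<Longrightarrow> Ck_on k g S \<Longrightarrow> Ck_on k (\<lambda>x. pr (f x) (g x)) S"
proof (induction k arbitrary: f g)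
  case 0
  then show ?case using assms by (auto intro: bounded_bilinear.continuous_on)
next
  case (Suc k)
  have fg: "Ck_on k f S" "Ck_on k g S"
    using Suc.prems Ck_on_SucD by blast+
  show ?case
  proof (rule Ck_on_SucI)
    show "((\<lambda>x. pr (f x) (g x)) has_derivative
        (\<lambda>v. pr (f x) (fderiv g x v) + pr (fderiv f x v) (g x))) (at x)" if "x \<in> S" for x
      using Suc.prems that
      by (intro bounded_bilinear.FDERIV[OF assms] has_fderiv) auto
    show "Ck_on k (\<lambda>x. pr (f x) (fderiv g x v) + pr (fderiv f x v) (g x)) S" for v
      using Suc fg by (intro Ck_on_add Suc.IH) auto
  qed (use Suc in auto)
qed

lemmas Ck_on_mult = Ck_on_bilinear[OF bounded_bilinear_mult]
lemmas Ck_on_scaleR = Ck_on_bilinear[OF bounded_bilinear_scaleR]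

lemma Ck_on_bounded_linear:
  assumes L: "bounded_linear L"
  shows "open S \<Longrightarrow> Ck_on k f S \<Longrightarrow> Ck_on k (\<lambda>x. L (f x)) S"
proof (induction k arbitrary: f)
  case 0
  then show ?case using L by (auto intro: bounded_linear.continuous_on)
next
  case (Suc k)
  show ?case
    by (rule Ck_on_SucI[where f' = "\<lambda>x v. L (fderiv f x v)"])
       (use Suc in \<open>auto intro!: bounded_linear.has_derivative[OF L] has_fderiv\<close>)
qed

lemma Ck_on_minus: "open S \<Longrightarrow> Ck_on k f S \<Longrightarrow> Ck_on k (\<lambda>x. - f x) S"
  by (rule Ck_on_bounded_linear[OF bounded_linear_minus[OF bounded_linear_ident]])

lemma Ck_on_diff:
  "open S \<Longrightarrow> Ck_on k f S \<Longrightarrow> Ck_on k g S \<Longrightarrow> Ck_on k (\<lambda>x. f x - g x) S"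
  using Ck_on_add[of S k f "\<lambda>x. - g x"] Ck_on_minus[of S k g] by simp

lemma Ck_on_Pair:
  "open S \<Longrightarrow> Ck_on k f S \<Longrightarrow> Ck_on k g S \<Longrightarrow> Ck_on k (\<lambda>x. (f x, g x)) S"
proof (induction k arbitrary: f g)
  case 0
  then show ?case by (auto intro: continuous_intros)
next
  case (Suc k)
  show ?case
    by (rule Ck_on_SucI[where f' = "\<lambda>x v. (fderiv f x v, fderiv g x v)"])
       (use Suc in \<open>auto intro!: has_derivative_Pair has_fderiv\<close>)
qed

lemma linear_expand:
  fixes F :: "'a::euclidean_space \<Rightarrow> 'b::real_vector"
  assumes "linear F"
  shows "F u = (\<Sum>i\<in>Basis. (u \<bullet> i) *\<^sub>R F i)"
proof -
  have "F u = F (\<Sum>i\<in>Basis. (u \<bullet> i) *\<^sub>R i)"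
    by (simp only: euclidean_representation)
  also have "\<dots> = (\<Sum>i\<in>Basis. (u \<bullet> i) *\<^sub>R F i)"
    by (subst linear_sum[OF assms]) (intro sum.cong refl linear_scale[OF assms])
  finally show ?thesis .
qed

text \<open>\<open>Ck_on\<close> knows a derivative only through its values at fixed vectors.
  Expanding \<open>a x\<close> in the basis writes the value at a moving vector as a finite sum of
  products, so no norm on a space of linear maps is involved.\<close>

lemma Ck_on_linear_apply:
  fixes a :: "'a::euclidean_space \<Rightarrow> 'b::euclidean_space"
  assumes "open S" "\<And>x. x \<in> S \<Longrightarrow> linear (F x)" "\<And>u. Ck_on k (\<lambda>x. F x u) S" "Ck_on k a S"
  shows "Ck_on k (\<lambda>x. F x (a x)) S"
proof (rule Ck_on_cong[OF \<open>open S\<close>])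
  have "Ck_on k (\<lambda>x. a x \<bullet> i) S" for i
    by (rule Ck_on_bounded_linear[OF bounded_linear_inner_left assms(1,4)])
  then show "Ck_on k (\<lambda>x. \<Sum>i\<in>Basis. (a x \<bullet> i) *\<^sub>R F x i) S"
    by (intro Ck_on_sum Ck_on_scaleR assms)
  show "(\<Sum>i\<in>Basis. (a x \<bullet> i) *\<^sub>R F x i) = F x (a x)" if "x \<in> S" for x
    by (rule linear_expand[OF assms(2)[OF that], symmetric])
qed

text \<open>The derivative of the composite applies \<open>fderiv f (g x)\<close> to the moving
  vector \<open>fderiv g x v\<close>, which is the situation of \<open>Ck_on_linear_apply\<close>.
  The induction generalizes over \<open>f\<close> because its directional derivatives replace it,
  while \<open>g\<close> stays the same map.\<close>

lemma Ck_on_compose: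
  fixes g :: "'a::euclidean_space \<Rightarrow> 'b::euclidean_space"
  assumes "open S" "open T" "g ` S \<subseteq> T"
  shows "Ck_on k f T \<Longrightarrow> Ck_on k g S \<Longrightarrow> Ck_on k (\<lambda>x. f (g x)) S"
proof (induction k arbitrary: f)
  case 0
  then show ?case
    using assms continuous_on_compose2[of T f S g] by auto
next
  case (Suc k)
  have d: "f differentiable at (g x)" "g differentiable at x" if "x \<in> S" for x
    using Suc.prems that assms by auto
  show ?case
  proof (rule Ck_on_SucI[OF \<open>open S\<close>])
    show "((\<lambda>x. f (g x)) has_derivative (\<lambda>v. fderiv f (g x) (fderiv g x v))) (at x)"
      if "x \<in> S" for x
      using has_derivative_compose[OF has_fderiv[OF d(2)] has_fderiv[OF d(1)]] that by simp
    show "Ck_on k (\<lambda>x. fderiv f (g x) (fderiv g x v)) S" for v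
    proof (rule Ck_on_linear_apply[OF \<open>open S\<close>])
      show "linear (fderiv f (g x))" if "x \<in> S" for x
        using d(1)[OF that] by (rule linear_frechet_derivative)
      show "Ck_on k (\<lambda>x. fderiv f (g x) u) S" for u
        by (rule Suc.IH) (use Suc.prems Ck_on_SucD in auto)
    qed (use Suc.prems in simp)
  qed
qed

lemma Ck_on_has_field_derivative:
  assumes "open S" "\<And>x. x \<in> S \<Longrightarrow> (f has_field_derivative f' x) (at x)" "Ck_on k f' S"
  shows "Ck_on (Suc k) (f :: real \<Rightarrow> real) S"
  using assms
  by (intro Ck_on_SucI[where f' = "\<lambda>x v. f' x * v"]) (auto simp: has_field_derivative_def intro!: Ck_on_mult)

lemma Ck_on_powr: "Ck_on k (\<lambda>x::real. x powr a) {0<..}"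
proof (induction k arbitrary: a)
  case 0
  then show ?case by (auto intro!: continuous_intros)
next
  case (Suc k)
  show ?case
    by (rule Ck_on_has_field_derivative[where f' = "\<lambda>x. a * x powr (a - 1)"])
       (auto intro!: Ck_on_mult Suc has_real_derivative_powr)
qed

lemma Ck_on_exp: "Ck_on k (exp :: real \<Rightarrow> real) UNIV"
proof (induction k)
  case (Suc k)
  then show ?case by (intro Ck_on_has_field_derivative[where f' = exp]) auto
qed (auto intro: continuous_intros)

lemma Ck_on_chain:
  fixes g :: "'a::euclidean_space \<Rightarrow> 'b::euclidean_space"
  assumes "open S" "open T" "\<And>x. x \<in> S \<Longrightarrow> g x \<in> T" "Ck_on k f T" "Ck_on k g S"
  shows "Ck_on k (\<lambda>x. f (g x)) S"
  using Ck_on_compose[OF assms(1,2) _ assms(4,5)] assms(3) by blast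

lemma smooth_on_Ck: "smooth_on S f \<Longrightarrow> Ck_on k f S"
  by (simp add: smooth_on_def)

lemma smooth_on_differentiable: "smooth_on S f \<Longrightarrow> x \<in> S \<Longrightarrow> f differentiable at x"
  using Ck_on_differentiable smooth_on_Ck by blast

section \<open>Symmetry of second derivatives\<close>

lemma second_difference_mean_value:
  fixes f :: "'a::euclidean_space \<Rightarrow> real"
  assumes h: "h > 0" and C2: "Ck_on 2 f S"
    and S: "\<And>s t. 0 \<le> s \<Longrightarrow> s \<le> h \<Longrightarrow> 0 \<le> t \<Longrightarrow> t \<le> h \<Longrightarrow> p + s *\<^sub>R u + t *\<^sub>R v \<in> S"
  shows "\<exists>s t. 0 < s \<and> s < h \<and> 0 < t \<and> t < h \<and>
     f (p + h *\<^sub>R u + h *\<^sub>R v) - f (p + h *\<^sub>R u) - f (p + h *\<^sub>R v) + f p =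
       h * (h * fderiv (\<lambda>q. fderiv f q u) (p + s *\<^sub>R u + t *\<^sub>R v) v)"
proof -
  have d1: "f differentiable at q" "(\<lambda>q. fderiv f q u) differentiable at q" if "q \<in> S" for q
    using C2 that by (auto simp: numeral_2_eq_2)
  have der: "((\<lambda>s. F (a + s *\<^sub>R x)) has_real_derivative fderiv F (a + s *\<^sub>R x) x) (at s)"
    if "F differentiable at (a + s *\<^sub>R x)" for F :: "'a \<Rightarrow> real" and a x s
  proof -
    have "((\<lambda>s. a + s *\<^sub>R x) has_derivative (\<lambda>s. s *\<^sub>R x)) (at s)"
      by (auto intro!: derivative_eq_intros)
    from has_derivative_compose[OF this has_fderiv[OF that]]
    show ?thesis
      using linear_frechet_derivative[OF that]
      by (simp add: has_field_derivative_def linear_scale mult_commute_abs)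
  qed
  \<comment> \<open>The second difference is an increment of \<phi> in direction \<open>u\<close>;
    the mean value theorem leaves an increment of \<open>fderiv f _ u\<close> in direction
    \<open>v\<close>, to which it is applied again.\<close>
  define \<phi> where "\<phi> s = f (p + h *\<^sub>R v + s *\<^sub>R u) - f (p + s *\<^sub>R u)" for s
  have "\<exists>s. 0 < s \<and> s < h \<and> \<phi> h - \<phi> 0 = (h - 0) *
      (fderiv f (p + h *\<^sub>R v + s *\<^sub>R u) u - fderiv f (p + s *\<^sub>R u) u)"
    using h
  proof (rule MVT2)
    fix s assume "0 \<le> s" "s \<le> h"
    then have "p + h *\<^sub>R v + s *\<^sub>R u \<in> S" "p + s *\<^sub>R u \<in> S"
      using S[of s h] S[of s 0] h by (auto simp: algebra_simps)
    then show "DERIV \<phi> s :> fderiv f (p + h *\<^sub>R v + s *\<^sub>R u) u - fderiv f (p + s *\<^sub>R u) u"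
      unfolding \<phi>_def by (intro DERIV_diff der d1)
  qed
  then obtain s where s: "0 < s" "s < h"
    and s_eq: "\<phi> h - \<phi> 0 = h * (fderiv f (p + h *\<^sub>R v + s *\<^sub>R u) u - fderiv f (p + s *\<^sub>R u) u)"
    by auto
  have "\<exists>t. 0 < t \<and> t < h \<and> fderiv f (p + s *\<^sub>R u + h *\<^sub>R v) u - fderiv f (p + s *\<^sub>R u + 0 *\<^sub>R v) u
      = (h - 0) * fderiv (\<lambda>q. fderiv f q u) (p + s *\<^sub>R u + t *\<^sub>R v) v"
    using h
  proof (rule MVT2)
    fix t assume "0 \<le> t" "t \<le> h"
    then have "p + s *\<^sub>R u + t *\<^sub>R v \<in> S"
      using S s by auto
    then show "DERIV (\<lambda>t. fderiv f (p + s *\<^sub>R u + t *\<^sub>R v) u) t :>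
        fderiv (\<lambda>q. fderiv f q u) (p + s *\<^sub>R u + t *\<^sub>R v) v"
      by (intro der d1)
  qed
  then obtain t where t: "0 < t" "t < h"
    and t_eq: "fderiv f (p + s *\<^sub>R u + h *\<^sub>R v) u - fderiv f (p + s *\<^sub>R u) u
      = h * fderiv (\<lambda>q. fderiv f q u) (p + s *\<^sub>R u + t *\<^sub>R v) v"
    by auto
  have "f (p + h *\<^sub>R u + h *\<^sub>R v) - f (p + h *\<^sub>R u) - f (p + h *\<^sub>R v) + f p = \<phi> h - \<phi> 0"
    by (simp add: \<phi>_def algebra_simps)
  also have "\<dots> = h * (h * fderiv (\<lambda>q. fderiv f q u) (p + s *\<^sub>R u + t *\<^sub>R v) v)"
    using s_eq t_eq by (simp add: algebra_simps)
  finally show ?thesis using s t by blast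
qed

text \<open>The second difference does not change when \<open>u\<close> and \<open>v\<close> are
  exchanged, but the mean value theorem turns it into a value of one mixed derivative or of the
  other, depending on the order. So the two derivatives agree at two points of an arbitrarily small
  parallelogram, and continuity brings both points to \<open>p\<close>.\<close>

lemma symmetric_second_fderiv_real:
  fixes f :: "'a::euclidean_space \<Rightarrow> real"
  assumes "open S" "p \<in> S" and C2: "Ck_on 2 f S"
  shows "fderiv (\<lambda>q. fderiv f q u) p v = fderiv (\<lambda>q. fderiv f q v) p u"
proof -
  define A where "A q = fderiv (\<lambda>q. fderiv f q u) q v" for q
  define B where "B q = fderiv (\<lambda>q. fderiv f q v) q u" for q
  have cont: "continuous_on S A" "continuous_on S B"
    using C2 unfolding A_def B_def by (auto simp: numeral_2_eq_2)
  have "A p = B p"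
  proof (rule ccontr)
    assume ne: "A p \<noteq> B p"
    \<comment> \<open>No number is closer than half the gap to both \<open>A p\<close> and
      \<open>B p\<close>.\<close>
    define e where "e = \<bar>A p - B p\<bar> / 2"
    have "e > 0" using ne by (simp add: e_def)
    obtain d1 where d1: "d1 > 0" "\<And>q. q \<in> S \<Longrightarrow> dist q p < d1 \<Longrightarrow> dist (A q) (A p) < e"
      using cont(1) \<open>e > 0\<close> assms(2) unfolding continuous_on_iff by blast
    obtain d2 where d2: "d2 > 0" "\<And>q. q \<in> S \<Longrightarrow> dist q p < d2 \<Longrightarrow> dist (B q) (B p) < e"
      using cont(2) \<open>e > 0\<close> assms(2) unfolding continuous_on_iff by blast
    obtain d3 where d3: "d3 > 0" "ball p d3 \<subseteq> S"
      using assms openE by blast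
    define r where "r = min d3 (min d1 d2)"
    \<comment> \<open>Every point of the parallelogram is within h (|u| + |v|) < r of
      \<open>p\<close>; the added 1 keeps the denominator positive when \<open>u\<close> and
      \<open>v\<close> vanish.\<close>
    define h where "h = r / (2 * (norm u + norm v + 1))"
    have pos: "norm u + norm v + 1 > 0"
      by (simp add: add_nonneg_pos)
    have r: "r > 0" using d1 d2 d3 by (simp add: r_def)
    then have "h > 0" using pos by (simp add: h_def)
    have near: "dist (p + s *\<^sub>R x + t *\<^sub>R y) p < r"
      if "0 \<le> s" "s \<le> h" "0 \<le> t" "t \<le> h" "{x, y} = {u, v}" for s t x y
    proof -
      have "dist (p + s *\<^sub>R x + t *\<^sub>R y) p \<le> norm (s *\<^sub>R x) + norm (t *\<^sub>R y)"
        using norm_triangle_ineq[of "s *\<^sub>R x" "t *\<^sub>R y"] by (simp add: dist_norm add.assoc)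
      also have "\<dots> \<le> h * norm x + h * norm y"
        using that by (simp add: add_mono mult_right_mono)
      also have "\<dots> \<le> h * (norm u + norm v)"
        using that(5) \<open>h > 0\<close> by (auto simp: doubleton_eq_iff algebra_simps)
      also have "\<dots> < h * (2 * (norm u + norm v + 1))"
        using \<open>h > 0\<close> by (simp add: add_nonneg_pos)
      also have "\<dots> = r"
        using pos by (simp add: h_def)
      finally show ?thesis .
    qed
    have sub: "p + s *\<^sub>R x + t *\<^sub>R y \<in> S"
      if "0 \<le> s" "s \<le> h" "0 \<le> t" "t \<le> h" "{x, y} = {u, v}" for s t x y
      using near[OF that] d3 by (auto simp: r_def dist_commute)
    obtain s t where st: "0 < s" "s < h" "0 < t" "t < h"
      "f (p + h *\<^sub>R u + h *\<^sub>R v) - f (p + h *\<^sub>R u) - f (p + h *\<^sub>R v) + f p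
        = h * (h * A (p + s *\<^sub>R u + t *\<^sub>R v))"
      using second_difference_mean_value[OF \<open>h > 0\<close> C2 sub, of u v] unfolding A_def by auto
    obtain s' t' where st': "0 < s'" "s' < h" "0 < t'" "t' < h"
      "f (p + h *\<^sub>R v + h *\<^sub>R u) - f (p + h *\<^sub>R v) - f (p + h *\<^sub>R u) + f p
        = h * (h * B (p + s' *\<^sub>R v + t' *\<^sub>R u))"
      using second_difference_mean_value[OF \<open>h > 0\<close> C2 sub, of v u] unfolding B_def by auto
    have "h * (h * A (p + s *\<^sub>R u + t *\<^sub>R v)) = h * (h * B (p + s' *\<^sub>R v + t' *\<^sub>R u))"
      using st(5) st'(5) by (simp add: algebra_simps)
    then have AB: "A (p + s *\<^sub>R u + t *\<^sub>R v) = B (p + s' *\<^sub>R v + t' *\<^sub>R u)"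
      using \<open>h > 0\<close> by simp
    have "\<bar>A (p + s *\<^sub>R u + t *\<^sub>R v) - A p\<bar> < e" "\<bar>B (p + s' *\<^sub>R v + t' *\<^sub>R u) - B p\<bar> < e"
      using near[of s t u v] near[of s' t' v u] sub[of s t u v] sub[of s' t' v u] st st'
        d1(2)[of "p + s *\<^sub>R u + t *\<^sub>R v"] d2(2)[of "p + s' *\<^sub>R v + t' *\<^sub>R u"]
      by (auto simp: r_def dist_real_def)
    moreover have False if "\<bar>x - a\<bar> < \<bar>a - b\<bar> / 2" "\<bar>x - b\<bar> < \<bar>a - b\<bar> / 2" for x a b :: real
      using that by (auto simp: abs_if split: if_splits)
    ultimately show False
      unfolding AB e_def by blast
  qed
  then show ?thesis by (simp add: A_def B_def)
qed

lemma symmetric_second_fderiv: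
  fixes f :: "'a::euclidean_space \<Rightarrow> 'b::euclidean_space"
  assumes "open S" "p \<in> S" and C2: "Ck_on 2 f S"
  shows "fderiv (\<lambda>q. fderiv f q u) p v = fderiv (\<lambda>q. fderiv f q v) p u"
proof (rule euclidean_eqI)
  fix i :: 'b assume "i \<in> Basis"
  have d: "f differentiable at q" "(\<lambda>q. fderiv f q x) differentiable at q" if "q \<in> S" for q x
    using C2 that by (auto simp: numeral_2_eq_2)
  have c: "Ck_on 2 (\<lambda>q. f q \<bullet> i) S"
    by (rule Ck_on_bounded_linear[OF bounded_linear_inner_left \<open>open S\<close> C2])
  have e1: "fderiv (\<lambda>q. f q \<bullet> i) q x = fderiv f q x \<bullet> i" if "q \<in> S" for q x
    by (subst fderiv_eq[OF has_derivative_inner_left[OF has_fderiv[OF d(1)[OF that]]]]) simp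
  have e2: "fderiv (\<lambda>q. fderiv (\<lambda>q. f q \<bullet> i) q x) p y = fderiv (\<lambda>q. fderiv f q x) p y \<bullet> i" for x y
  proof -
    have "((\<lambda>q. fderiv f q x \<bullet> i) has_derivative (\<lambda>y. fderiv (\<lambda>q. fderiv f q x) p y \<bullet> i)) (at p)"
      by (rule has_derivative_inner_left[OF has_fderiv[OF d(2)[OF assms(2)]]])
    then have "((\<lambda>q. fderiv (\<lambda>q. f q \<bullet> i) q x) has_derivative
        (\<lambda>y. fderiv (\<lambda>q. fderiv f q x) p y \<bullet> i)) (at p)"
      by (rule has_derivative_transform_within_open[OF _ assms(1,2)]) (simp add: e1)
    then show ?thesis by (simp add: fderiv_eq)
  qed
  show "fderiv (\<lambda>q. fderiv f q u) p v \<bullet> i = fderiv (\<lambda>q. fderiv f q v) p u \<bullet> i"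
    using symmetric_second_fderiv_real[OF assms(1,2) c, of u v] by (simp add: e2)
qed


section \<open>Derivatives of multilinear expressions\<close>

text \<open>The sum is the Riesz vector of \<open>F\<close>; it serves to represent the Koszul
  expression and the differential of f as inner products.\<close>

lemma inner_sum_Basis_eq:
  fixes F :: "'a::euclidean_space \<Rightarrow> real"
  assumes "linear F"
  shows "(\<Sum>k\<in>Basis. F k *\<^sub>R k) \<bullet> w = F w"
proof -
  have "(\<Sum>k\<in>Basis. F k *\<^sub>R k) \<bullet> w = (\<Sum>k\<in>Basis. (w \<bullet> k) *\<^sub>R F k)"
    unfolding inner_sum_left by (intro sum.cong refl) (simp add: inner_commute)
  then show ?thesis
    by (simp only: linear_expand[OF assms, symmetric])
qed

text \<open>The product rule for a moving linear map and a moving vector, with \<open>F\<close>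
  known to be differentiable only at each fixed vector. Expansion in the basis reduces it to the
  rule for scalar multiples.\<close>

lemma has_derivative_linear_apply:
  fixes a :: "'c::real_normed_vector \<Rightarrow> 'a::euclidean_space" and F :: "'c \<Rightarrow> 'a \<Rightarrow> 'b::real_normed_vector"
  assumes S: "open S" "p \<in> S" and lin: "\<And>q. q \<in> S \<Longrightarrow> linear (F q)"
    and F: "\<And>u. ((\<lambda>q. F q u) has_derivative (\<lambda>x. F' x u)) (at p)"
    and a: "(a has_derivative a') (at p)"
  shows "((\<lambda>q. F q (a q)) has_derivative (\<lambda>x. F' x (a p) + F p (a' x))) (at p)"
proof -
  have *: "((\<lambda>q. \<Sum>i\<in>Basis. (a q \<bullet> i) *\<^sub>R F q i) has_derivative
     (\<lambda>x. \<Sum>i\<in>Basis. ((a p \<bullet> i) *\<^sub>R F' x i + (a' x \<bullet> i) *\<^sub>R F p i))) (at p)"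
    by (intro has_derivative_sum has_derivative_scaleR F has_derivative_inner_left a)
  have 1: "((\<lambda>q. F q (a q)) has_derivative
     (\<lambda>x. \<Sum>i\<in>Basis. ((a p \<bullet> i) *\<^sub>R F' x i + (a' x \<bullet> i) *\<^sub>R F p i))) (at p)"
    by (rule has_derivative_transform_within_open[OF * S]) (rule linear_expand[OF lin, symmetric])
  \<comment> \<open>The same expansion at a constant vector shows, by uniqueness of derivatives,
    that \<open>F' x\<close> inherits linearity from \<open>F q\<close>.\<close>
  have 2: "((\<lambda>q. F q u) has_derivative (\<lambda>x. \<Sum>i\<in>Basis. (u \<bullet> i) *\<^sub>R F' x i)) (at p)" for u
  proof -
    have "((\<lambda>q. \<Sum>i\<in>Basis. (u \<bullet> i) *\<^sub>R F q i) has_derivative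
        (\<lambda>x. \<Sum>i\<in>Basis. (u \<bullet> i) *\<^sub>R F' x i)) (at p)"
      by (intro has_derivative_sum has_derivative_scaleR_right F)
    then show ?thesis
      by (rule has_derivative_transform_within_open[OF _ S]) (rule linear_expand[OF lin, symmetric])
  qed
  have 3: "F' x (a p) = (\<Sum>i\<in>Basis. (a p \<bullet> i) *\<^sub>R F' x i)" for x
    using has_derivative_unique[OF F 2] by metis
  have "(\<lambda>x. F' x (a p) + F p (a' x)) =
     (\<lambda>x. \<Sum>i\<in>Basis. ((a p \<bullet> i) *\<^sub>R F' x i + (a' x \<bullet> i) *\<^sub>R F p i))"
    unfolding sum.distrib 3 linear_expand[OF lin[OF S(2)], of "a' _"] ..
  with 1 show ?thesis by simp
qed

lemma has_derivative_bilinear_apply: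
  fixes a :: "'c::real_normed_vector \<Rightarrow> 'a::euclidean_space"
    and b :: "'c \<Rightarrow> 'd::euclidean_space" and F :: "'c \<Rightarrow> 'a \<Rightarrow> 'd \<Rightarrow> 'b::real_normed_vector"
  assumes S: "open S" "p \<in> S"
    and lin: "\<And>q v. q \<in> S \<Longrightarrow> linear (\<lambda>u. F q u v)" "\<And>q u. q \<in> S \<Longrightarrow> linear (F q u)"
    and F: "\<And>u v. ((\<lambda>q. F q u v) has_derivative (\<lambda>x. F' x u v)) (at p)"
    and a: "(a has_derivative a') (at p)" and b: "(b has_derivative b') (at p)"
  shows "((\<lambda>q. F q (a q) (b q)) has_derivative
     (\<lambda>x. F' x (a p) (b p) + F p (a' x) (b p) + F p (a p) (b' x))) (at p)"
proof -
  have "((\<lambda>q. F q (a q) v) has_derivative (\<lambda>x. F' x (a p) v + F p (a' x) v)) (at p)" for v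
    by (rule has_derivative_linear_apply[where F = "\<lambda>q u. F q u v", OF S lin(1) F a])
  from has_derivative_linear_apply[where F = "\<lambda>q. F q (a q)", OF S lin(2) this b]
  show ?thesis .
qed

lemma has_derivative_trilinear_apply:
  fixes a :: "'c::real_normed_vector \<Rightarrow> 'a::euclidean_space"
    and b :: "'c \<Rightarrow> 'd::euclidean_space" and c :: "'c \<Rightarrow> 'e::euclidean_space"
    and F :: "'c \<Rightarrow> 'a \<Rightarrow> 'd \<Rightarrow> 'e \<Rightarrow> 'b::real_normed_vector"
  assumes S: "open S" "p \<in> S"
    and lin: "\<And>q v w. q \<in> S \<Longrightarrow> linear (\<lambda>u. F q u v w)" "\<And>q u w. q \<in> S \<Longrightarrow> linear (\<lambda>v. F q u v w)"
      "\<And>q u v. q \<in> S \<Longrightarrow> linear (F q u v)"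
    and F: "\<And>u v w. ((\<lambda>q. F q u v w) has_derivative (\<lambda>x. F' x u v w)) (at p)"
    and a: "(a has_derivative a') (at p)" and b: "(b has_derivative b') (at p)"
    and c: "(c has_derivative c') (at p)"
  shows "((\<lambda>q. F q (a q) (b q) (c q)) has_derivative
     (\<lambda>x. F' x (a p) (b p) (c p) + F p (a' x) (b p) (c p) + F p (a p) (b' x) (c p)
        + F p (a p) (b p) (c' x))) (at p)"
proof -
  have "((\<lambda>q. F q (a q) (b q) w) has_derivative
     (\<lambda>x. F' x (a p) (b p) w + F p (a' x) (b p) w + F p (a p) (b' x) w)) (at p)" for w
    by (rule has_derivative_bilinear_apply[where F = "\<lambda>q u v. F q u v w", OF S lin(1) lin(2) F a b])
  from has_derivative_linear_apply[where F = "\<lambda>q. F q (a q) (b q)", OF S lin(3) this c]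
  show ?thesis .
qed

text \<open>At a zero of \<open>k\<close> the product rule has no term with the derivative of
  \<open>a\<close>, so continuity of \<open>a\<close> is enough. This breaks the circle in
  \<open>linear_solution_differentiable\<close>, where \<open>a\<close> is a coordinate of the
  solution whose differentiability is sought.\<close>

lemma has_derivative_scaleR_vanishing:
  fixes k :: "'a::real_normed_vector \<Rightarrow> 'b::real_normed_vector" and a :: "'a \<Rightarrow> real"
  assumes a: "(a \<longlongrightarrow> a p) (at p)" and k: "(k has_derivative k') (at p)" and "k p = 0"
  shows "((\<lambda>q. a q *\<^sub>R k q) has_derivative (\<lambda>x. a p *\<^sub>R k' x)) (at p)"
proof -
  obtain d where d: "d > 0" "\<And>y. norm (y - p) < d \<Longrightarrow> norm (k y - k p - k' (y - p)) \<le> 1 * norm (y - p)"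
    using k unfolding has_derivative_at_alt by (metis zero_less_one)
  obtain B where B: "B > 0" "\<And>x. norm (k' x) \<le> norm x * B"
    using bounded_linear.pos_bounded[OF has_derivative_bounded_linear[OF k]] by blast
  have "((\<lambda>q. (a q - a p) *\<^sub>R k q) has_derivative (\<lambda>x. 0)) (at p)"
  proof (rule has_derivativeI_sandwich[OF d(1)])
    show "norm ((a y - a p) *\<^sub>R k y - (a p - a p) *\<^sub>R k p - 0) / norm (y - p) \<le> \<bar>a y - a p\<bar> * (B + 1)"
      if "y \<noteq> p" "dist y p < d" for y
    proof -
      have "norm (k y) \<le> norm (k y - k p - k' (y - p)) + norm (k' (y - p))"
        using norm_triangle_ineq[of "k y - k' (y - p)" "k' (y - p)"] \<open>k p = 0\<close> by simp
      also have "\<dots> \<le> (B + 1) * norm (y - p)"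
        using d(2)[of y] B(2)[of "y - p"] that by (simp add: dist_norm algebra_simps)
      finally have "\<bar>a y - a p\<bar> * norm (k y) \<le> \<bar>a y - a p\<bar> * ((B + 1) * norm (y - p))"
        by (rule mult_left_mono) simp
      then show ?thesis
        using that by (simp add: divide_le_eq mult.assoc)
    qed
    have "((\<lambda>y. \<bar>a y - a p\<bar> * (B + 1)) \<longlongrightarrow> \<bar>a p - a p\<bar> * (B + 1)) (at p)"
      by (intro tendsto_intros a)
    then show "((\<lambda>y. \<bar>a y - a p\<bar> * (B + 1)) \<longlongrightarrow> 0) (at p)"
      by simp
  qed auto
  from has_derivative_add[OF this has_derivative_scaleR_right[OF k, of "a p"]]
  show ?thesis by (simp add: algebra_simps)
qed

text \<open>Up to \<open>B (b q - b p)\<close>, with \<open>B\<close> a left inverse of \<open>F p\<close>, the difference \<open>z q - z p\<close> is a sum of products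
  of a continuous function and a differentiable one that vanishes at \<open>p\<close>.\<close>

lemma linear_solution_differentiable:
  fixes F :: "'c::real_normed_vector \<Rightarrow> 'a::euclidean_space \<Rightarrow> 'b::euclidean_space"
  assumes S: "open S" "p \<in> S" and lin: "\<And>q. q \<in> S \<Longrightarrow> linear (F q)" and inj: "inj (F p)"
    and F: "\<And>u. (\<lambda>q. F q u) differentiable at p" and b: "b differentiable at p"
    and sol: "\<And>q. q \<in> S \<Longrightarrow> F q (z q) = b q"
  shows "z differentiable at p"
proof -
  obtain B where B: "linear B" "B \<circ> F p = id"
    using linear_injective_left_inverse[OF lin[OF S(2)] inj] by blast
  note bB = linear_conv_bounded_linear[THEN iffD1, OF B(1)]
  obtain K where K: "K > 0" "\<And>x. norm (B x) \<le> norm x * K"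
    using bounded_linear.pos_bounded[OF bB] by blast
  have BF: "B (F p x) = x" for x
    using B(2) by (metis comp_apply id_apply)
  define \<delta> where "\<delta> q = (\<Sum>i\<in>Basis. norm (F q i - F p i))" for q
  have Fp: "F q x - F p x = (\<Sum>i\<in>Basis. (x \<bullet> i) *\<^sub>R (F q i - F p i))" if "q \<in> S" for q x
    unfolding linear_expand[OF lin[OF that], of x] linear_expand[OF lin[OF S(2)], of x]
    by (simp add: sum_subtractf scaleR_diff_right)
  have \<delta>: "norm (F q x - F p x) \<le> \<delta> q * norm x" if "q \<in> S" for q x
    unfolding Fp[OF that, of x] \<delta>_def sum_distrib_right
  proof (rule sum_norm_le)
    fix i :: 'a assume "i \<in> Basis"
    then have "\<bar>x \<bullet> i\<bar> * norm (F q i - F p i) \<le> norm x * norm (F q i - F p i)"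
      by (intro mult_right_mono Basis_le_norm) auto
    then show "norm ((x \<bullet> i) *\<^sub>R (F q i - F p i)) \<le> norm (F q i - F p i) * norm x"
      by (simp add: mult.commute)
  qed
  have diff: "z q - z p = B (b q - b p) - B (F q (z q) - F p (z q))" if "q \<in> S" for q
  proof -
    have "B (b q - b p) - B (F q (z q) - F p (z q)) = B (F p (z q)) - B (F p (z p))"
      using sol[OF that] sol[OF S(2)] by (simp add: linear_diff[OF B(1)])
    then show ?thesis by (simp add: BF)
  qed
  have tF: "((\<lambda>q. F q u) \<longlongrightarrow> F p u) (at p)" for u
    using differentiable_imp_continuous_within[OF F] by (simp add: continuous_within)
  have tb: "(b \<longlongrightarrow> b p) (at p)"
    using differentiable_imp_continuous_within[OF b] by (simp add: continuous_within)
  have "(\<delta> \<longlongrightarrow> (\<Sum>i\<in>Basis. norm (F p i - F p i))) (at p)"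
    unfolding \<delta>_def by (intro tendsto_intros tF)
  then have t\<delta>: "(\<delta> \<longlongrightarrow> 0) (at p)" by simp
  have ev: "\<forall>\<^sub>F q in at p. q \<in> S"
    using S by (simp add: eventually_at_in_open')
  have ev\<delta>: "\<forall>\<^sub>F q in at p. \<delta> q < 1 / (2 * K)"
    using order_tendstoD(2)[OF t\<delta>, of "1 / (2 * K)"] K(1) by simp
  \<comment> \<open>Continuity of \<open>z\<close> at \<open>p\<close> comes from the equation
    itself: near \<open>p\<close> the perturbation of \<open>F\<close> is so small against
    \<open>B\<close> that the term in |z q - z p| on the right is at most half of the left side and
    is absorbed.\<close>
  have bound: "\<forall>\<^sub>F q in at p. norm (z q - z p) \<le> 2 * K * (norm (b q - b p) + \<delta> q * norm (z p))"
    using ev ev\<delta>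
  proof eventually_elim
    case (elim q)
    have "norm (z q - z p) \<le> norm (B (b q - b p)) + norm (B (F q (z q) - F p (z q)))"
      unfolding diff[OF elim(1)] by (rule norm_triangle_ineq4)
    also have "\<dots> \<le> norm (b q - b p) * K + (\<delta> q * norm (z q)) * K"
      using \<delta>[OF elim(1)] K by (intro add_mono order_trans[OF K(2)] mult_right_mono) auto
    also have "\<dots> \<le> norm (b q - b p) * K + (\<delta> q * (norm (z p) + norm (z q - z p))) * K"
    proof -
      have "\<delta> q \<ge> 0" by (simp add: \<delta>_def sum_nonneg)
      moreover have "norm (z q) \<le> norm (z p) + norm (z q - z p)"
        using norm_triangle_ineq[of "z p" "z q - z p"] by simp
      ultimately show ?thesis
        using K(1) by (intro add_left_mono mult_right_mono mult_left_mono) auto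
    qed
    finally have "norm (z q - z p) \<le>
        K * (norm (b q - b p) + \<delta> q * norm (z p)) + (\<delta> q * K) * norm (z q - z p)"
      by (simp add: algebra_simps)
    moreover have "(\<delta> q * K) * norm (z q - z p) \<le> (1 / 2) * norm (z q - z p)"
      using elim(2) K(1) by (intro mult_right_mono) (auto simp: field_simps)
    ultimately show ?case by simp
  qed
  have "((\<lambda>q. 2 * K * (norm (b q - b p) + \<delta> q * norm (z p))) \<longlongrightarrow>
      2 * K * (norm (b p - b p) + 0 * norm (z p))) (at p)"
    by (intro tendsto_intros tb t\<delta>)
  then have "((\<lambda>q. 2 * K * (norm (b q - b p) + \<delta> q * norm (z p))) \<longlongrightarrow> 0) (at p)"
    by simp
  from Lim_null_comparison[OF bound this] have tz: "(z \<longlongrightarrow> z p) (at p)"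
    by (simp add: LIM_zero_iff)
  have z_eq: "z q = z p + B (b q - b p) - (\<Sum>i\<in>Basis. (z q \<bullet> i) *\<^sub>R B (F q i - F p i))" if "q \<in> S" for q
  proof -
    have "B (F q (z q) - F p (z q)) = (\<Sum>i\<in>Basis. (z q \<bullet> i) *\<^sub>R B (F q i - F p i))"
      unfolding Fp[OF that, of "z q"] linear_sum[OF B(1)] linear_scale[OF B(1)] ..
    with diff[OF that] show ?thesis by (simp add: algebra_simps)
  qed
  have "((\<lambda>q. (z q \<bullet> i) *\<^sub>R B (F q i - F p i)) has_derivative
      (\<lambda>x. (z p \<bullet> i) *\<^sub>R B (fderiv (\<lambda>q. F q i) p x))) (at p)" for i
  proof (rule has_derivative_scaleR_vanishing)
    show "((\<lambda>q. z q \<bullet> i) \<longlongrightarrow> z p \<bullet> i) (at p)"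
      by (intro tendsto_intros tz)
    have "((\<lambda>q. F q i - F p i) has_derivative fderiv (\<lambda>q. F q i) p) (at p)"
      using has_derivative_diff[OF has_fderiv[OF F] has_derivative_const[of "F p i"]] by simp
    then show "((\<lambda>q. B (F q i - F p i)) has_derivative (\<lambda>x. B (fderiv (\<lambda>q. F q i) p x))) (at p)"
      by (rule bounded_linear.has_derivative[OF bB])
  qed (simp add: linear_0[OF B(1)])
  then have d1: "(\<lambda>q. \<Sum>i\<in>Basis. (z q \<bullet> i) *\<^sub>R B (F q i - F p i)) differentiable at p"
    by (intro differentiable_sum) (auto simp: differentiable_def)
  have "(\<lambda>q. b q - b p) differentiable at p"
    using b by (intro differentiable_diff) auto
  then have d2: "(\<lambda>q. B (b q - b p)) differentiable at p"
    using bounded_linear.has_derivative[OF bB] unfolding differentiable_def by blast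
  have "(\<lambda>q. z p + B (b q - b p) - (\<Sum>i\<in>Basis. (z q \<bullet> i) *\<^sub>R B (F q i - F p i))) differentiable at p"
    using d1 d2 by (intro differentiable_diff differentiable_add differentiable_const)
  then show ?thesis
    using has_derivative_transform_within_open[OF _ S, of _ _ UNIV z] z_eq
    unfolding differentiable_def by (metis (no_types, lifting))
qed


section \<open>Curvature of a metric in coordinates\<close>

definition metric_deriv ::
  "('a::euclidean_space \<Rightarrow> 'a \<Rightarrow> 'a \<Rightarrow> real) \<Rightarrow> 'a \<Rightarrow> 'a \<Rightarrow> 'a \<Rightarrow> 'a \<Rightarrow> real" where
  "metric_deriv G p x u v = fderiv (\<lambda>q. G q u v) p x"

text \<open>The Christoffel symbol of the first kind. It is a sum of derivatives of \<open>G\<close>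
  and inherits linearity and regularity directly, while \<open>christoffel\<close> is only given by
  a description.\<close>

definition koszul ::
  "('a::euclidean_space \<Rightarrow> 'a \<Rightarrow> 'a \<Rightarrow> real) \<Rightarrow> 'a \<Rightarrow> 'a \<Rightarrow> 'a \<Rightarrow> 'a \<Rightarrow> real" where
  "koszul G p a b c = (metric_deriv G p a b c + metric_deriv G p b a c - metric_deriv G p c a b) / 2"

definition koszul_deriv ::
  "('a::euclidean_space \<Rightarrow> 'a \<Rightarrow> 'a \<Rightarrow> real) \<Rightarrow> 'a \<Rightarrow> 'a \<Rightarrow> 'a \<Rightarrow> 'a \<Rightarrow> 'a \<Rightarrow> real" where
  "koszul_deriv G p x a b c = fderiv (\<lambda>q. koszul G q a b c) p x"

text \<open>This is \<open>G(R(u, v) v, u)\<close>, written without derivatives of the Christoffel symbols.\<close>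

definition curvature_form ::
  "('a::euclidean_space \<Rightarrow> 'a \<Rightarrow> 'a \<Rightarrow> real) \<Rightarrow> 'a \<Rightarrow> 'a \<Rightarrow> 'a \<Rightarrow> real" where
  "curvature_form G p u v = koszul_deriv G p u v v u - koszul_deriv G p v u v u
     - G p (christoffel G p u u) (christoffel G p v v)
     + G p (christoffel G p u v) (christoffel G p u v)"

text \<open>Asking that \<open>G p u u\<close> does not vanish covers positive and negative definite
  metrics at once. Two derivatives are what the curvature consumes.\<close>

locale coord_metric =
  fixes S :: "'a::euclidean_space set" and G :: "'a \<Rightarrow> 'a \<Rightarrow> 'a \<Rightarrow> real"
  assumes open_S: "open S"
    and linear_left: "p \<in> S \<Longrightarrow> linear (\<lambda>u. G p u v)"
    and sym: "p \<in> S \<Longrightarrow> G p u v = G p v u"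
    and definite: "p \<in> S \<Longrightarrow> u \<noteq> 0 \<Longrightarrow> G p u u \<noteq> 0"
    and C2: "Ck_on 2 (\<lambda>p. G p u v) S"
begin

lemma linear_right: "p \<in> S \<Longrightarrow> linear (G p u)"
  using linear_left[of p u] sym[of p u] by (metis (no_types, lifting) ext)

lemma G_add: "p \<in> S \<Longrightarrow> G p (u + v) w = G p u w + G p v w" "p \<in> S \<Longrightarrow> G p w (u + v) = G p w u + G p w v"
  using linear_add[OF linear_left] linear_add[OF linear_right] by auto

lemma G_scale: "p \<in> S \<Longrightarrow> G p (r *\<^sub>R u) w = r * G p u w" "p \<in> S \<Longrightarrow> G p w (r *\<^sub>R u) = r * G p w u"
  using linear_scale[OF linear_left] linear_scale[OF linear_right] by auto

lemma G_diff: "p \<in> S \<Longrightarrow> G p (u - v) w = G p u w - G p v w"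
  using linear_diff[OF linear_left] by auto

lemma eq_if_G_eq:
  assumes "p \<in> S" "\<And>w. G p z w = G p z' w"
  shows "z = z'"
  using definite[OF assms(1), of "z - z'"] assms by (auto simp: G_diff)

lemma G_has_derivative:
  "p \<in> S \<Longrightarrow> ((\<lambda>q. G q u v) has_derivative (\<lambda>x. metric_deriv G p x u v)) (at p)"
  unfolding metric_deriv_def
  using has_fderiv[of "\<lambda>q. G q u v" p] C2 by (simp add: numeral_2_eq_2)

lemma metric_deriv_eq:
  "((\<lambda>q. G q u v) has_derivative D) (at p) \<Longrightarrow> metric_deriv G p x u v = D x"
  by (simp add: metric_deriv_def fderiv_eq)

lemma metric_deriv_linear_point: "p \<in> S \<Longrightarrow> linear (\<lambda>x. metric_deriv G p x u v)"
  using G_has_derivative has_derivative_linear by blast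

lemma metric_deriv_sym:
  assumes "p \<in> S" shows "metric_deriv G p x u v = metric_deriv G p x v u"
  by (rule metric_deriv_eq, rule has_derivative_transform_within_open[OF G_has_derivative[OF assms] open_S assms])
     (rule sym)

lemma metric_deriv_linear_left:
  assumes p: "p \<in> S" shows "linear (\<lambda>u. metric_deriv G p x u v)"
proof (rule linearI)
  fix u u' :: 'a and r :: real
  show "metric_deriv G p x (u + u') v = metric_deriv G p x u v + metric_deriv G p x u' v"
    by (rule metric_deriv_eq, rule has_derivative_transform_within_open[OF
          has_derivative_add[OF G_has_derivative[OF p] G_has_derivative[OF p]] open_S p])
       (simp add: G_add)
  show "metric_deriv G p x (r *\<^sub>R u) v = r *\<^sub>R metric_deriv G p x u v"
    unfolding real_scaleR_def
    by (rule metric_deriv_eq, rule has_derivative_transform_within_open[OF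
          has_derivative_mult_right[OF G_has_derivative[OF p]] open_S p])
       (simp add: G_scale)
qed

lemma metric_deriv_linear_right: "p \<in> S \<Longrightarrow> linear (\<lambda>v. metric_deriv G p x u v)"
  using metric_deriv_linear_left[of p x u] metric_deriv_sym[of p x u] by (metis (no_types, lifting) ext)

lemma linear_half: "linear f \<Longrightarrow> linear (\<lambda>x. f x / (2::real))"
  using linear_compose_scale_right[of f "1/2"] by simp

lemma koszul_linear:
  assumes "p \<in> S"
  shows "linear (\<lambda>a. koszul G p a b c)" "linear (\<lambda>b. koszul G p a b c)" "linear (\<lambda>c. koszul G p a b c)"
  unfolding koszul_def using assms
  by (auto intro!: linear_half linear_compose_add linear_compose_sub metric_deriv_linear_point
      metric_deriv_linear_left metric_deriv_linear_right)

lemma koszul_sym: "p \<in> S \<Longrightarrow> koszul G p a b c = koszul G p b a c"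
  unfolding koszul_def using metric_deriv_sym[of p c a b] by simp

text \<open>Compatibility of the Levi-Civita connection with the metric, on constant fields;
  \<open>koszul_sym\<close> is its freedom from torsion. Together they replace metric derivatives by
  Koszul terms in the curvature computations.\<close>

lemma metric_deriv_koszul: "p \<in> S \<Longrightarrow> metric_deriv G p x a b = koszul G p x a b + koszul G p x b a"
  unfolding koszul_def using metric_deriv_sym[of p x a b] metric_deriv_sym[of p a x b]
    metric_deriv_sym[of p b x a] by (simp add: field_simps)

lemma koszul_C1: "Ck_on 1 (\<lambda>q. koszul G q a b c) S"
proof -
  have "Ck_on 1 (\<lambda>q. metric_deriv G q x u v) S" for x u v
    using C2[of u v] by (simp add: numeral_2_eq_2 metric_deriv_def)
  then have "Ck_on 1 (\<lambda>q. (1/2) * (metric_deriv G q a b c + metric_deriv G q b a c - metric_deriv G q c a b)) S"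
    using open_S by (intro Ck_on_mult Ck_on_diff Ck_on_add Ck_on_const)
  then show ?thesis by (simp add: koszul_def)
qed

lemma koszul_has_derivative:
  "p \<in> S \<Longrightarrow> ((\<lambda>q. koszul G q a b c) has_derivative (\<lambda>x. koszul_deriv G p x a b c)) (at p)"
  unfolding koszul_deriv_def using has_fderiv koszul_C1 by fastforce

lemma koszul_deriv_eq:
  "((\<lambda>q. koszul G q a b c) has_derivative D) (at p) \<Longrightarrow> koszul_deriv G p x a b c = D x"
  by (simp add: koszul_deriv_def fderiv_eq)

lemma koszul_deriv_linear:
  assumes p: "p \<in> S"
  shows "koszul_deriv G p (r *\<^sub>R x) a b c = r * koszul_deriv G p x a b c"
    "koszul_deriv G p x (r *\<^sub>R a) b c = r * koszul_deriv G p x a b c"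
    "koszul_deriv G p x a (r *\<^sub>R b) c = r * koszul_deriv G p x a b c"
    "koszul_deriv G p x a b (r *\<^sub>R c) = r * koszul_deriv G p x a b c"
proof -
  show "koszul_deriv G p (r *\<^sub>R x) a b c = r * koszul_deriv G p x a b c"
    using linear_scale[OF has_derivative_linear[OF koszul_has_derivative[OF p]]] by simp
  note d = has_derivative_transform_within_open[OF
      has_derivative_mult_right[OF koszul_has_derivative[OF p]] open_S p]
  show "koszul_deriv G p x (r *\<^sub>R a) b c = r * koszul_deriv G p x a b c"
    by (rule koszul_deriv_eq, rule d) (simp add: linear_scale[OF koszul_linear(1)])
  show "koszul_deriv G p x a (r *\<^sub>R b) c = r * koszul_deriv G p x a b c"
    by (rule koszul_deriv_eq, rule d) (simp add: linear_scale[OF koszul_linear(2)])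
  show "koszul_deriv G p x a b (r *\<^sub>R c) = r * koszul_deriv G p x a b c"
    by (rule koszul_deriv_eq, rule d) (simp add: linear_scale[OF koszul_linear(3)])
qed

text \<open>Lowering an index. The dual is identified with the space itself through the inner
  product, so \<open>flat p\<close> is an endomorphism, and its injectivity, which is nondegeneracy
  of \<open>G\<close>, gives surjectivity.\<close>

definition flat :: "'a \<Rightarrow> 'a \<Rightarrow> 'a" where
  "flat p z = (\<Sum>k\<in>Basis. G p z k *\<^sub>R k)"

lemma flat_inner: "p \<in> S \<Longrightarrow> flat p z \<bullet> w = G p z w"
  unfolding flat_def using inner_sum_Basis_eq[OF linear_right] by blast

lemma linear_flat: "p \<in> S \<Longrightarrow> linear (flat p)"
  by (rule linearI; rule vector_eq_ldot[THEN iffD1])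
     (auto simp: flat_inner inner_add_right inner_commute[of _ "flat _ _"] G_add G_scale)

lemma inj_flat: "p \<in> S \<Longrightarrow> inj (flat p)"
  by (rule injI, rule eq_if_G_eq) (auto simp: flat_inner[symmetric])

text \<open>Justifies the description that defines \<open>christoffel\<close>: surjectivity of
  \<open>flat p\<close> gives existence, definiteness of \<open>G\<close> gives uniqueness.\<close>

lemma christoffel_koszul:
  assumes p: "p \<in> S"
  shows "G p (christoffel G p u v) w = koszul G p u v w"
proof -
  define b where "b = (\<Sum>k\<in>Basis. koszul G p u v k *\<^sub>R k)"
  have b: "b \<bullet> w = koszul G p u v w" for w
    unfolding b_def by (rule inner_sum_Basis_eq[OF koszul_linear(3)[OF p]])
  obtain z where "flat p z = b"
    using linear_injective_imp_surjective[OF linear_flat[OF p] inj_flat[OF p]] by (metis surjD)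
  then have z: "G p z w = koszul G p u v w" for w
    using b flat_inner[OF p] by metis
  have "christoffel G p u v = z"
    unfolding christoffel_def
  proof (rule the_equality)
    show "\<forall>w. 2 * G p z w = fderiv (\<lambda>q. G q v w) p u + fderiv (\<lambda>q. G q u w) p v - fderiv (\<lambda>q. G q u v) p w"
      by (simp add: z koszul_def metric_deriv_def)
    fix z' assume "\<forall>w. 2 * G p z' w = fderiv (\<lambda>q. G q v w) p u + fderiv (\<lambda>q. G q u w) p v - fderiv (\<lambda>q. G q u v) p w"
    then have "2 * G p z' w = 2 * G p z w" for w
      by (simp add: z koszul_def metric_deriv_def)
    then show "z' = z"
      by (intro eq_if_G_eq[OF p]) simp
  qed
  then show ?thesis by (simp add: z)
qed

lemma christoffel_unique:
  assumes "p \<in> S" "\<And>w. G p z w = koszul G p u v w"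
  shows "christoffel G p u v = z"
  by (rule eq_if_G_eq[OF assms(1)]) (simp add: christoffel_koszul assms)

lemma christoffel_scale:
  assumes "p \<in> S"
  shows "christoffel G p (r *\<^sub>R u) v = r *\<^sub>R christoffel G p u v"
    "christoffel G p u (r *\<^sub>R v) = r *\<^sub>R christoffel G p u v"
  using assms
  by (auto intro!: christoffel_unique simp: G_scale christoffel_koszul
      linear_scale[OF koszul_linear(1)] linear_scale[OF koszul_linear(2)])

text \<open>The Christoffel symbol solves a linear equation whose coefficients and right side are
  differentiable, so no formula for an inverse matrix has to be differentiated.\<close>

lemma christoffel_differentiable:
  assumes p: "p \<in> S"
  shows "(\<lambda>q. christoffel G q u v) differentiable at p"
proof -
  have differentiable_basis: "(\<lambda>q. f q *\<^sub>R k) differentiable at p"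
    if "(f has_derivative f') (at p)" for f f' and k :: 'a
    unfolding differentiable_def by (rule exI, rule has_derivative_scaleR_left[OF that])
  show ?thesis
proof (rule linear_solution_differentiable[where F = flat, OF open_S p _ inj_flat[OF p]])
  show "linear (flat q)" if "q \<in> S" for q
    by (rule linear_flat[OF that])
  show "(\<lambda>q. flat q z) differentiable at p" for z
    unfolding flat_def
    by (intro differentiable_sum ballI finite_Basis) (auto intro: differentiable_basis G_has_derivative[OF p])
  show "(\<lambda>q. \<Sum>k\<in>Basis. koszul G q u v k *\<^sub>R k) differentiable at p"
    by (intro differentiable_sum ballI finite_Basis) (auto intro: differentiable_basis koszul_has_derivative[OF p])
  show "flat q (christoffel G q u v) = (\<Sum>k\<in>Basis. koszul G q u v k *\<^sub>R k)" if "q \<in> S" for q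
    by (simp add: flat_def christoffel_koszul[OF that])
  qed
qed

text \<open>The Leibniz rule for \<open>G q (christoffel G q v w) y\<close>, which is a Koszul term
  on all of \<open>S\<close>. Pairing with \<open>G\<close> thus removes the derivatives of
  Christoffel symbols.\<close>

lemma G_fderiv_christoffel:
  assumes p: "p \<in> S"
  shows "G p (fderiv (\<lambda>q. christoffel G q v w) p x) y
    = koszul_deriv G p x v w y - metric_deriv G p x (christoffel G p v w) y"
proof -
  have "((\<lambda>q. G q (christoffel G q v w) y) has_derivative
      (\<lambda>x. metric_deriv G p x (christoffel G p v w) y + G p (fderiv (\<lambda>q. christoffel G q v w) p x) y)) (at p)"
    by (rule has_derivative_linear_apply[where F = "\<lambda>q u. G q u y", OF open_S p linear_left
          G_has_derivative[OF p] has_fderiv[OF christoffel_differentiable[OF p]]])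
  then have "((\<lambda>q. koszul G q v w y) has_derivative
      (\<lambda>x. metric_deriv G p x (christoffel G p v w) y + G p (fderiv (\<lambda>q. christoffel G q v w) p x) y)) (at p)"
    by (rule has_derivative_transform_within_open[OF _ open_S p]) (rule christoffel_koszul)
  from koszul_deriv_eq[OF this] show ?thesis by simp
qed

text \<open>Metric compatibility, applied to \<open>christoffel G p v v\<close> and
  \<open>christoffel G p u v\<close>, combines the leftover metric derivatives with the iterated
  Christoffel terms of the Riemann tensor.\<close>

lemma riemann_curvature_form:
  assumes p: "p \<in> S"
  shows "G p (riemann G p u v v) u = curvature_form G p u v"
proof -
  let ?\<Gamma> = "christoffel G p"
  have "G p (riemann G p u v v) u =
     koszul_deriv G p u v v u - metric_deriv G p u (?\<Gamma> v v) u
     - (koszul_deriv G p v u v u - metric_deriv G p v (?\<Gamma> u v) u)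
     + koszul G p u (?\<Gamma> v v) u - koszul G p v (?\<Gamma> u v) u"
    unfolding riemann_def using p
    by (simp add: G_add G_diff G_fderiv_christoffel christoffel_koszul)
  moreover have "G p (?\<Gamma> u u) (?\<Gamma> v v) = metric_deriv G p u (?\<Gamma> v v) u - koszul G p u (?\<Gamma> v v) u"
    using p metric_deriv_koszul[OF p, of u "?\<Gamma> v v" u] by (simp add: christoffel_koszul)
  moreover have "G p (?\<Gamma> u v) (?\<Gamma> u v) = metric_deriv G p v (?\<Gamma> u v) u - koszul G p v (?\<Gamma> u v) u"
    using p metric_deriv_koszul[OF p, of v "?\<Gamma> u v" u] koszul_sym[OF p, of u v]
    by (simp add: christoffel_koszul)
  ultimately show ?thesis by (simp add: curvature_form_def)
qed

lemma sectional_coord_eq: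
  "p \<in> S \<Longrightarrow> sectional_coord G p u v = curvature_form G p u v / (G p u u * G p v v - (G p u v)\<^sup>2)"
  by (simp add: sectional_coord_def riemann_curvature_form)

text \<open>All terms are homogeneous in each slot, so for proportional arguments they cancel in
  pairs.\<close>

lemma curvature_form_dependent:
  assumes p: "p \<in> S"
  shows "curvature_form G p u (r *\<^sub>R u) = 0" "curvature_form G p 0 v = 0"
proof -
  show "curvature_form G p u (r *\<^sub>R u) = 0"
    unfolding curvature_form_def using p
    by (simp add: koszul_deriv_linear christoffel_scale G_scale)
  have "curvature_form G p (0 *\<^sub>R u) v = 0" for u
    unfolding curvature_form_def using p
    by (simp only: koszul_deriv_linear christoffel_scale G_scale)
  then show "curvature_form G p 0 v = 0" by simp
qed

end


section \<open>Naturality under immersions\<close>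

definition pullback_coord ::
  "('a::euclidean_space \<Rightarrow> 'a \<Rightarrow> 'a \<Rightarrow> real) \<Rightarrow> ('e::euclidean_space \<Rightarrow> 'a) \<Rightarrow> 'e \<Rightarrow> 'e \<Rightarrow> 'e \<Rightarrow> real" where
  "pullback_coord G \<Phi> p u v = G (\<Phi> p) (fderiv \<Phi> p u) (fderiv \<Phi> p v)"

text \<open>Three derivatives, because the pulled back metric contains one derivative of \<Phi> and
  its curvature takes two more. The dimensions may differ: the locale serves both for a chart of the
  level set and for the flow coordinates.\<close>

locale coord_immersion = coord_metric S G
  for S :: "'a::euclidean_space set" and G +
  fixes W :: "'e::euclidean_space set" and \<Phi> :: "'e \<Rightarrow> 'a"
  assumes open_W: "open W"
    and C3: "Ck_on 3 \<Phi> W"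
    and mapsto: "p \<in> W \<Longrightarrow> \<Phi> p \<in> S"
    and immersion: "p \<in> W \<Longrightarrow> inj (fderiv \<Phi> p)"
begin

definition D2 :: "'e \<Rightarrow> 'e \<Rightarrow> 'e \<Rightarrow> 'a" where
  "D2 p x u = fderiv (\<lambda>q. fderiv \<Phi> q u) p x"

definition D3 :: "'e \<Rightarrow> 'e \<Rightarrow> 'e \<Rightarrow> 'e \<Rightarrow> 'a" where
  "D3 p y x u = fderiv (\<lambda>q. D2 q x u) p y"

lemma C2_map: "Ck_on 2 \<Phi> W"
  using C3 Ck_on_le by fastforce

lemma C2_fderiv: "Ck_on 2 (\<lambda>q. fderiv \<Phi> q u) W"
  using C3 by (simp add: numeral_3_eq_3 numeral_2_eq_2)

lemma map_has_derivative: "p \<in> W \<Longrightarrow> (\<Phi> has_derivative fderiv \<Phi> p) (at p)"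
  using C3 by (intro has_fderiv) (simp add: numeral_3_eq_3)

lemma linear_fderiv: "p \<in> W \<Longrightarrow> linear (fderiv \<Phi> p)"
  using map_has_derivative has_derivative_linear by blast

lemma fderiv_has_derivative:
  "p \<in> W \<Longrightarrow> ((\<lambda>q. fderiv \<Phi> q u) has_derivative (\<lambda>x. D2 p x u)) (at p)"
  unfolding D2_def using C2_fderiv[of u] has_fderiv by (fastforce simp: numeral_2_eq_2)

lemma D2_has_derivative:
  "p \<in> W \<Longrightarrow> ((\<lambda>q. D2 q x u) has_derivative (\<lambda>y. D3 p y x u)) (at p)"
  unfolding D3_def D2_def using C2_fderiv[of u] has_fderiv by (fastforce simp: numeral_2_eq_2)

lemma D2_sym: "p \<in> W \<Longrightarrow> D2 p u v = D2 p v u"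
  unfolding D2_def by (rule symmetric_second_fderiv[OF open_W _ C2_map])

lemma D3_sym: "p \<in> W \<Longrightarrow> D3 p y x u = D3 p x y u"
  unfolding D3_def D2_def by (rule symmetric_second_fderiv[OF open_W _ C2_fderiv])

lemma G_map_has_derivative:
  assumes p: "p \<in> W"
  shows "((\<lambda>q. G (\<Phi> q) u v) has_derivative (\<lambda>x. metric_deriv G (\<Phi> p) (fderiv \<Phi> p x) u v)) (at p)"
  using has_derivative_compose[OF map_has_derivative[OF p] G_has_derivative[OF mapsto[OF p]]] .

lemma koszul_map_has_derivative:
  assumes p: "p \<in> W"
  shows "((\<lambda>q. koszul G (\<Phi> q) a b c) has_derivative
    (\<lambda>x. koszul_deriv G (\<Phi> p) (fderiv \<Phi> p x) a b c)) (at p)"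
  using has_derivative_compose[OF map_has_derivative[OF p] koszul_has_derivative[OF mapsto[OF p]]] .

lemma coord_metric_pullback: "coord_metric W (pullback_coord G \<Phi>)"
proof (rule coord_metric.intro)
  show "linear (\<lambda>u. pullback_coord G \<Phi> p u v)" if "p \<in> W" for p v
    using linear_compose[OF linear_fderiv[OF that] linear_left[OF mapsto[OF that]]]
    by (simp add: pullback_coord_def o_def)
  show "pullback_coord G \<Phi> p u u \<noteq> 0" if "p \<in> W" "u \<noteq> 0" for p u
  proof -
    have "fderiv \<Phi> p u \<noteq> 0"
      using linear_injective_0[OF linear_fderiv[OF that(1)]] immersion[OF that(1)] that(2) by blast
    then show ?thesis
      using definite mapsto that(1) by (simp add: pullback_coord_def)
  qed
  have G: "Ck_on 2 (\<lambda>p. G (\<Phi> p) u v) W" for u v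
    by (rule Ck_on_chain[OF open_W open_S mapsto C2 C2_map])
  have "Ck_on 2 (\<lambda>p. G (\<Phi> p) (fderiv \<Phi> p u) v) W" for u v
    by (rule Ck_on_linear_apply[where F = "\<lambda>p u. G (\<Phi> p) u v", OF open_W linear_left[OF mapsto] G C2_fderiv])
  then show "Ck_on 2 (\<lambda>p. pullback_coord G \<Phi> p u v) W" for u v
    unfolding pullback_coord_def
    by (intro Ck_on_linear_apply[where F = "\<lambda>p. G (\<Phi> p) (fderiv \<Phi> p u)",
          OF open_W linear_right[OF mapsto] _ C2_fderiv])
qed (auto simp: pullback_coord_def sym mapsto open_W)

lemma metric_deriv_pullback:
  assumes p: "p \<in> W"
  shows "metric_deriv (pullback_coord G \<Phi>) p x u v =
    metric_deriv G (\<Phi> p) (fderiv \<Phi> p x) (fderiv \<Phi> p u) (fderiv \<Phi> p v)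
    + G (\<Phi> p) (D2 p x u) (fderiv \<Phi> p v) + G (\<Phi> p) (fderiv \<Phi> p u) (D2 p x v)"
  unfolding metric_deriv_def[of "pullback_coord G \<Phi>"] pullback_coord_def
  by (subst fderiv_eq[OF has_derivative_bilinear_apply[where F = "\<lambda>q. G (\<Phi> q)",
        OF open_W p linear_left[OF mapsto] linear_right[OF mapsto] G_map_has_derivative[OF p]
        fderiv_has_derivative[OF p] fderiv_has_derivative[OF p]]]) simp_all

text \<open>The inhomogeneous transformation law of Christoffel symbols. Of the six terms with
  \<open>D2\<close>, four cancel by the symmetry of \<open>D2\<close> and \<open>G\<close>, and the
  other two coincide.\<close>

lemma koszul_pullback:
  assumes p: "p \<in> W"
  shows "koszul (pullback_coord G \<Phi>) p a b c =
    koszul G (\<Phi> p) (fderiv \<Phi> p a) (fderiv \<Phi> p b) (fderiv \<Phi> p c) + G (\<Phi> p) (D2 p a b) (fderiv \<Phi> p c)"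
  unfolding koszul_def metric_deriv_pullback[OF p]
  using D2_sym[OF p, of a b] D2_sym[OF p, of a c] D2_sym[OF p, of b c]
    sym[OF mapsto[OF p], of "fderiv \<Phi> p b" "D2 p c a"] sym[OF mapsto[OF p], of "fderiv \<Phi> p a" "D2 p c b"]
  by (simp add: sym[OF mapsto[OF p], of "fderiv \<Phi> p _"] field_simps)

lemma koszul_deriv_pullback:
  assumes p: "p \<in> W"
  shows "koszul_deriv (pullback_coord G \<Phi>) p x a b c =
    koszul_deriv G (\<Phi> p) (fderiv \<Phi> p x) (fderiv \<Phi> p a) (fderiv \<Phi> p b) (fderiv \<Phi> p c)
    + koszul G (\<Phi> p) (D2 p x a) (fderiv \<Phi> p b) (fderiv \<Phi> p c)
    + koszul G (\<Phi> p) (fderiv \<Phi> p a) (D2 p x b) (fderiv \<Phi> p c)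
    + koszul G (\<Phi> p) (fderiv \<Phi> p a) (fderiv \<Phi> p b) (D2 p x c)
    + (metric_deriv G (\<Phi> p) (fderiv \<Phi> p x) (D2 p a b) (fderiv \<Phi> p c)
    + G (\<Phi> p) (D3 p x a b) (fderiv \<Phi> p c) + G (\<Phi> p) (D2 p a b) (D2 p x c))"
proof -
  note d = has_derivative_add[OF
      has_derivative_trilinear_apply[where F = "\<lambda>q. koszul G (\<Phi> q)", OF open_W p
        koszul_linear(1)[OF mapsto] koszul_linear(2)[OF mapsto] koszul_linear(3)[OF mapsto]
        koszul_map_has_derivative[OF p]
        fderiv_has_derivative[OF p, of a] fderiv_has_derivative[OF p, of b] fderiv_has_derivative[OF p, of c]]
      has_derivative_bilinear_apply[where F = "\<lambda>q. G (\<Phi> q)", OF open_W p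
        linear_left[OF mapsto] linear_right[OF mapsto] G_map_has_derivative[OF p]
        D2_has_derivative[OF p, of a b] fderiv_has_derivative[OF p, of c]]]
  show ?thesis
    unfolding koszul_deriv_def[of "pullback_coord G \<Phi>"]
    by (subst fderiv_eq[OF has_derivative_transform_within_open[OF d open_W p]])
       (simp_all add: koszul_pullback)
qed

end

text \<open>Surjectivity makes it enough to test an identity in the target on the vectors
  \<open>fderiv \<Phi> p c\<close>. For a general immersion the second fundamental form would enter,
  as in the Gauss equation.\<close>

locale coord_diffeo = coord_immersion +
  assumes immersion_onto: "p \<in> W \<Longrightarrow> surj (fderiv \<Phi> p)"
begin

lemma fderiv_christoffel_pullback:
  assumes p: "p \<in> W"
  shows "fderiv \<Phi> p (christoffel (pullback_coord G \<Phi>) p a b) =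
    D2 p a b + christoffel G (\<Phi> p) (fderiv \<Phi> p a) (fderiv \<Phi> p b)"
proof (rule eq_if_G_eq[OF mapsto[OF p]])
  fix w
  obtain c where w: "w = fderiv \<Phi> p c"
    using immersion_onto[OF p] by (metis surjD)
  have "G (\<Phi> p) (fderiv \<Phi> p (christoffel (pullback_coord G \<Phi>) p a b)) w =
      koszul (pullback_coord G \<Phi>) p a b c"
    using coord_metric.christoffel_koszul[OF coord_metric_pullback p, of a b c]
    by (simp add: w pullback_coord_def)
  then show "G (\<Phi> p) (fderiv \<Phi> p (christoffel (pullback_coord G \<Phi>) p a b)) w =
      G (\<Phi> p) (D2 p a b + christoffel G (\<Phi> p) (fderiv \<Phi> p a) (fderiv \<Phi> p b)) w"
    using p by (simp add: koszul_pullback w G_add mapsto christoffel_koszul)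
qed

text \<open>Third derivatives of \<Phi> cancel by \<open>D3_sym\<close> in the difference of the two
  Koszul derivatives; the terms with \<open>D2\<close> cancel against those that the transformation
  law puts into the quadratic Christoffel terms.\<close>

lemma curvature_form_pullback:
  assumes p: "p \<in> W"
  shows "curvature_form (pullback_coord G \<Phi>) p u v
    = curvature_form G (\<Phi> p) (fderiv \<Phi> p u) (fderiv \<Phi> p v)"
proof -
  note P = mapsto[OF p]
  let ?D = "fderiv \<Phi> p" and ?K = "koszul G (\<Phi> p)"
  let ?\<Gamma> = "\<lambda>a b. christoffel G (\<Phi> p) (?D a) (?D b)"
  have \<Gamma>\<Gamma>: "pullback_coord G \<Phi> p (christoffel (pullback_coord G \<Phi>) p a b) (christoffel (pullback_coord G \<Phi>) p c d)
     = G (\<Phi> p) (D2 p a b) (D2 p c d) + ?K (?D c) (?D d) (D2 p a b) + ?K (?D a) (?D b) (D2 p c d)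
       + G (\<Phi> p) (?\<Gamma> a b) (?\<Gamma> c d)" for a b c d
    unfolding pullback_coord_def fderiv_christoffel_pullback[OF p] G_add[OF P]
    using sym[OF P, of "D2 p a b" "?\<Gamma> c d"]
      christoffel_koszul[OF P, of "?D c" "?D d" "D2 p a b"] christoffel_koszul[OF P, of "?D a" "?D b" "D2 p c d"]
    by linarith
  show ?thesis
    unfolding curvature_form_def \<Gamma>\<Gamma> koszul_deriv_pullback[OF p] metric_deriv_koszul[OF P]
    using D2_sym[OF p, of v u] D3_sym[OF p, of v u v] koszul_sym[OF P, of "?D v" "D2 p u v" "?D u"]
      koszul_sym[OF P, of "?D v" "?D u" "D2 p u v"] sym[OF P, of "D2 p u u" "D2 p v v"]
    by simp
qed

lemma sectional_coord_pullback:
  "p \<in> W \<Longrightarrow> sectional_coord (pullback_coord G \<Phi>) p u v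
    = sectional_coord G (\<Phi> p) (fderiv \<Phi> p u) (fderiv \<Phi> p v)"
  using coord_metric.sectional_coord_eq[OF coord_metric_pullback, of p u v]
  by (simp add: sectional_coord_eq mapsto curvature_form_pullback) (simp add: pullback_coord_def)

end


section \<open>Conformally product metrics\<close>

text \<open>With \<rho> = exp (2 \<psi>) up to sign, so that \<eta> = \<psi>', this is the formula
  for a conformal change of the product metric \<gamma> + \<kappa> dt^2. The factor dt^2 is flat,
  \<eta>' is the Hessian of \<psi> and \<eta>^2 / \<kappa> its squared gradient; the contributions
  of \<eta>^2 to the terms with \<open>snd a\<close> and \<open>snd b\<close> cancel.\<close>

lemma conformal_product_curvature_form:
  fixes Q :: "'b::euclidean_space set" and W :: "('b \<times> real) set" and \<rho> \<eta> \<eta>' :: "real \<Rightarrow> real"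
  assumes "coord_metric Q \<gamma>" and "coord_metric W H" and "\<kappa> \<noteq> 0"
    and W: "\<And>p. p \<in> W \<Longrightarrow> fst p \<in> Q"
    and H: "\<And>p a b. p \<in> W \<Longrightarrow> H p a b = \<rho> (snd p) * (\<gamma> (fst p) (fst a) (fst b) + \<kappa> * (snd a * snd b))"
    and \<rho>: "\<And>p. p \<in> W \<Longrightarrow> (\<rho> has_real_derivative 2 * \<eta> (snd p) * \<rho> (snd p)) (at (snd p))"
    and \<eta>: "\<And>p. p \<in> W \<Longrightarrow> (\<eta> has_real_derivative \<eta>' (snd p)) (at (snd p))"
    and p: "p \<in> W"
  shows "curvature_form H p a b = \<rho> (snd p) * (curvature_form \<gamma> (fst p) (fst a) (fst b)
     - \<eta>' (snd p) * ((snd a)\<^sup>2 * \<gamma> (fst p) (fst b) (fst b) + (snd b)\<^sup>2 * \<gamma> (fst p) (fst a) (fst a)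
          - 2 * snd a * snd b * \<gamma> (fst p) (fst a) (fst b))
     - (\<eta> (snd p))\<^sup>2 / \<kappa> * (\<gamma> (fst p) (fst a) (fst a) * \<gamma> (fst p) (fst b) (fst b)
          - (\<gamma> (fst p) (fst a) (fst b))\<^sup>2))"
proof -
  interpret B: coord_metric Q \<gamma> by fact
  interpret H: coord_metric W H by fact
  define I where "I p a b = \<gamma> (fst p) (fst a) (fst b) + \<kappa> * (snd a * snd b)"
    for p a b :: "'b \<times> real"
  have H': "H p a b = \<rho> (snd p) * I p a b" if "p \<in> W" for p a b
    using H[OF that] by (simp add: I_def)
  have scalar: "((\<lambda>p. f (snd p)) has_derivative (\<lambda>x. f' * snd x)) (at p)"
    if "(f has_real_derivative f') (at (snd p))" for f f' and p :: "'b \<times> real"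
    using has_derivative_compose[OF has_derivative_snd[OF has_derivative_ident], of f "(*) f'" p UNIV] that
    by (simp add: has_field_derivative_def)
  have dI: "((\<lambda>p. I p a b) has_derivative (\<lambda>x. metric_deriv \<gamma> (fst p) (fst x) (fst a) (fst b))) (at p)"
    if "p \<in> W" for p a b
    unfolding I_def
    using has_derivative_add[OF has_derivative_compose[OF has_derivative_fst[OF has_derivative_ident]
          B.G_has_derivative[OF W[OF that]], of "fst a" "fst b"] has_derivative_const[of "\<kappa> * (snd a * snd b)"]]
    by simp
  have dK: "((\<lambda>p. koszul \<gamma> (fst p) u v w) has_derivative (\<lambda>x. koszul_deriv \<gamma> (fst p) (fst x) u v w)) (at p)"
    if "p \<in> W" for p u v w
    using has_derivative_compose[OF has_derivative_fst[OF has_derivative_ident]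
          B.koszul_has_derivative[OF W[OF that]]] by simp
  have mH: "metric_deriv H p x a b = 2 * \<eta> (snd p) * \<rho> (snd p) * snd x * I p a b
      + \<rho> (snd p) * metric_deriv \<gamma> (fst p) (fst x) (fst a) (fst b)" if "p \<in> W" for p x a b
    by (subst H.metric_deriv_eq[OF has_derivative_transform_within_open[OF
            has_derivative_mult[OF scalar[OF \<rho>[OF that]] dI[OF that]] H.open_S that]])
       (simp_all add: H' algebra_simps)
  have kH: "koszul H p a b c = \<eta> (snd p) * \<rho> (snd p) * (snd a * I p b c + snd b * I p a c - snd c * I p a b)
      + \<rho> (snd p) * koszul \<gamma> (fst p) (fst a) (fst b) (fst c)" if "p \<in> W" for p a b c
    unfolding koszul_def mH[OF that] by (simp add: field_simps)
  have kdH: "koszul_deriv H p x a b c =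
      (\<eta> (snd p) * (2 * \<eta> (snd p) * \<rho> (snd p) * snd x) + \<eta>' (snd p) * snd x * \<rho> (snd p))
        * (snd a * I p b c + snd b * I p a c - snd c * I p a b)
      + \<eta> (snd p) * \<rho> (snd p) * (snd a * metric_deriv \<gamma> (fst p) (fst x) (fst b) (fst c)
          + snd b * metric_deriv \<gamma> (fst p) (fst x) (fst a) (fst c)
          - snd c * metric_deriv \<gamma> (fst p) (fst x) (fst a) (fst b))
      + 2 * \<eta> (snd p) * \<rho> (snd p) * snd x * koszul \<gamma> (fst p) (fst a) (fst b) (fst c)
      + \<rho> (snd p) * koszul_deriv \<gamma> (fst p) (fst x) (fst a) (fst b) (fst c)" for x a b c
  proof -
    note d = has_derivative_add[OF
        has_derivative_mult[OF has_derivative_mult[OF scalar[OF \<eta>[OF p]] scalar[OF \<rho>[OF p]]]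
          has_derivative_diff[OF has_derivative_add[OF
            has_derivative_mult_right[OF dI[OF p, of b c], of "snd a"]
            has_derivative_mult_right[OF dI[OF p, of a c], of "snd b"]]
            has_derivative_mult_right[OF dI[OF p, of a b], of "snd c"]]]
        has_derivative_mult[OF scalar[OF \<rho>[OF p]] dK[OF p, of "fst a" "fst b" "fst c"]]]
    show ?thesis
      by (subst H.koszul_deriv_eq[OF has_derivative_transform_within_open[OF d H.open_S p]])
         (simp_all add: kH algebra_simps)
  qed
  note q = W[OF p]
  \<comment> \<open>The connection of a conformal metric: \<nabla>_a b + d\<psi>(a) b + d\<psi>(b) a
    - I(a, b) grad \<psi>, where the gradient with respect to \<open>I\<close> is (0, \<eta> /
    \<kappa>).\<close>
  define \<Gamma> where "\<Gamma> a b = (christoffel \<gamma> (fst p) (fst a) (fst b) + \<eta> (snd p) *\<^sub>R (snd a *\<^sub>R fst b + snd b *\<^sub>R fst a),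
     \<eta> (snd p) * (2 * snd a * snd b - I p a b / \<kappa>))" for a b
  have I\<Gamma>: "I p (\<Gamma> a b) c = koszul \<gamma> (fst p) (fst a) (fst b) (fst c)
       + \<eta> (snd p) * (snd a * I p b c + snd b * I p a c - snd c * I p a b)" for a b c
    using \<open>\<kappa> \<noteq> 0\<close>
    by (simp add: I_def[of p _ c] \<Gamma>_def B.G_add[OF q] B.G_scale[OF q] B.christoffel_koszul[OF q] field_simps)
  have christ: "christoffel H p a b = \<Gamma> a b" for a b
    by (rule H.christoffel_unique[OF p]) (simp add: H'[OF p] I\<Gamma> kH[OF p] algebra_simps)
  have I_sym: "I p x y = I p y x" for x y
    by (simp add: I_def B.sym[OF q])
  \<comment> \<open>Koszul terms that contain a Christoffel vector become pairings by \<gamma>, so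
    that the final identity is algebra in a fixed set of quantities.\<close>
  have koszul_\<Gamma>: "koszul \<gamma> (fst p) u v (fst (\<Gamma> c d)) =
       \<gamma> (fst p) (christoffel \<gamma> (fst p) u v) (christoffel \<gamma> (fst p) (fst c) (fst d))
       + \<eta> (snd p) * (snd c * koszul \<gamma> (fst p) u v (fst d) + snd d * koszul \<gamma> (fst p) u v (fst c))" for u v c d
    by (simp add: \<Gamma>_def B.christoffel_koszul[OF q, symmetric] B.G_add[OF q] B.G_scale[OF q] del: fst_add)
  have I\<Gamma>': "I p c (\<Gamma> a b) = koszul \<gamma> (fst p) (fst a) (fst b) (fst c)
       + \<eta> (snd p) * (snd a * I p b c + snd b * I p a c - snd c * I p a b)" for a b c
    using I\<Gamma> I_sym by metis
  have snd\<Gamma>: "snd (\<Gamma> a b) = \<eta> (snd p) * (2 * snd a * snd b - I p a b / \<kappa>)" for a b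
    by (simp add: \<Gamma>_def)
  show ?thesis
    unfolding curvature_form_def christ kdH H'[OF p] I\<Gamma>[of _ _ "\<Gamma> _ _"] koszul_\<Gamma> I\<Gamma>' snd\<Gamma>
      B.metric_deriv_koszul[OF q] B.koszul_sym[OF q, of "fst b" "fst a"]
    using \<open>\<kappa> \<noteq> 0\<close>
      B.sym[OF q, of "christoffel \<gamma> (fst p) (fst b) (fst b)" "christoffel \<gamma> (fst p) (fst a) (fst a)"]
    by (simp add: I_def B.sym[OF q, of "fst b" "fst a"]) (simp add: field_simps power2_eq_square)
qed


section \<open>Charts and pushforwards\<close>

context
  fixes X :: "'m topology" and c :: "('m, 'a::euclidean_space) chart"
  assumes c: "topological_chart X c"
begin

lemma chart_domain: "openin X (fst c)" "open (snd c ` fst c)"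
  using c by (auto simp: topological_chart_def)

lemma chart_homeomorphic_map:
  "homeomorphic_map (subtopology X (fst c)) (top_of_set (snd c ` fst c)) (snd c)"
  using c by (simp add: topological_chart_def)

lemma topspace_chart: "topspace (subtopology X (fst c)) = fst c"
  using openin_subset[OF chart_domain(1)] by (rule topspace_subtopology_subset)

lemma chart_inj: "inj_on (snd c) (fst c)"
  using homeomorphic_imp_injective_map[OF chart_homeomorphic_map] by (simp only: topspace_chart)

lemma chart_inv_left: "x \<in> fst c \<Longrightarrow> chart_inv c (snd c x) = x"
  using chart_inj by (simp add: chart_inv_def)

lemma chart_inv_right: "p \<in> snd c ` fst c \<Longrightarrow> snd c (chart_inv c p) = p"
  by (simp add: chart_inv_def f_inv_into_f)

lemma chart_inv_in: "p \<in> snd c ` fst c \<Longrightarrow> chart_inv c p \<in> fst c"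
  by (simp add: chart_inv_def inv_into_into)

lemma chart_continuous: "continuous_map (subtopology X (fst c)) euclidean (snd c)"
  using homeomorphic_imp_continuous_map[OF chart_homeomorphic_map]
  by (simp add: continuous_map_in_subtopology)

lemma chart_inv_continuous: "continuous_map (top_of_set (snd c ` fst c)) X (chart_inv c)"
proof -
  obtain k where k: "homeomorphic_maps (subtopology X (fst c)) (top_of_set (snd c ` fst c)) (snd c) k"
    using chart_homeomorphic_map homeomorphic_map_maps by blast
  then have "continuous_map (top_of_set (snd c ` fst c)) X k"
    by (simp add: homeomorphic_maps_def continuous_map_in_subtopology)
  moreover have "k p = chart_inv c p" if "p \<in> topspace (top_of_set (snd c ` fst c))" for p
    using that k topspace_chart chart_inv_left by (auto simp: homeomorphic_maps_def)
  ultimately show ?thesis by (rule continuous_map_eq)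
qed

lemma chart_open_image:
  assumes "openin X V" shows "open (snd c ` (fst c \<inter> V))"
proof -
  have "openin (subtopology X (fst c)) (fst c \<inter> V)"
    using assms chart_domain(1) by (simp add: openin_open_subtopology openin_Int)
  then have "openin (top_of_set (snd c ` fst c)) (snd c ` (fst c \<inter> V))"
    using homeomorphic_imp_open_map[OF chart_homeomorphic_map] by (simp add: open_map_def)
  then show ?thesis
    using chart_domain(2) by (simp add: openin_open_eq)
qed

lemma open_param_preimage:
  fixes \<gamma> :: "'e::topological_space \<Rightarrow> 'm"
  assumes "open Q" "continuous_map (top_of_set Q) X \<gamma>"
  shows "open (Q \<inter> \<gamma> -` fst c)"
proof -
  have "openin (top_of_set Q) {q \<in> topspace (top_of_set Q). \<gamma> q \<in> fst c}"
    by (rule openin_continuous_map_preimage[OF assms(2) chart_domain(1)])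
  then show ?thesis
    using assms(1) by (simp add: openin_open_eq Int_def vimage_def)
qed

text \<open>The chain rule through a chart: near \<open>q\<close> the map
  \<open>h \<circ> \<gamma>\<close> factors through the coordinates
  \<open>snd c \<circ> \<gamma>\<close>. With \<open>h\<close> a coordinate map, a function or a map
  followed by a chart, it yields the rules for pushforwards.\<close>

lemma chart_has_derivative:
  fixes \<gamma> :: "'e::real_normed_vector \<Rightarrow> 'm" and h :: "'m \<Rightarrow> 'k::real_normed_vector"
  assumes Q: "open Q" "continuous_map (top_of_set Q) X \<gamma>" "q \<in> Q" "\<gamma> q \<in> fst c"
    and h: "(h \<circ> chart_inv c) differentiable at (snd c (\<gamma> q))"
    and d: "(snd c \<circ> \<gamma>) differentiable at q"
  shows "((h \<circ> \<gamma>) has_derivative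
    (\<lambda>u. fderiv (h \<circ> chart_inv c) (snd c (\<gamma> q)) (fderiv (snd c \<circ> \<gamma>) q u))) (at q)"
proof -
  have "((\<lambda>r. (h \<circ> chart_inv c) ((snd c \<circ> \<gamma>) r)) has_derivative
    (\<lambda>u. fderiv (h \<circ> chart_inv c) (snd c (\<gamma> q)) (fderiv (snd c \<circ> \<gamma>) q u))) (at q)"
  proof (rule has_derivative_compose[OF has_fderiv[OF d]])
    show "((h \<circ> chart_inv c) has_derivative fderiv (h \<circ> chart_inv c) (snd c (\<gamma> q))) (at ((snd c \<circ> \<gamma>) q))"
      using has_fderiv[OF h] by (metis comp_apply)
  qed
  then show ?thesis
    by (rule has_derivative_transform_within_open[OF _ open_param_preimage[OF Q(1,2)]])
       (use Q(3,4) chart_inv_left in auto)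
qed

end

text \<open>The differential of a parametrization, whose source is a normed space and needs no
  atlas. It is given in all charts at once, whereas \<open>differential\<close> is evaluated in the
  chosen chart of the source.\<close>

definition pushforward ::
  "('m, 'a::real_normed_vector) atlas \<Rightarrow> ('e::real_normed_vector \<Rightarrow> 'm) \<Rightarrow> 'e \<Rightarrow> 'e \<Rightarrow> ('m, 'a) tvec" where
  "pushforward A \<gamma> q u = (\<lambda>c. if c \<in> charts_at A (\<gamma> q) then fderiv (snd c \<circ> \<gamma>) q u else 0)"

lemma tvec_of_pushforward:
  "chart_inv c (snd c x) = x \<Longrightarrow> tvec_of A c x u = pushforward A (chart_inv c) (snd c x) u"
  by (simp add: tvec_of_def pushforward_def)

lemma charts_atD: "c \<in> charts_at A x \<Longrightarrow> c \<in> A" "c \<in> charts_at A x \<Longrightarrow> x \<in> fst c"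
  by (auto simp: charts_at_def)

lemma chart_at_nonempty_in: "charts_at A x \<noteq> {} \<Longrightarrow> chart_at A x \<in> charts_at A x"
  unfolding chart_at_def by (rule someI_ex) auto

text \<open>Only as much regularity as is known of a submanifold atlas beforehand.\<close>

locale c1_atlas =
  fixes X :: "'m topology" and A :: "('m, 'a::euclidean_space) atlas"
  assumes chart: "c \<in> A \<Longrightarrow> topological_chart X c"
    and transition: "c \<in> charts_at A x \<Longrightarrow> c' \<in> charts_at A x \<Longrightarrow>
      (snd c' \<circ> chart_inv c) differentiable at (snd c x)"
begin

lemma chart': "c \<in> charts_at A x \<Longrightarrow> topological_chart X c"
  by (rule chart[OF charts_atD(1)])

lemma chart_inv_at [simp]: "c \<in> charts_at A x \<Longrightarrow> chart_inv c (snd c x) = x"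
  by (rule chart_inv_left[OF chart' charts_atD(2)])

lemma pushforward_eq_tvec_of:
  fixes \<gamma> :: "'e::real_normed_vector \<Rightarrow> 'm"
  assumes "open Q" "continuous_map (top_of_set Q) X \<gamma>" "q \<in> Q"
    and c: "c \<in> charts_at A (\<gamma> q)" and d: "(snd c \<circ> \<gamma>) differentiable at q"
  shows "pushforward A \<gamma> q u = tvec_of A c (\<gamma> q) (fderiv (snd c \<circ> \<gamma>) q u)"
proof
  fix c'
  show "pushforward A \<gamma> q u c' = tvec_of A c (\<gamma> q) (fderiv (snd c \<circ> \<gamma>) q u) c'"
  proof (cases "c' \<in> charts_at A (\<gamma> q)")
    case True
    from fderiv_eq[OF chart_has_derivative[OF chart'[OF c] assms(1-3) charts_atD(2)[OF c] transition[OF c True] d]]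
    show ?thesis using True by (simp add: pushforward_def tvec_of_def)
  qed (simp add: pushforward_def tvec_of_def)
qed

lemma tvec_of_change:
  assumes c: "c \<in> charts_at A x" and c': "c' \<in> charts_at A x"
  shows "tvec_of A c x u = tvec_of A c' x (fderiv (snd c' \<circ> chart_inv c) (snd c x) u)"
proof -
  have "pushforward A (chart_inv c) (snd c x) u
      = tvec_of A c' (chart_inv c (snd c x)) (fderiv (snd c' \<circ> chart_inv c) (snd c x) u)"
    by (rule pushforward_eq_tvec_of[OF chart_domain(2)[OF chart'[OF c]] chart_inv_continuous[OF chart'[OF c]]])
       (use c c' charts_atD(2)[OF c] transition[OF c c'] transition[OF c c] in auto)
  then show ?thesis
    using c by (simp add: tvec_of_pushforward)
qed

lemma fderiv_chart_self:
  assumes c: "c \<in> charts_at A x"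
  shows "fderiv (snd c \<circ> chart_inv c) (snd c x) u = u"
proof -
  have "fderiv (snd c \<circ> chart_inv c) (snd c x) = fderiv (\<lambda>p. p) (snd c x)"
    by (rule fderiv_cong[OF chart_domain(2)[OF chart'[OF c]]])
       (use c charts_atD(2)[OF c] transition[OF c c] chart_inv_right[OF chart'[OF c]] in auto)
  then show ?thesis by simp
qed

lemma tvec_of_apply [simp]: "c \<in> charts_at A x \<Longrightarrow> tvec_of A c x u c = u"
  by (simp add: tvec_of_def fderiv_chart_self)

lemma tvec_of_tangent: "c \<in> charts_at A x \<Longrightarrow> tvec_of A c x u \<in> tangent_space A x"
  unfolding tangent_space_def
proof (clarsimp, intro conjI ballI allI impI)
  fix c1 c2 assume c: "c \<in> charts_at A x" and c1: "c1 \<in> charts_at A x" and c2: "c2 \<in> charts_at A x"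
  have *: "tvec_of A c x u c1 = fderiv (snd c1 \<circ> chart_inv c) (snd c x) u"
    using c1 by (simp add: tvec_of_def)
  have "tvec_of A c x u c2 = tvec_of A c1 x (tvec_of A c x u c1) c2"
    unfolding * by (rule fun_cong[OF tvec_of_change[OF c c1]])
  also have "\<dots> = fderiv (snd c2 \<circ> chart_inv c1) (snd c1 x) (tvec_of A c x u c1)"
    using c2 by (simp add: tvec_of_def[of A c1])
  finally show "tvec_of A c x u c2 = fderiv (snd c2 \<circ> chart_inv c1) (snd c1 x) (tvec_of A c x u c1)" .
qed (simp add: tvec_of_def)

lemma tangent_eq_tvec_of:
  assumes "\<xi> \<in> tangent_space A x" "c \<in> charts_at A x"
  shows "\<xi> = tvec_of A c x (\<xi> c)"
proof
  fix c'
  show "\<xi> c' = tvec_of A c x (\<xi> c) c'"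
    using assms unfolding tangent_space_def tvec_of_def mem_Collect_eq
    by (cases "c' \<in> charts_at A x") (metis (no_types, lifting))+
qed

lemma lincomb_tvec_of:
  assumes "c \<in> charts_at A x"
  shows "lincomb a (tvec_of A c x u) b (tvec_of A c x v) = tvec_of A c x (a *\<^sub>R u + b *\<^sub>R v)"
proof
  fix c'
  show "lincomb a (tvec_of A c x u) b (tvec_of A c x v) c' = tvec_of A c x (a *\<^sub>R u + b *\<^sub>R v) c'"
  proof (cases "c' \<in> charts_at A x")
    case True
    note l = linear_frechet_derivative[OF transition[OF assms True]]
    show ?thesis
      using True linear_add[OF l] linear_scale[OF l] by (simp add: lincomb_def tvec_of_def)
  qed (simp add: lincomb_def tvec_of_def)
qed

lemma tvec_of_zero: "c \<in> charts_at A x \<Longrightarrow> tvec_of A c x 0 = (\<lambda>_. 0)"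
  using lincomb_tvec_of[of c x 0 0 0 0] by (simp add: lincomb_def fun_eq_iff)

lemma tvec_of_eq_zero: "c \<in> charts_at A x \<Longrightarrow> tvec_of A c x u = (\<lambda>_. 0) \<longleftrightarrow> u = 0"
  using tvec_of_zero tvec_of_apply by metis

lemma lin_indep_tvec_of:
  assumes "c \<in> charts_at A x"
  shows "lin_indep (tvec_of A c x u) (tvec_of A c x v) \<longleftrightarrow> (\<forall>a b. a *\<^sub>R u + b *\<^sub>R v = 0 \<longrightarrow> a = 0 \<and> b = 0)"
  by (simp add: lin_indep_def lincomb_tvec_of[OF assms] tvec_of_eq_zero[OF assms])

text \<open>Every coordinate vector in the chosen chart comes from a tangent vector by
  \<open>tvec_of\<close>, and independence means the same for both, so the values can be
  parametrized by coordinate vectors.\<close>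

lemma sectional_curvatures_alt:
  assumes S: "\<And>x. x \<in> S \<Longrightarrow> charts_at A x \<noteq> {}"
  shows "sectional_curvatures A S g =
    {sectional_coord (metric_coord A g (chart_at A x)) (snd (chart_at A x) x) u v | x u v.
       x \<in> S \<and> (\<forall>a b. a *\<^sub>R u + b *\<^sub>R v = 0 \<longrightarrow> a = 0 \<and> b = 0)}" (is "?L = ?R")
proof (intro set_eqI iffI)
  fix K assume "K \<in> ?L"
  then obtain x \<xi> \<eta> where *: "K = sectional_curvature A g x \<xi> \<eta>" "x \<in> S"
    "\<xi> \<in> tangent_space A x" "\<eta> \<in> tangent_space A x" "lin_indep \<xi> \<eta>"
    unfolding sectional_curvatures_def by blast
  have c: "chart_at A x \<in> charts_at A x"
    by (rule chart_at_nonempty_in[OF S[OF *(2)]])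
  have "\<forall>a b. a *\<^sub>R \<xi> (chart_at A x) + b *\<^sub>R \<eta> (chart_at A x) = 0 \<longrightarrow> a = 0 \<and> b = 0"
    using *(5) lin_indep_tvec_of[OF c] tangent_eq_tvec_of[OF *(3) c] tangent_eq_tvec_of[OF *(4) c] by metis
  then show "K \<in> ?R"
    using * by (auto simp: sectional_curvature_def Let_def)
next
  fix K assume "K \<in> ?R"
  then obtain x u v where *: "K = sectional_coord (metric_coord A g (chart_at A x)) (snd (chart_at A x) x) u v"
    "x \<in> S" "\<forall>a b. a *\<^sub>R u + b *\<^sub>R v = 0 \<longrightarrow> a = 0 \<and> b = 0"
    by blast
  have c: "chart_at A x \<in> charts_at A x"
    by (rule chart_at_nonempty_in[OF S[OF *(2)]])
  have "K = sectional_curvature A g x (tvec_of A (chart_at A x) x u) (tvec_of A (chart_at A x) x v)"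
    using *(1) c by (simp add: sectional_curvature_def Let_def)
  then show "K \<in> ?L"
    unfolding sectional_curvatures_def
    using *(2,3) tvec_of_tangent[OF c] lin_indep_tvec_of[OF c] by blast
qed

lemma metric_coord_pushforward:
  assumes "c \<in> A" "p \<in> snd c ` fst c"
  shows "metric_coord A g c p u v = g (chart_inv c p) (pushforward A (chart_inv c) p u) (pushforward A (chart_inv c) p v)"
  using assms tvec_of_pushforward[of c "chart_inv c p"] chart_inv_right[OF chart[OF assms(1)] assms(2)]
  by (simp add: metric_coord_def)

end

text \<open>Functoriality. On vectors that come from a parametrization it frees
  \<open>differential\<close> from the chart chosen in its definition.\<close>

lemma differential_pushforward:
  fixes \<gamma> :: "'e::real_normed_vector \<Rightarrow> 'm"
  assumes "c1_atlas X A" and Q: "open Q" "continuous_map (top_of_set Q) X \<gamma>" "q \<in> Q"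
    and c: "charts_at A (\<gamma> q) \<noteq> {}"
    and d: "\<And>c. c \<in> charts_at A (\<gamma> q) \<Longrightarrow> (snd c \<circ> \<gamma>) differentiable at q"
    and F: "\<And>c c'. c \<in> charts_at A (\<gamma> q) \<Longrightarrow> c' \<in> charts_at B (F (\<gamma> q)) \<Longrightarrow>
      (snd c' \<circ> F \<circ> chart_inv c) differentiable at (snd c (\<gamma> q))"
  shows "differential A B F (\<gamma> q) (pushforward A \<gamma> q u) = pushforward B (F \<circ> \<gamma>) q u"
proof
  interpret c1_atlas X A by fact
  have c: "chart_at A (\<gamma> q) \<in> charts_at A (\<gamma> q)"
    by (rule chart_at_nonempty_in[OF c])
  fix c'
  show "differential A B F (\<gamma> q) (pushforward A \<gamma> q u) c' = pushforward B (F \<circ> \<gamma>) q u c'"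
  proof (cases "c' \<in> charts_at B (F (\<gamma> q))")
    case True
    from fderiv_eq[OF chart_has_derivative[OF chart'[OF c] Q charts_atD(2)[OF c] F[OF c True] d[OF c]]]
    show ?thesis
      using True c by (simp add: differential_def pushforward_def Let_def o_assoc)
  qed (simp add: differential_def pushforward_def)
qed

lemma dfun_pushforward:
  fixes \<gamma> :: "'e::real_normed_vector \<Rightarrow> 'm"
  assumes "c1_atlas X A" and Q: "open Q" "continuous_map (top_of_set Q) X \<gamma>" "q \<in> Q"
    and c: "charts_at A (\<gamma> q) \<noteq> {}"
    and d: "\<And>c. c \<in> charts_at A (\<gamma> q) \<Longrightarrow> (snd c \<circ> \<gamma>) differentiable at q"
    and f: "\<And>c. c \<in> charts_at A (\<gamma> q) \<Longrightarrow> (f \<circ> chart_inv c) differentiable at (snd c (\<gamma> q))"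
  shows "((f \<circ> \<gamma>) has_derivative (\<lambda>u. dfun A f (\<gamma> q) (pushforward A \<gamma> q u))) (at q)"
proof -
  interpret c1_atlas X A by fact
  have c: "chart_at A (\<gamma> q) \<in> charts_at A (\<gamma> q)"
    by (rule chart_at_nonempty_in[OF c])
  from chart_has_derivative[OF chart'[OF c] Q charts_atD(2)[OF c] f[OF c] d[OF c]]
  show ?thesis
    using c by (simp add: dfun_def pushforward_def Let_def)
qed


section \<open>Parametrizations\<close>

lemma Ck_on_local:
  assumes "\<And>x. x \<in> S \<Longrightarrow> \<exists>T. open T \<and> x \<in> T \<and> Ck_on k f T"
  shows "Ck_on k f S"
  using assms
proof (induction k arbitrary: f)
  case 0
  then have "continuous (at x) f" if "x \<in> S" for x
    using that continuous_on_eq_continuous_at by fastforce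
  then show ?case
    by (simp add: continuous_at_imp_continuous_on)
next
  case (Suc k)
  have "Ck_on k (\<lambda>x. fderiv f x v) S" for v
    by (rule Suc.IH) (use Suc.prems in fastforce)
  then show ?case
    using Suc.prems by fastforce
qed

text \<open>Maps from an open Euclidean set into the manifold that are regular in all charts. The
  order \<open>k\<close> is finite so that the rules for \<open>Ck_on\<close> apply directly;
  smoothness is the statement for every \<open>k\<close>.\<close>

definition Ck_param ::
  "'m topology \<Rightarrow> ('m, 'a::euclidean_space) atlas \<Rightarrow> nat \<Rightarrow> 'e::euclidean_space set \<Rightarrow> ('e \<Rightarrow> 'm) \<Rightarrow> bool" where
  "Ck_param X A k Q \<gamma> \<longleftrightarrow> open Q \<and> continuous_map (top_of_set Q) X \<gamma> \<and>
     (\<forall>c\<in>A. Ck_on k (snd c \<circ> \<gamma>) (Q \<inter> \<gamma> -` fst c))"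

lemma Ck_param_open: "Ck_param X A k Q \<gamma> \<Longrightarrow> open Q"
  and Ck_param_continuous: "Ck_param X A k Q \<gamma> \<Longrightarrow> continuous_map (top_of_set Q) X \<gamma>"
  by (auto simp: Ck_param_def)

lemma Ck_param_topspace: "Ck_param X A k Q \<gamma> \<Longrightarrow> q \<in> Q \<Longrightarrow> \<gamma> q \<in> topspace X"
  by (auto simp: Ck_param_def continuous_map_def)

lemma Ck_param_Ck_on: "Ck_param X A k Q \<gamma> \<Longrightarrow> c \<in> A \<Longrightarrow> Ck_on k (snd c \<circ> \<gamma>) (Q \<inter> \<gamma> -` fst c)"
  by (simp add: Ck_param_def)

lemma Ck_param_differentiable:
  assumes "Ck_param X A (Suc k) Q \<gamma>" "q \<in> Q" "c \<in> charts_at A (\<gamma> q)"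
  shows "(snd c \<circ> \<gamma>) differentiable at q"
  by (rule Ck_on_differentiable[OF Ck_param_Ck_on[OF assms(1) charts_atD(1)[OF assms(3)]]])
     (simp add: assms(2) charts_atD(2)[OF assms(3)])

lemma Ck_param_subset: "Ck_param X A k Q \<gamma> \<Longrightarrow> open P \<Longrightarrow> P \<subseteq> Q \<Longrightarrow> Ck_param X A k P \<gamma>"
  unfolding Ck_param_def
  by (meson Ck_on_subset Int_mono continuous_map_from_subtopology_mono order_refl)

lemma Ck_param_cong:
  assumes "Ck_param X A k Q \<gamma>" "\<And>q. q \<in> Q \<Longrightarrow> \<gamma> q = \<gamma>' q" "\<And>c. c \<in> A \<Longrightarrow> topological_chart X c"
  shows "Ck_param X A k Q \<gamma>'"
proof -
  have "Q \<inter> \<gamma>' -` fst c = Q \<inter> \<gamma> -` fst c" for c :: "('a, 'b) chart"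
    using assms(2) by auto
  moreover have "Ck_on k (snd c \<circ> \<gamma>') (Q \<inter> \<gamma> -` fst c)" if "c \<in> A" for c
    by (rule Ck_on_cong[OF open_param_preimage[OF assms(3)[OF that]] _ Ck_param_Ck_on[OF assms(1) that]])
       (use assms(1,2) in \<open>auto simp: Ck_param_def\<close>)
  moreover have "continuous_map (top_of_set Q) X \<gamma>'"
    by (rule continuous_map_eq[OF Ck_param_continuous[OF assms(1)]]) (use assms(2) in auto)
  ultimately show ?thesis
    using assms(1) by (simp add: Ck_param_def)
qed

lemma Ck_param_compose:
  fixes \<phi> :: "'d::euclidean_space \<Rightarrow> 'e::euclidean_space"
  assumes \<gamma>: "Ck_param X A k Q \<gamma>" and P: "open P" "Ck_on k \<phi> P" "\<phi> ` P \<subseteq> Q"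
    and chart: "\<And>c. c \<in> A \<Longrightarrow> topological_chart X c"
  shows "Ck_param X A k P (\<gamma> \<circ> \<phi>)"
proof -
  have "continuous_map (top_of_set P) (top_of_set Q) \<phi>"
    using Ck_on_continuous[OF P(2)] P(3) by auto
  then have cont: "continuous_map (top_of_set P) X (\<gamma> \<circ> \<phi>)"
    using Ck_param_continuous[OF \<gamma>] continuous_map_compose by blast
  have "Ck_on k (snd c \<circ> (\<gamma> \<circ> \<phi>)) (P \<inter> (\<gamma> \<circ> \<phi>) -` fst c)" if "c \<in> A" for c
  proof -
    have "Ck_on k (\<lambda>x. (snd c \<circ> \<gamma>) (\<phi> x)) (P \<inter> (\<gamma> \<circ> \<phi>) -` fst c)"
    proof (rule Ck_on_compose[where f = "snd c \<circ> \<gamma>" and g = \<phi>])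
      show "open (P \<inter> (\<gamma> \<circ> \<phi>) -` fst c)"
        by (rule open_param_preimage[OF chart[OF that] P(1) cont])
      show "open (Q \<inter> \<gamma> -` fst c)"
        by (rule open_param_preimage[OF chart[OF that] Ck_param_open[OF \<gamma>] Ck_param_continuous[OF \<gamma>]])
      show "Ck_on k \<phi> (P \<inter> (\<gamma> \<circ> \<phi>) -` fst c)"
        by (rule Ck_on_subset[OF P(2)]) auto
    qed (use P(3) Ck_param_Ck_on[OF \<gamma> that] in auto)
    then show ?thesis by (simp add: o_def)
  qed
  then show ?thesis
    using P(1) cont by (simp add: Ck_param_def)
qed

locale manifold =
  fixes X :: "'m topology" and A :: "('m, 'a::euclidean_space) atlas"
  assumes manifold: "smooth_manifold X A"

sublocale manifold \<subseteq> c1_atlas X A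
proof
  show chart: "topological_chart X c" if "c \<in> A" for c
    using manifold that by (simp add: smooth_manifold_def)
  show "(snd c' \<circ> chart_inv c) differentiable at (snd c x)"
    if "c \<in> charts_at A x" "c' \<in> charts_at A x" for c c' x
    using manifold that
    by (intro smooth_on_differentiable[of "snd c ` (fst c \<inter> fst c')"]) (auto simp: smooth_manifold_def charts_at_def)
qed

context manifold
begin

lemma charts_at_nonempty: "x \<in> topspace X \<Longrightarrow> charts_at A x \<noteq> {}"
proof -
  assume "x \<in> topspace X"
  then obtain c where "c \<in> A" "x \<in> fst c"
    using manifold unfolding smooth_manifold_def by blast
  then show ?thesis unfolding charts_at_def by blast
qed

lemma chart_at: "x \<in> topspace X \<Longrightarrow> chart_at A x \<in> charts_at A x"
  by (rule chart_at_nonempty_in[OF charts_at_nonempty])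

lemma Ck_param_chart_inv:
  assumes "c \<in> A" shows "Ck_param X A k (snd c ` fst c) (chart_inv c)"
proof -
  have "snd c ` fst c \<inter> chart_inv c -` fst c' = snd c ` (fst c \<inter> fst c')" for c' :: "('m, 'a) chart"
    using chart_inv_left[OF chart[OF assms]] by force
  moreover have "Ck_on k (snd c' \<circ> chart_inv c) (snd c ` (fst c \<inter> fst c'))" if "c' \<in> A" for c'
  proof (rule smooth_on_Ck)
    show "smooth_on (snd c ` (fst c \<inter> fst c')) (snd c' \<circ> chart_inv c)"
      using manifold assms that by (simp add: smooth_manifold_def)
  qed
  ultimately show ?thesis
    using chart_domain(2)[OF chart[OF assms]] chart_inv_continuous[OF chart[OF assms]]
    by (simp add: Ck_param_def)
qed

lemma Ck_on_fun_param:
  assumes \<gamma>: "Ck_param X A k Q \<gamma>" and f: "\<And>c. c \<in> A \<Longrightarrow> Ck_on k (f \<circ> chart_inv c) (snd c ` fst c)"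
  shows "Ck_on k (f \<circ> \<gamma>) Q"
proof (rule Ck_on_local)
  fix q assume q: "q \<in> Q"
  let ?c = "chart_at A (\<gamma> q)"
  have c: "?c \<in> A" "\<gamma> q \<in> fst ?c"
    using chart_at[OF Ck_param_topspace[OF \<gamma> q]] by (simp_all add: charts_at_def)
  define P where "P = Q \<inter> \<gamma> -` fst ?c"
  have P: "open P"
    unfolding P_def by (rule open_param_preimage[OF chart[OF c(1)] Ck_param_open[OF \<gamma>] Ck_param_continuous[OF \<gamma>]])
  have "Ck_on k (\<lambda>r. (f \<circ> chart_inv ?c) ((snd ?c \<circ> \<gamma>) r)) P"
    unfolding P_def
    by (rule Ck_on_compose[where g = "snd ?c \<circ> \<gamma>", OF P[unfolded P_def] chart_domain(2)[OF chart[OF c(1)]] _ f[OF c(1)]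
          Ck_param_Ck_on[OF \<gamma> c(1)]]) auto
  then have "Ck_on k (f \<circ> \<gamma>) P"
    by (rule Ck_on_cong[OF P, rotated]) (use chart_inv_left[OF chart[OF c(1)]] in \<open>auto simp: P_def\<close>)
  then show "\<exists>T. open T \<and> q \<in> T \<and> Ck_on k (f \<circ> \<gamma>) T"
    using P q c(2) by (auto simp: P_def)
qed

end


section \<open>Submanifold atlases\<close>

text \<open>Makes transition maps of submanifold charts differentiable once they are continuous. A
  left inverse \<open>L\<close> of the derivative of \<open>F\<close> recovers \<tau> y - \<tau> x
  from L (k y - k x) up to an error that continuity of \<tau> makes small relative to |\<tau> y -
  \<tau> x|. Absorbing this error bounds |\<tau> y - \<tau> x| by a multiple of |y - x|, and then
  the error is small relative to |y - x|.\<close>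

lemma differentiable_through_immersion:
  fixes F :: "'b::euclidean_space \<Rightarrow> 'a::euclidean_space" and \<tau> :: "'e::real_normed_vector \<Rightarrow> 'b"
  assumes F: "F differentiable at (\<tau> x)" and inj: "inj (fderiv F (\<tau> x))" and \<tau>: "isCont \<tau> x"
    and k: "k differentiable at x" and S: "open S" "x \<in> S" and eq: "\<And>y. y \<in> S \<Longrightarrow> F (\<tau> y) = k y"
  shows "\<tau> differentiable at x"
proof -
  define F' where "F' = fderiv F (\<tau> x)"
  define k' where "k' = fderiv k x"
  have F': "(F has_derivative F') (at (\<tau> x))" and k': "(k has_derivative k') (at x)"
    using has_fderiv[OF F] has_fderiv[OF k] by (auto simp: F'_def k'_def)
  obtain L where L: "linear L" "L \<circ> F' = id"
    using linear_injective_left_inverse[OF has_derivative_linear[OF F']] inj by (auto simp: F'_def)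
  have LF: "L (F' v) = v" for v
    using L(2) by (metis comp_apply id_apply)
  note bL = linear_conv_bounded_linear[THEN iffD1, OF L(1)]
  obtain K where K: "K > 0" "\<And>v. norm (L v) \<le> norm v * K"
    using bounded_linear.pos_bounded[OF bL] by blast
  obtain B where B: "B > 0" "\<And>v. norm (k' v) \<le> norm v * B"
    using bounded_linear.pos_bounded[OF has_derivative_bounded_linear[OF k']] by blast
  obtain r where r: "r > 0" "ball x r \<subseteq> S"
    using S openE by blast
  obtain dk where dk: "dk > 0" "\<And>y. norm (y - x) < dk \<Longrightarrow> norm (k y - k x - k' (y - x)) \<le> 1 * norm (y - x)"
    using k' unfolding has_derivative_at_alt by (metis zero_less_one)
  have "(\<tau> has_derivative (\<lambda>v. L (k' v))) (at x)"
    unfolding has_derivative_at_alt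
  proof (intro conjI allI impI)
    show "bounded_linear (\<lambda>v. L (k' v))"
      using bounded_linear_compose[OF bL has_derivative_bounded_linear[OF k']] .
    fix e :: real assume e: "e > 0"
    define M where "M = 2 * K * (B + 1)"
    have M: "M > 0" using K(1) B(1) by (simp add: M_def)
    \<comment> \<open>The first bound makes K e1 at most 1/2, so that half of |z| can be absorbed
      and |z| is at most M |y - x|; the second makes the remaining error K e1 M at most e /
      2.\<close>
    define e1 where "e1 = min (1 / (2 * K)) (e / (2 * K * M))"
    have e1: "e1 > 0" "K * e1 \<le> 1 / 2" "K * e1 * M \<le> e / 2"
    proof -
      show "e1 > 0" using e K(1) M by (simp add: e1_def)
      have "e1 \<le> 1 / (2 * K)" "e1 \<le> e / (2 * K * M)"
        by (simp_all add: e1_def)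
      then show "K * e1 \<le> 1 / 2" "K * e1 * M \<le> e / 2"
        using K(1) M by (auto simp: field_simps)
    qed
    obtain dF where dF: "dF > 0"
      "\<And>z. norm (z - \<tau> x) < dF \<Longrightarrow> norm (F z - F (\<tau> x) - F' (z - \<tau> x)) \<le> e1 * norm (z - \<tau> x)"
      using F' e1(1) unfolding has_derivative_at_alt by blast
    obtain d\<tau> where d\<tau>: "d\<tau> > 0" "\<And>y. norm (y - x) < d\<tau> \<Longrightarrow> norm (\<tau> y - \<tau> x) < dF"
      using \<tau> dF(1) unfolding continuous_at_eps_delta dist_norm by blast
    have "e / (2 * K) > 0" using e K(1) by simp
    then obtain dk' where dk': "dk' > 0"
      "\<And>y. norm (y - x) < dk' \<Longrightarrow> norm (k y - k x - k' (y - x)) \<le> e / (2 * K) * norm (y - x)"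
      using k' unfolding has_derivative_at_alt by blast
    define d where "d = min (min r dk) (min d\<tau> dk')"
    have "norm (\<tau> y - \<tau> x - L (k' (y - x))) \<le> e * norm (y - x)" if "norm (y - x) < d" for y
    proof -
      have yS: "y \<in> S"
        using that r(2) by (auto simp: d_def dist_norm norm_minus_commute)
      have near: "norm (\<tau> y - \<tau> x) < dF" "norm (y - x) < dk" "norm (y - x) < dk'"
        using that d\<tau>(2) by (auto simp: d_def)
      define z where "z = \<tau> y - \<tau> x"
      have k_diff: "F (\<tau> y) - F (\<tau> x) = k y - k x"
        using eq yS S(2) by simp
      have err: "norm (L (k y - k x) - z) \<le> K * e1 * norm z"
      proof -
        have "L (k y - k x) - z = L (F (\<tau> y) - F (\<tau> x) - F' z)"
          by (simp add: k_diff linear_diff[OF L(1)] LF)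
        also have "norm \<dots> \<le> norm (F (\<tau> y) - F (\<tau> x) - F' z) * K" by (rule K(2))
        also have "\<dots> \<le> (e1 * norm z) * K"
          using dF(2)[OF near(1)] K(1) by (intro mult_right_mono) (auto simp: z_def)
        finally show ?thesis by (simp add: mult_ac)
      qed
      have kB: "norm (k y - k x) \<le> (B + 1) * norm (y - x)"
      proof -
        have "norm (k y - k x) \<le> norm (k y - k x - k' (y - x)) + norm (k' (y - x))"
          using norm_triangle_ineq[of "k y - k x - k' (y - x)" "k' (y - x)"] by simp
        also have "\<dots> \<le> (B + 1) * norm (y - x)"
          using dk(2)[OF near(2)] B(2)[of "y - x"] by (simp add: algebra_simps)
        finally show ?thesis .
      qed
      have "norm z \<le> norm (L (k y - k x)) + norm (L (k y - k x) - z)"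
        using norm_triangle_ineq4[of "L (k y - k x)" "L (k y - k x) - z"] by simp
      also have "\<dots> \<le> norm (k y - k x) * K + 1 / 2 * norm z"
        using K(2)[of "k y - k x"] err mult_right_mono[OF e1(2) norm_ge_zero[of z]] by linarith
      finally have "norm z \<le> 2 * K * norm (k y - k x)" by (simp add: field_simps)
      also have "\<dots> \<le> 2 * K * ((B + 1) * norm (y - x))"
        using kB K(1) by (intro mult_left_mono) auto
      finally have z: "norm z \<le> M * norm (y - x)" by (simp only: M_def mult.assoc)
      have "\<tau> y - \<tau> x - L (k' (y - x)) = L (k y - k x - k' (y - x)) - (L (k y - k x) - z)"
        by (simp add: linear_diff[OF L(1)] z_def)
      then have "norm (\<tau> y - \<tau> x - L (k' (y - x))) \<le> norm (L (k y - k x - k' (y - x))) + norm (L (k y - k x) - z)"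
        by (metis norm_triangle_ineq4)
      also have "norm (L (k y - k x - k' (y - x))) \<le> e / (2 * K) * norm (y - x) * K"
        using order_trans[OF K(2) mult_right_mono[OF dk'(2)[OF near(3)]]] K(1) by simp
      also have "\<dots> = e / 2 * norm (y - x)" using K(1) by simp
      also have "norm (L (k y - k x) - z) \<le> K * e1 * (M * norm (y - x))"
        by (rule order_trans[OF err mult_left_mono[OF z]]) (use K(1) e1(1) in simp)
      also have "\<dots> \<le> e / 2 * norm (y - x)"
        using mult_right_mono[OF e1(3) norm_ge_zero[of "y - x"]] by (simp add: mult_ac)
      finally show ?thesis by simp
    qed
    then show "\<exists>d>0. \<forall>y. norm (y - x) < d \<longrightarrow> norm (\<tau> y - \<tau> x - L (k' (y - x))) \<le> e * norm (y - x)"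
      using r(1) dk(1) d\<tau>(1) dk'(1) by (intro exI[of _ d]) (auto simp: d_def)
  qed
  then show ?thesis by (auto simp: differentiable_def)
qed

lemma chart_inv_id: "q \<in> Q \<Longrightarrow> chart_inv (Q, id) q = q"
  by (simp add: chart_inv_def f_inv_into_f[of q id Q, simplified])

context manifold
begin

lemma submanifold_chart_param:
  assumes d: "d \<in> submanifold_atlas X A N"
  shows "Ck_param X A k (snd d ` fst d) (chart_inv d)"
proof -
  let ?Q = "snd d ` fst d"
  have chart_d: "topological_chart (subtopology X N) d"
    and sm: "smooth_map (top_of_set ?Q) (open_atlas ?Q) X A (chart_inv d)"
    using d by (auto simp: submanifold_atlas_def)
  have Q: "open ?Q" by (rule chart_domain(2)[OF chart_d])
  have cont: "continuous_map (top_of_set ?Q) X (chart_inv d)"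
    using sm by (simp add: smooth_map_def)
  have "Ck_on k (snd c \<circ> chart_inv d) (?Q \<inter> chart_inv d -` fst c)" if c: "c \<in> A" for c
  proof -
    have "smooth_on (?Q \<inter> chart_inv d -` fst c) (snd c \<circ> chart_inv d \<circ> chart_inv (?Q, id))"
      using sm c by (auto simp: smooth_map_def open_atlas_def)
    then show ?thesis
      by (intro Ck_on_cong[OF open_param_preimage[OF chart[OF c] Q cont] _ smooth_on_Ck])
         (auto simp: chart_inv_id)
  qed
  then show ?thesis
    using Q cont by (simp add: Ck_param_def)
qed

lemma submanifold_chart_at_subset:
  assumes "d \<in> charts_at (submanifold_atlas X A N) y"
  shows "y \<in> N" "y \<in> topspace X"
proof -
  have "topological_chart (subtopology X N) d"
    using charts_atD(1)[OF assms] by (simp add: submanifold_atlas_def)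
  from openin_subset[OF chart_domain(1)[OF this]] charts_atD(2)[OF assms]
  show "y \<in> N" "y \<in> topspace X" by auto
qed

text \<open>The definition of the atlas does not mention transition maps. They are continuous
  because the charts are homeomorphisms; followed by the immersion \<open>chart_inv e\<close>, read
  in an ambient chart, they give the smooth map \<open>chart_inv d\<close>, so
  \<open>differentiable_through_immersion\<close> applies.\<close>

lemma submanifold_c1_atlas: "c1_atlas (subtopology X N) (submanifold_atlas X A N)"
proof
  show chart_N: "topological_chart (subtopology X N) d" if "d \<in> submanifold_atlas X A N"
    for d :: "('m, 'b::euclidean_space) chart"
    using that by (simp add: submanifold_atlas_def)
  fix d e :: "('m, 'b::euclidean_space) chart" and y
  assume d: "d \<in> charts_at (submanifold_atlas X A N) y" and e: "e \<in> charts_at (submanifold_atlas X A N) y"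
  note d' = chart_N[OF charts_atD(1)[OF d]] and e' = chart_N[OF charts_atD(1)[OF e]]
  note dy = chart_inv_left[OF d' charts_atD(2)[OF d]] and ey = chart_inv_left[OF e' charts_atD(2)[OF e]]
  let ?c = "chart_at A y"
  have c: "?c \<in> charts_at A y"
    by (rule chart_at[OF submanifold_chart_at_subset(2)[OF d]])
  define P where "P = snd d ` fst d \<inter> chart_inv d -` fst e"
  have cont_d: "continuous_map (top_of_set (snd d ` fst d)) (subtopology X N) (chart_inv d)"
    by (rule chart_inv_continuous[OF d'])
  have P: "open P"
    unfolding P_def by (rule open_param_preimage[OF e' chart_domain(2)[OF d'] cont_d])
  have yP: "snd d y \<in> P"
    using charts_atD(2)[OF d] charts_atD(2)[OF e] by (simp add: P_def dy)
  have "continuous_map (top_of_set P) (subtopology (subtopology X N) (fst e)) (chart_inv d)"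
    using continuous_map_from_subtopology_mono[OF cont_d, of P]
    by (auto simp: continuous_map_in_subtopology[of _ "subtopology X N"] P_def)
  from continuous_map_compose[OF this chart_continuous[OF e']]
  have "continuous_on P (snd e \<circ> chart_inv d)" by simp
  then have "isCont (snd e \<circ> chart_inv d) (snd d y)"
    using P yP continuous_on_eq_continuous_at by blast
  then show "(snd e \<circ> chart_inv d) differentiable at (snd d y)"
  proof (rule differentiable_through_immersion[where F = "snd ?c \<circ> chart_inv e", rotated 2])
    show "(snd ?c \<circ> chart_inv d) differentiable at (snd d y)"
      using Ck_param_differentiable[where q = "snd d y" and c = ?c and k = 0,
          OF submanifold_chart_param[OF charts_atD(1)[OF d]]]
        c charts_atD(2)[OF d] by (simp add: dy)
    show "(snd ?c \<circ> chart_inv e) differentiable at ((snd e \<circ> chart_inv d) (snd d y))"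
      using Ck_param_differentiable[where q = "snd e y" and c = ?c and k = 0,
          OF submanifold_chart_param[OF charts_atD(1)[OF e]]]
        c charts_atD(2)[OF e] by (simp add: dy ey)
    show "inj (fderiv (snd ?c \<circ> chart_inv e) ((snd e \<circ> chart_inv d) (snd d y)))"
      using charts_atD[OF e] c by (simp add: submanifold_atlas_def dy)
    show "(snd ?c \<circ> chart_inv e) ((snd e \<circ> chart_inv d) r) = (snd ?c \<circ> chart_inv d) r" if "r \<in> P" for r
      using that chart_inv_left[OF e'] by (simp add: P_def)
  qed (rule P yP)+
qed

end


section \<open>Homogeneous pairs\<close>

locale homogeneous = manifold X A
  for X :: "'m topology" and A :: "('m, 'a::euclidean_space) atlas" +
  fixes m :: "real \<Rightarrow> 'm \<Rightarrow> 'm" and \<alpha> :: real and g :: "('m, 'a) metric" and f :: "'m \<Rightarrow> real"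
  assumes action: "smooth_free_action X A m" and pair: "homogeneous_pair X A m \<alpha> g f"
begin

lemma alpha_nonzero: "\<alpha> \<noteq> 0"
  using pair by (simp add: homogeneous_pair_def)

lemma action_one: "x \<in> topspace X \<Longrightarrow> m 1 x = x"
  and action_mult: "s > 0 \<Longrightarrow> t > 0 \<Longrightarrow> x \<in> topspace X \<Longrightarrow> m s (m t x) = m (s * t) x"
  using action by (auto simp: smooth_free_action_def)

lemma action_continuous_map:
  "continuous_map (prod_topology (top_of_set {0<..}) X) X (\<lambda>(t, x). m t x)"
  using action by (simp add: smooth_free_action_def smooth_map_def)

lemma action_in: "t > 0 \<Longrightarrow> x \<in> topspace X \<Longrightarrow> m t x \<in> topspace X"
  using action_continuous_map by (auto simp: continuous_map_def Pi_iff)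

lemma action_exp: "x \<in> topspace X \<Longrightarrow> m (exp s) (m (exp t) x) = m (exp (s + t)) x"
  by (simp add: action_mult exp_add)

lemma f_continuous: "continuous_map X (top_of_set {0<..}) f"
  using pair by (simp add: homogeneous_pair_def smooth_map_def)

lemma f_pos: "x \<in> topspace X \<Longrightarrow> f x > 0"
  using f_continuous by (auto simp: continuous_map_in_subtopology)

lemma f_action: "t > 0 \<Longrightarrow> x \<in> topspace X \<Longrightarrow> f (m t x) = t powr \<alpha> * f x"
  using pair by (simp add: homogeneous_pair_def)

lemma f_Ck:
  assumes c: "c \<in> A" shows "Ck_on k (f \<circ> chart_inv c) (snd c ` fst c)"
proof -
  have "smooth_on (snd c ` (fst c \<inter> f -` {0<..})) (id \<circ> f \<circ> chart_inv c)"
    using pair c by (auto simp: homogeneous_pair_def smooth_map_def open_atlas_def)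
  moreover have "fst c \<inter> f -` {0<..} = fst c"
    using f_pos openin_subset[OF chart_domain(1)[OF chart[OF c]]] by auto
  ultimately show ?thesis
    by (simp add: smooth_on_def)
qed

lemma Ck_on_f_param: "Ck_param X A k Q \<gamma> \<Longrightarrow> Ck_on k (f \<circ> \<gamma>) Q"
  by (rule Ck_on_fun_param[OF _ f_Ck])

lemma action_param_continuous:
  assumes "continuous_map (top_of_set Q) X \<gamma>" "continuous_on Q \<tau>" "\<And>q. q \<in> Q \<Longrightarrow> \<tau> q > 0"
  shows "continuous_map (top_of_set Q) X (\<lambda>q. m (\<tau> q) (\<gamma> q))"
proof -
  have "continuous_map (top_of_set Q) (top_of_set {0<..}) \<tau>"
    using assms(2,3) by auto
  from continuous_map_compose[OF continuous_map_pairedI[OF this assms(1)] action_continuous_map]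
  show ?thesis by (simp add: o_def)
qed

text \<open>Smoothness of the action is given for the atlas of the product. The facts
  \<open>cp\<close> and \<open>img\<close> compute the inverse and the image of a product chart, so
  that the action becomes an ordinary map of pairs (t, p).\<close>

lemma action_Ck_on:
  assumes c: "c \<in> A" "c' \<in> A"
  shows "open {z. fst z > 0 \<and> snd z \<in> snd c ` fst c \<and> m (fst z) (chart_inv c (snd z)) \<in> fst c'}"
    and "Ck_on k (\<lambda>z. snd c' (m (fst z) (chart_inv c (snd z))))
      {z. fst z > 0 \<and> snd z \<in> snd c ` fst c \<and> m (fst z) (chart_inv c (snd z)) \<in> fst c'}"
proof -
  let ?D = "{z. fst z > 0 \<and> snd z \<in> snd c ` fst c \<and> m (fst z) (chart_inv c (snd z)) \<in> fst c'}"
  let ?Q = "{0::real<..} \<times> snd c ` fst c"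
  have Q: "open ?Q"
    by (intro open_Times chart_domain(2)[OF chart[OF c(1)]] open_greaterThan)
  have "continuous_map (top_of_set ?Q) (top_of_set (snd c ` fst c)) snd"
    by (auto intro!: continuous_intros)
  from continuous_map_compose[OF this chart_inv_continuous[OF chart[OF c(1)]]]
  have "continuous_map (top_of_set ?Q) X (\<lambda>z. m (fst z) (chart_inv c (snd z)))"
    by (intro action_param_continuous) (auto simp: o_def intro!: continuous_intros)
  from open_param_preimage[OF chart[OF c(2)] Q this]
  show D: "open ?D"
    by (rule back_subst[where P = "open"]) auto
  let ?cp = "({0<..} \<times> fst c, map_prod id (snd c)) :: (real \<times> 'm, real \<times> 'a) chart"
  have cp: "chart_inv ?cp z = (fst z, chart_inv c (snd z))" if "z \<in> ?Q" for z
  proof -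
    let ?w = "(fst z, chart_inv c (snd z))"
    have "inj_on (map_prod id (snd c)) ({0::real<..} \<times> fst c)"
      using chart_inj[OF chart[OF c(1)]] by (auto simp: inj_on_def)
    moreover have "?w \<in> {0<..} \<times> fst c"
      using chart_inv_in[OF chart[OF c(1)]] that by auto
    ultimately have "inv_into ({0<..} \<times> fst c) (map_prod id (snd c)) (map_prod id (snd c) ?w) = ?w"
      by (rule inv_into_f_f)
    moreover have "map_prod id (snd c) ?w = z"
      using chart_inv_right[OF chart[OF c(1)]] that by auto
    ultimately show ?thesis
      by (simp only: chart_inv_def fst_conv snd_conv)
  qed
  have img: "snd ?cp ` (fst ?cp \<inter> (\<lambda>(t, x). m t x) -` fst c') = ?D"
  proof (intro set_eqI iffI)
    fix z assume "z \<in> ?D"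
    then have "z = snd ?cp (fst z, chart_inv c (snd z))"
      "(fst z, chart_inv c (snd z)) \<in> fst ?cp \<inter> (\<lambda>(t, x). m t x) -` fst c'"
      using chart_inv_right[OF chart[OF c(1)]] chart_inv_in[OF chart[OF c(1)]] by (auto simp: prod_eq_iff)
    then show "z \<in> snd ?cp ` (fst ?cp \<inter> (\<lambda>(t, x). m t x) -` fst c')" by (rule image_eqI)
  qed (auto simp: chart_inv_left[OF chart[OF c(1)]])
  have "?cp \<in> prod_atlas (open_atlas {0<..}) A"
    using c(1) by (force simp: prod_atlas_def open_atlas_def)
  from action[unfolded smooth_free_action_def, THEN conjunct1, unfolded smooth_map_def, THEN conjunct2,
      rule_format, OF this c(2)]
  have "smooth_on ?D (snd c' \<circ> (\<lambda>(t, x). m t x) \<circ> chart_inv ?cp)"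
    unfolding img .
  then show "Ck_on k (\<lambda>z. snd c' (m (fst z) (chart_inv c (snd z)))) ?D"
    by (intro Ck_on_cong[OF D _ smooth_on_Ck]) (auto simp: cp)
qed

lemma Ck_param_action:
  fixes \<gamma> :: "'e::euclidean_space \<Rightarrow> 'm"
  assumes \<gamma>: "Ck_param X A k Q \<gamma>" and \<tau>: "Ck_on k \<tau> Q" "\<And>q. q \<in> Q \<Longrightarrow> \<tau> q > 0"
  shows "Ck_param X A k Q (\<lambda>q. m (\<tau> q) (\<gamma> q))"
proof -
  note Q = Ck_param_open[OF \<gamma>]
  have cont: "continuous_map (top_of_set Q) X (\<lambda>q. m (\<tau> q) (\<gamma> q))"
    by (rule action_param_continuous[OF Ck_param_continuous[OF \<gamma>] Ck_on_continuous[OF \<tau>(1)] \<tau>(2)])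
  have "Ck_on k (snd c' \<circ> (\<lambda>q. m (\<tau> q) (\<gamma> q))) (Q \<inter> (\<lambda>q. m (\<tau> q) (\<gamma> q)) -` fst c')" if c': "c' \<in> A" for c'
  proof (rule Ck_on_local)
    fix q assume q: "q \<in> Q \<inter> (\<lambda>q. m (\<tau> q) (\<gamma> q)) -` fst c'"
    let ?c = "chart_at A (\<gamma> q)"
    have c: "?c \<in> A" "\<gamma> q \<in> fst ?c"
      using chart_at[OF Ck_param_topspace[OF \<gamma>, of q]] q by (simp_all add: charts_at_def)
    define P where "P = (Q \<inter> \<gamma> -` fst ?c) \<inter> (Q \<inter> (\<lambda>q. m (\<tau> q) (\<gamma> q)) -` fst c')"
    have P: "open P"
      unfolding P_def
      by (intro open_Int open_param_preimage[OF chart[OF c(1)] Q Ck_param_continuous[OF \<gamma>]]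
          open_param_preimage[OF chart[OF c'] Q cont])
    let ?D = "{z. fst z > 0 \<and> snd z \<in> snd ?c ` fst ?c \<and> m (fst z) (chart_inv ?c (snd z)) \<in> fst c'}"
    let ?z = "\<lambda>q. (\<tau> q, (snd ?c \<circ> \<gamma>) q)"
    have "Ck_on k (\<lambda>q. (\<lambda>z. snd c' (m (fst z) (chart_inv ?c (snd z)))) (?z q)) P"
    proof (rule Ck_on_compose[where g = ?z and T = ?D, OF P action_Ck_on(1)[OF c(1) c'] _ action_Ck_on(2)[OF c(1) c']])
      show "Ck_on k ?z P"
      proof (rule Ck_on_Pair[OF P])
        show "Ck_on k \<tau> P"
          by (rule Ck_on_subset[OF \<tau>(1)]) (auto simp: P_def)
        show "Ck_on k (snd ?c \<circ> \<gamma>) P"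
          by (rule Ck_on_subset[OF Ck_param_Ck_on[OF \<gamma> c(1)]]) (auto simp: P_def)
      qed
    qed (use \<tau>(2) chart_inv_left[OF chart[OF c(1)]] in \<open>auto simp: P_def\<close>)
    then have "Ck_on k (snd c' \<circ> (\<lambda>q. m (\<tau> q) (\<gamma> q))) P"
      by (rule Ck_on_cong[OF P, rotated]) (use chart_inv_left[OF chart[OF c(1)]] in \<open>auto simp: P_def\<close>)
    then show "\<exists>T. open T \<and> q \<in> T \<and> Ck_on k (snd c' \<circ> (\<lambda>q. m (\<tau> q) (\<gamma> q))) T"
      using P q c(2) by (intro exI[of _ P]) (auto simp: P_def)
  qed
  then show ?thesis
    using Q cont by (simp add: Ck_param_def)
qed

lemma Ck_param_const: "x \<in> topspace X \<Longrightarrow> Ck_param X A k UNIV (\<lambda>_. x)"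
  by (auto simp: Ck_param_def o_def)

lemma pushforward_tangent:
  assumes \<gamma>: "Ck_param X A (Suc k) Q \<gamma>" "q \<in> Q"
  shows "pushforward A \<gamma> q u \<in> tangent_space A (\<gamma> q)"
proof -
  have c: "chart_at A (\<gamma> q) \<in> charts_at A (\<gamma> q)"
    by (rule chart_at[OF Ck_param_topspace[OF assms]])
  show ?thesis
    unfolding pushforward_eq_tvec_of[OF Ck_param_open[OF \<gamma>(1)] Ck_param_continuous[OF \<gamma>(1)] \<gamma>(2) c
        Ck_param_differentiable[OF \<gamma> c]]
    by (rule tvec_of_tangent[OF c])
qed

lemma metric_action_pushforward:
  assumes \<gamma>: "Ck_param X A (Suc k) Q \<gamma>" "q \<in> Q" and t: "t > 0"
  shows "g (m t (\<gamma> q)) (pushforward A (m t \<circ> \<gamma>) q u) (pushforward A (m t \<circ> \<gamma>) q v)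
    = t powr \<alpha> * g (\<gamma> q) (pushforward A \<gamma> q u) (pushforward A \<gamma> q v)"
proof -
  have F: "(snd c' \<circ> m t \<circ> chart_inv c) differentiable at (snd c (\<gamma> q))"
    if c: "c \<in> charts_at A (\<gamma> q)" and c': "c' \<in> charts_at A (m t (\<gamma> q))" for c c'
  proof -
    have "Ck_param X A (Suc 0) (snd c ` fst c) (\<lambda>p. m t (chart_inv c p))"
      by (rule Ck_param_action[OF Ck_param_chart_inv[OF charts_atD(1)[OF c]] Ck_on_const t])
    from Ck_param_differentiable[OF this, of "snd c (\<gamma> q)" c'] show ?thesis
      using c c' charts_atD(2)[OF c] by (simp add: o_def)
  qed
  have "differential A A (m t) (\<gamma> q) (pushforward A \<gamma> q w) = pushforward A (m t \<circ> \<gamma>) q w" for w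
    by (rule differential_pushforward[OF c1_atlas_axioms Ck_param_open[OF \<gamma>(1)] Ck_param_continuous[OF \<gamma>(1)] \<gamma>(2)
          charts_at_nonempty[OF Ck_param_topspace[OF \<gamma>]] Ck_param_differentiable[OF \<gamma>] F])
  moreover have "pullback A A (m t) g (\<gamma> q) (pushforward A \<gamma> q u) (pushforward A \<gamma> q v)
      = t powr \<alpha> * g (\<gamma> q) (pushforward A \<gamma> q u) (pushforward A \<gamma> q v)"
    using pair t Ck_param_topspace[OF \<gamma>] pushforward_tangent[OF \<gamma>] unfolding homogeneous_pair_def by blast
  ultimately show ?thesis
    by (simp add: pullback_def)
qed

lemma metric_euler_pushforward:
  assumes \<gamma>: "Ck_param X A (Suc k) Q \<gamma>" "q \<in> Q"
  shows "((f \<circ> \<gamma>) has_derivative (\<lambda>u. g (\<gamma> q) (euler_field A m (\<gamma> q)) (pushforward A \<gamma> q u))) (at q)"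
proof -
  have "(f \<circ> chart_inv c) differentiable at (snd c (\<gamma> q))" if "c \<in> charts_at A (\<gamma> q)" for c
    by (rule Ck_on_differentiable[OF f_Ck[OF charts_atD(1)[OF that], of "Suc 0"]])
       (use charts_atD(2)[OF that] in auto)
  from dfun_pushforward[OF c1_atlas_axioms Ck_param_open[OF \<gamma>(1)] Ck_param_continuous[OF \<gamma>(1)] \<gamma>(2)
      charts_at_nonempty[OF Ck_param_topspace[OF \<gamma>]] Ck_param_differentiable[OF \<gamma>] this]
  have *: "((f \<circ> \<gamma>) has_derivative (\<lambda>u. dfun A f (\<gamma> q) (pushforward A \<gamma> q u))) (at q)" .
  have "g (\<gamma> q) (euler_field A m (\<gamma> q)) (pushforward A \<gamma> q u) = dfun A f (\<gamma> q) (pushforward A \<gamma> q u)" for u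
    using pair Ck_param_topspace[OF \<gamma>] pushforward_tangent[OF \<gamma>] unfolding homogeneous_pair_def by blast
  with * show ?thesis by simp
qed

lemma Ck_param_flow_line:
  assumes "x \<in> topspace X" shows "Ck_param X A k UNIV (\<lambda>t. m (exp t) x)"
  by (rule Ck_param_action[OF Ck_param_const[OF assms] Ck_on_exp]) simp

text \<open>By the group law, the flow line that starts at m(e^t, x) is the flow line of
  \<open>x\<close> shifted in time by t, so its velocity at time 0 is the velocity of the latter at
  time t.\<close>

lemma euler_field_pushforward:
  assumes x: "x \<in> topspace X"
  shows "euler_field A m (m (exp t) x) = pushforward A (\<lambda>t. m (exp t) x) t 1"
proof
  fix c
  let ?y = "m (exp t) x"
  have y: "?y \<in> topspace X" using action_in x by simp
  show "euler_field A m ?y c = pushforward A (\<lambda>t. m (exp t) x) t 1 c"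
  proof (cases "c \<in> charts_at A ?y")
    case True
    have d: "(snd c \<circ> (\<lambda>t. m (exp t) x)) differentiable at t"
      by (rule Ck_param_differentiable[OF Ck_param_flow_line[OF x, of "Suc 0"]]) (use True in auto)
    have "((\<lambda>s. (snd c \<circ> (\<lambda>t. m (exp t) x)) (s + t)) has_derivative
        fderiv (snd c \<circ> (\<lambda>t. m (exp t) x)) t) (at 0)"
      by (rule has_derivative_compose[of "\<lambda>s. s + t" "\<lambda>s. s" 0 UNIV, simplified])
         (use has_fderiv[OF d] in \<open>auto simp: o_def intro!: derivative_eq_intros\<close>)
    then have "((snd c \<circ> (\<lambda>s. m (exp s) ?y)) has_derivative fderiv (snd c \<circ> (\<lambda>t. m (exp t) x)) t) (at 0)"
      by (simp add: o_def action_exp[OF x])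
    moreover have "fderiv (snd c \<circ> (\<lambda>t. m (exp t) x)) t = (\<lambda>s. s *\<^sub>R fderiv (snd c \<circ> (\<lambda>t. m (exp t) x)) t 1)"
    proof
      fix s :: real
      show "fderiv (snd c \<circ> (\<lambda>t. m (exp t) x)) t s = s *\<^sub>R fderiv (snd c \<circ> (\<lambda>t. m (exp t) x)) t 1"
        using linear_scale[OF linear_frechet_derivative[OF d], of s 1] by (simp only: real_scaleR_def mult_1_right)
    qed
    ultimately have "((snd c \<circ> (\<lambda>s. m (exp s) ?y)) has_vector_derivative fderiv (snd c \<circ> (\<lambda>t. m (exp t) x)) t 1) (at 0)"
      unfolding has_vector_derivative_def by simp
    from vector_derivative_at[OF this] show ?thesis
      using True by (simp add: euler_field_def velocity_def pushforward_def action_one[OF y])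
  qed (simp add: euler_field_def velocity_def pushforward_def action_one[OF y])
qed

lemma metric_bilinear:
  assumes "x \<in> topspace X" "\<xi> \<in> tangent_space A x" "\<eta> \<in> tangent_space A x" "\<zeta> \<in> tangent_space A x"
  shows "g x (lincomb a \<xi> b \<eta>) \<zeta> = a * g x \<xi> \<zeta> + b * g x \<eta> \<zeta>" "g x \<xi> \<eta> = g x \<eta> \<xi>"
  using pair assms unfolding homogeneous_pair_def pseudo_riemannian_def by blast+

lemma tangent_space_lincomb:
  assumes "x \<in> topspace X" "\<xi> \<in> tangent_space A x" "\<eta> \<in> tangent_space A x"
  shows "lincomb a \<xi> b \<eta> \<in> tangent_space A x"
proof -
  note c = chart_at[OF assms(1)]
  show ?thesis
    using tangent_eq_tvec_of[OF assms(2) c] tangent_eq_tvec_of[OF assms(3) c]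
      lincomb_tvec_of[OF c] tvec_of_tangent[OF c] by metis
qed

section \<open>The metric in flow coordinates\<close>

lemma Ck_param_flow:
  assumes J: "Ck_param X A k Q J"
  shows "Ck_param X A k (Q \<times> UNIV) (\<lambda>z. m (exp (snd z)) (J (fst z)))"
proof (rule Ck_param_action)
  have open_QU: "open (Q \<times> (UNIV :: real set))"
    using Ck_param_open[OF J] by (simp add: open_Times)
  show "Ck_param X A k (Q \<times> (UNIV :: real set)) (\<lambda>z. J (fst z))"
    using Ck_param_compose[OF J open_QU Ck_on_linear[OF open_QU bounded_linear_fst] _ chart]
    by (auto simp: o_def)
  show "Ck_on k (\<lambda>z. exp (snd z)) (Q \<times> (UNIV :: real set))"
    by (rule Ck_on_compose[OF open_QU open_UNIV _ Ck_on_exp Ck_on_linear[OF open_QU bounded_linear_snd]]) auto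
qed simp

text \<open>Splitting \<open>a\<close> into its parts in \<open>q\<close> and \<open>t\<close>
  leaves two partial maps: for fixed t the translate \<open>m (exp t) \<circ> J\<close>, for fixed q
  a flow line.\<close>

lemma pushforward_flow:
  assumes J: "Ck_param X A (Suc k) Q J" and q: "q \<in> Q"
  shows "pushforward A (\<lambda>z. m (exp (snd z)) (J (fst z))) (q, t) a =
    lincomb 1 (pushforward A (m (exp t) \<circ> J) q (fst a)) (snd a) (euler_field A m (m (exp t) (J q)))"
proof
  fix c
  let ?\<Gamma> = "\<lambda>z. m (exp (snd z)) (J (fst z))"
  have x: "J q \<in> topspace X" by (rule Ck_param_topspace[OF J q])
  show "pushforward A ?\<Gamma> (q, t) a c =
    lincomb 1 (pushforward A (m (exp t) \<circ> J) q (fst a)) (snd a) (euler_field A m (m (exp t) (J q))) c"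
  proof (cases "c \<in> charts_at A (m (exp t) (J q))")
    case True
    have d: "(snd c \<circ> ?\<Gamma>) differentiable at (q, t)"
      by (rule Ck_param_differentiable[OF Ck_param_flow[OF J]]) (use True q in auto)
    note D = has_fderiv[OF d]
    have 1: "fderiv (snd c \<circ> (m (exp t) \<circ> J)) q (fst a) = fderiv (snd c \<circ> ?\<Gamma>) (q, t) (fst a, 0)"
    proof -
      have "((\<lambda>q. (snd c \<circ> ?\<Gamma>) (q, t)) has_derivative (\<lambda>u. fderiv (snd c \<circ> ?\<Gamma>) (q, t) (u, 0))) (at q)"
        by (rule has_derivative_compose[of "\<lambda>q. (q, t)" "\<lambda>u. (u, 0)", OF _ D])
           (auto intro!: derivative_eq_intros)
      from fderiv_eq[OF this] show ?thesis by (simp add: o_def)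
    qed
    have 2: "fderiv (snd c \<circ> (\<lambda>t. m (exp t) (J q))) t 1 = fderiv (snd c \<circ> ?\<Gamma>) (q, t) (0, 1)"
    proof -
      have "((\<lambda>t. (snd c \<circ> ?\<Gamma>) (q, t)) has_derivative (\<lambda>s. fderiv (snd c \<circ> ?\<Gamma>) (q, t) (0, s))) (at t)"
        by (rule has_derivative_compose[of "\<lambda>t. (q, t)" "\<lambda>s. (0, s)", OF _ D])
           (auto intro!: derivative_eq_intros)
      from fderiv_eq[OF this] show ?thesis by (simp add: o_def)
    qed
    note l = linear_frechet_derivative[OF d]
    have a: "a = (fst a, 0) + snd a *\<^sub>R (0, 1)" by (simp add: prod_eq_iff)
    have "fderiv (snd c \<circ> ?\<Gamma>) (q, t) a =
        fderiv (snd c \<circ> ?\<Gamma>) (q, t) (fst a, 0) + snd a *\<^sub>R fderiv (snd c \<circ> ?\<Gamma>) (q, t) (0, 1)"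
      by (subst a, subst linear_add[OF l], subst linear_scale[OF l]) (rule refl)
    then show ?thesis
      using True unfolding euler_field_pushforward[OF x] by (simp add: lincomb_def pushforward_def 1 2)
  qed (simp add: lincomb_def pushforward_def euler_field_pushforward[OF x])
qed

text \<open>In the coordinates \<open>(q, t)\<close> the metric is \<open>e\<^bsup>\<alpha>t\<^esup> (g\<^sub>l + \<alpha> l dt\<^sup>2)\<close>.\<close>

lemma metric_flow:
  assumes J: "Ck_param X A (Suc k) Q J" and q: "q \<in> Q" and level: "\<And>r. r \<in> Q \<Longrightarrow> f (J r) = l"
  shows "g (m (exp t) (J q)) (pushforward A (\<lambda>z. m (exp (snd z)) (J (fst z))) (q, t) a)
      (pushforward A (\<lambda>z. m (exp (snd z)) (J (fst z))) (q, t) b)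
    = exp (\<alpha> * t) * (g (J q) (pushforward A J q (fst a)) (pushforward A J q (fst b)) + \<alpha> * l * (snd a * snd b))"
proof -
  let ?x = "m (exp t) (J q)"
  let ?E = "euler_field A m ?x" and ?P = "\<lambda>u. pushforward A (m (exp t) \<circ> J) q u"
  have y: "J q \<in> topspace X" by (rule Ck_param_topspace[OF J q])
  then have x: "?x \<in> topspace X" using action_in by simp
  have Jt: "Ck_param X A (Suc k) Q (m (exp t) \<circ> J)"
    using Ck_param_action[OF J Ck_on_const, of "exp t"] by (simp add: o_def)
  have E: "?E \<in> tangent_space A ?x"
    unfolding euler_field_pushforward[OF y]
    using pushforward_tangent[OF Ck_param_flow_line[OF y], of t 1] by simp
  have P: "?P u \<in> tangent_space A ?x" for u
    using pushforward_tangent[OF Jt q] by simp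
  have gPP: "g ?x (?P u) (?P v) = exp (\<alpha> * t) * g (J q) (pushforward A J q u) (pushforward A J q v)" for u v
    using metric_action_pushforward[OF J q, of "exp t" u v] by (simp add: powr_def)
  \<comment> \<open>f is constant on the translate of the level set, so df = g(P, .) vanishes on its
    tangent vectors.\<close>
  have gEP: "g ?x ?E (?P u) = 0" for u
  proof -
    have "((f \<circ> (m (exp t) \<circ> J)) has_derivative (\<lambda>u. 0)) (at q)"
      by (rule has_derivative_transform_within_open[OF has_derivative_const[of "exp t powr \<alpha> * l"]
            Ck_param_open[OF J] q])
         (use level f_action Ck_param_topspace[OF J] in auto)
    from has_derivative_unique[OF metric_euler_pushforward[OF Jt q] this] show ?thesis
      by (metis comp_apply)
  qed
  \<comment> \<open>g(P, P) = df(P) is the derivative of f along the flow line, where f equals exp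
    (\<alpha> t) l.\<close>
  have gEE: "g ?x ?E ?E = \<alpha> * (exp (\<alpha> * t) * l)"
  proof -
    have "f (m (exp s) (J q)) = exp (\<alpha> * s) * l" for s
      using f_action[OF _ y, of "exp s"] level[OF q] by (simp add: powr_def)
    then have "((f \<circ> (\<lambda>t. m (exp t) (J q))) has_derivative (\<lambda>s. s * (\<alpha> * (exp (\<alpha> * t) * l)))) (at t)"
      by (auto simp: o_def mult_ac intro!: derivative_eq_intros)
    from fun_cong[OF has_derivative_unique[OF
          metric_euler_pushforward[OF Ck_param_flow_line[OF y, of "Suc 0"], of t] this], of 1]
    have "g ?x ?E (pushforward A (\<lambda>t. m (exp t) (J q)) t 1) = 1 * (\<alpha> * (exp (\<alpha> * t) * l))"
      by simp
    then show ?thesis by (simp add: euler_field_pushforward[OF y])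
  qed
  have Z: "lincomb 1 (?P v) r ?E \<in> tangent_space A ?x" for v r
    by (rule tangent_space_lincomb[OF x P E])
  have "g ?x (lincomb 1 (?P u) s ?E) (lincomb 1 (?P v) r ?E) =
      g ?x (?P u) (?P v) + s * r * g ?x ?E ?E" for u v s r
    using metric_bilinear(1)[OF x P[of u] E Z, of 1 s] metric_bilinear(2)[OF x P[of u] Z E]
      metric_bilinear(2)[OF x E Z E] metric_bilinear(1)[OF x P[of v] E P[of u], of 1 r]
      metric_bilinear(1)[OF x P[of v] E E, of 1 r] metric_bilinear(2)[OF x P[of u] P[of v] E]
      metric_bilinear(2)[OF x P[of u] E E] metric_bilinear(2)[OF x P[of v] E E] gEP
    by simp
  then show ?thesis
    unfolding pushforward_flow[OF J q] by (simp add: gPP gEE algebra_simps)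
qed

end


section \<open>The conformal factor\<close>

text \<open>The logarithmic derivative \<open>y = r w' / w\<close>.\<close>

definition w_slope :: "real \<Rightarrow> real \<Rightarrow> real \<Rightarrow> real \<Rightarrow> real \<Rightarrow> real" where
  "w_slope \<sigma> s C1 C2 r =
     (if s > 0 then - 2 * sqrt C1 * (sinh (sqrt C1 * (ln r + C2)) / cosh (sqrt C1 * (ln r + C2)))
      else if s = 0 then \<sigma> * 2 * sqrt C1
      else if C1 < 0 then - 2 * sqrt (- C1) * (cos (sqrt (- C1) * (ln r + C2)) / sin (sqrt (- C1) * (ln r + C2)))
      else - 2 / (ln r + C2))"

context
  fixes \<sigma> s C1 C2 :: real
  assumes \<Delta>: "(s, C1, C2) \<in> Delta1 \<union> Delta2 \<union> Delta3" and \<sigma>: "\<sigma> \<in> {1, -1}"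
begin

lemma w_cases:
  obtains (pos) "s > 0" "C1 > 0"
  | (zero) "s = 0" "C1 \<ge> 0"
  | (neg) "s < 0" "C1 < 0"
  | (deg) "s < 0" "C1 = 0"
  using \<Delta> by (fastforce simp: Delta1_def Delta2_def Delta3_def)

lemma w_pos: "r \<in> w_dom s C1 C2 \<Longrightarrow> w_fun \<sigma> s C1 C2 r > 0"
  by (cases rule: w_cases) (auto simp: w_fun_def w_dom_def divide_neg_neg mult_neg_pos)

text \<open>In the variable log r the derivatives computed below are w' = y w and y' = - 2 s w.
  Their first integral is y^2 + 4 s w, and its value is 4 C1. Case by case this is the identity
  between cosh and sinh, or between cos and sin, or a direct cancellation.\<close>

lemma w_slope_sq:
  assumes "r \<in> w_dom s C1 C2"
  shows "(w_slope \<sigma> s C1 C2 r)\<^sup>2 = 4 * (C1 - s * w_fun \<sigma> s C1 C2 r)"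
proof (cases rule: w_cases)
  case pos
  then show ?thesis
    by (simp add: w_slope_def w_fun_def power_mult_distrib power_divide sinh_square_eq field_simps)
next
  case zero
  then show ?thesis
    using \<sigma> by (auto simp: w_slope_def w_fun_def power_mult_distrib)
next
  case neg
  then show ?thesis
    using assms by (simp add: w_slope_def w_fun_def w_dom_def power_mult_distrib power_divide cos_squared_eq field_simps)
next
  case deg
  then show ?thesis
    using assms by (simp add: w_slope_def w_fun_def w_dom_def power_divide field_simps)
qed

lemma w_has_derivative:
  assumes r: "r \<in> w_dom s C1 C2"
  shows "(w_fun \<sigma> s C1 C2 has_real_derivative w_slope \<sigma> s C1 C2 r * w_fun \<sigma> s C1 C2 r / r) (at r)"
proof (cases rule: w_cases)
  case pos
  then have "w_fun \<sigma> s C1 C2 = (\<lambda>r. C1 / (s * (cosh (sqrt C1 * (ln r + C2)))\<^sup>2))"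
    by (simp add: w_fun_def fun_eq_iff)
  then show ?thesis
    using r pos
    by (auto simp: w_dom_def w_slope_def power2_eq_square field_simps intro!: derivative_eq_intros)
next
  case zero
  then have "w_fun \<sigma> s C1 C2 = (\<lambda>r. exp C2 * r powr (\<sigma> * 2 * sqrt C1))"
    by (simp add: w_fun_def fun_eq_iff)
  then show ?thesis
    using r zero
    by (auto simp: w_dom_def w_slope_def powr_diff field_simps intro!: derivative_eq_intros)
next
  case neg
  then have "w_fun \<sigma> s C1 C2 = (\<lambda>r. C1 / (s * (sin (sqrt (- C1) * (ln r + C2)))\<^sup>2))"
    by (simp add: w_fun_def fun_eq_iff)
  then show ?thesis
    using r neg
    by (auto simp: w_dom_def w_slope_def power2_eq_square field_simps intro!: derivative_eq_intros)
next
  case deg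
  then have "w_fun \<sigma> s C1 C2 = (\<lambda>r. - 1 / (s * (ln r + C2)\<^sup>2))"
    by (simp add: w_fun_def fun_eq_iff)
  moreover define u where "u = ln r + C2"
  have u: "u \<noteq> 0" "r > 0" using r deg by (auto simp: u_def w_dom_def)
  have 1: "((\<lambda>u. - 1 / (s * u\<^sup>2)) has_real_derivative 2 / (s * u ^ 3)) (at (ln r + C2))"
    unfolding u_def[symmetric] using deg u
    by (auto intro!: derivative_eq_intros simp: field_simps power2_eq_square power3_eq_cube)
  have 2: "((\<lambda>r. ln r + C2) has_real_derivative 1 / r) (at r)"
    using u by (auto intro!: derivative_eq_intros)
  note DERIV_chain2[OF 1 2]
  ultimately have "(w_fun \<sigma> s C1 C2 has_real_derivative 2 / (s * u ^ 3) * (1 / r)) (at r)"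
    by (simp only:)
  moreover have "2 / (s * u ^ 3) * (1 / r) = w_slope \<sigma> s C1 C2 r * w_fun \<sigma> s C1 C2 r / r"
    using deg by (simp add: w_slope_def w_fun_def u_def[symmetric] power2_eq_square power3_eq_cube)
  ultimately show ?thesis by simp
qed

lemma w_slope_has_derivative:
  assumes r: "r \<in> w_dom s C1 C2"
  shows "(w_slope \<sigma> s C1 C2 has_real_derivative - 2 * s * w_fun \<sigma> s C1 C2 r / r) (at r)"
proof (cases rule: w_cases)
  case pos
  define k where "k = sqrt C1"
  define z where "z = k * (ln r + C2)"
  have eq: "w_slope \<sigma> s C1 C2 = (\<lambda>r. - 2 * k * (sinh (k * (ln r + C2)) / cosh (k * (ln r + C2))))"
    using pos by (simp add: w_slope_def k_def fun_eq_iff)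
  have "r > 0" using r by (simp add: w_dom_def)
  have 1: "((\<lambda>z. - 2 * k * (sinh z / cosh z)) has_real_derivative
      - 2 * k * (((cosh z)\<^sup>2 - (sinh z)\<^sup>2) / (cosh z)\<^sup>2)) (at (k * (ln r + C2)))"
    unfolding z_def[symmetric]
    by (rule DERIV_cmult) (auto intro!: derivative_eq_intros simp: power2_eq_square)
  have 2: "((\<lambda>r. k * (ln r + C2)) has_real_derivative k / r) (at r)"
    using \<open>r > 0\<close> by (auto intro!: derivative_eq_intros)
  have "- 2 * k * (((cosh z)\<^sup>2 - (sinh z)\<^sup>2) / (cosh z)\<^sup>2) * (k / r) = - 2 * k\<^sup>2 / ((cosh z)\<^sup>2 * r)"
    unfolding hyperbolic_pythagoras by (simp add: power2_eq_square)
  also have "\<dots> = - 2 * s * w_fun \<sigma> s C1 C2 r / r"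
    using pos by (simp add: w_fun_def z_def k_def)
  finally show ?thesis
    using DERIV_chain2[OF 1 2] unfolding eq by simp
next
  case zero
  then have "w_slope \<sigma> s C1 C2 = (\<lambda>r. \<sigma> * 2 * sqrt C1)"
    by (simp add: w_slope_def fun_eq_iff)
  then show ?thesis using zero by simp
next
  case neg
  define k where "k = sqrt (- C1)"
  define z where "z = k * (ln r + C2)"
  have eq: "w_slope \<sigma> s C1 C2 = (\<lambda>r. - 2 * k * (cos (k * (ln r + C2)) / sin (k * (ln r + C2))))"
    using neg by (simp add: w_slope_def k_def fun_eq_iff)
  have "r > 0" "sin z \<noteq> 0" using r neg by (auto simp: w_dom_def z_def k_def)
  have 1: "((\<lambda>z. - 2 * k * (cos z / sin z)) has_real_derivative
      - 2 * k * (- ((sin z)\<^sup>2 + (cos z)\<^sup>2) / (sin z)\<^sup>2)) (at (k * (ln r + C2)))"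
    unfolding z_def[symmetric] using \<open>sin z \<noteq> 0\<close>
    by (intro DERIV_cmult) (auto intro!: derivative_eq_intros simp: power2_eq_square)
  have 2: "((\<lambda>r. k * (ln r + C2)) has_real_derivative k / r) (at r)"
    using \<open>r > 0\<close> by (auto intro!: derivative_eq_intros)
  have "- 2 * k * (- ((sin z)\<^sup>2 + (cos z)\<^sup>2) / (sin z)\<^sup>2) * (k / r) = 2 * k\<^sup>2 / ((sin z)\<^sup>2 * r)"
    unfolding sin_cos_squared_add by (simp add: power2_eq_square)
  also have "\<dots> = - 2 * s * w_fun \<sigma> s C1 C2 r / r"
    using neg by (simp add: w_fun_def z_def k_def)
  finally show ?thesis
    using DERIV_chain2[OF 1 2] unfolding eq by simp
next
  case deg
  have eq: "w_slope \<sigma> s C1 C2 = (\<lambda>r. - 2 / (ln r + C2))"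
    using deg by (simp add: w_slope_def fun_eq_iff)
  define u where "u = ln r + C2"
  have u: "u \<noteq> 0" "r > 0" using r deg by (auto simp: u_def w_dom_def)
  have 1: "((\<lambda>u. - 2 / u) has_real_derivative 2 / u\<^sup>2) (at (ln r + C2))"
    unfolding u_def[symmetric] using u
    by (auto intro!: derivative_eq_intros simp: power2_eq_square)
  have 2: "((\<lambda>r. ln r + C2) has_real_derivative 1 / r) (at r)"
    using u by (auto intro!: derivative_eq_intros)
  have "2 / u\<^sup>2 * (1 / r) = - 2 * s * w_fun \<sigma> s C1 C2 r / r"
    using deg by (simp add: w_fun_def u_def[symmetric])
  then show ?thesis
    using DERIV_chain2[OF 1 2] unfolding eq by simp
qed

lemma w_dom_subset: "w_dom s C1 C2 \<subseteq> {0<..}"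
  by (auto simp: w_dom_def)

lemma open_w_dom: "open (w_dom s C1 C2)"
proof -
  define k where "k r = (if s < 0 then if C1 < 0 then sin (sqrt (- C1) * (ln r + C2)) else ln r + C2 else 1)" for r
  have "continuous_on {0<..} k"
    unfolding k_def by (cases "s < 0"; cases "C1 < 0") (auto intro!: continuous_intros)
  then have "open ({0<..} \<inter> k -` (- {0}))"
    by (intro continuous_open_preimage) auto
  moreover have "{0<..} \<inter> k -` (- {0}) = w_dom s C1 C2"
    by (auto simp: w_dom_def k_def split: if_splits)
  ultimately show ?thesis by simp
qed

text \<open>The two differential equations express the derivatives of w and y as products of w, y
  and 1 / r, so the regularity of both grows together, without a case distinction.\<close>

lemma Ck_on_w: "Ck_on k (w_fun \<sigma> s C1 C2) (w_dom s C1 C2)"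
proof -
  have inv: "Ck_on k (\<lambda>r. r powr (-1)) (w_dom s C1 C2)" for k
    by (rule Ck_on_subset[OF Ck_on_powr w_dom_subset])
  have "Ck_on k (w_fun \<sigma> s C1 C2) (w_dom s C1 C2) \<and> Ck_on k (w_slope \<sigma> s C1 C2) (w_dom s C1 C2)"
  proof (induction k)
    case 0
    then show ?case
      using w_has_derivative w_slope_has_derivative
      by (auto intro!: continuous_at_imp_continuous_on DERIV_isCont)
  next
    case (Suc k)
    have d: "(w_fun \<sigma> s C1 C2 has_real_derivative w_slope \<sigma> s C1 C2 r * w_fun \<sigma> s C1 C2 r * r powr (-1)) (at r)"
      "(w_slope \<sigma> s C1 C2 has_real_derivative - 2 * s * w_fun \<sigma> s C1 C2 r * r powr (-1)) (at r)"
      if "r \<in> w_dom s C1 C2" for r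
      using w_has_derivative[OF that] w_slope_has_derivative[OF that] w_dom_subset that
      by (auto simp: powr_minus divide_inverse)
    show ?case
      by (intro conjI Ck_on_has_field_derivative[OF open_w_dom d(1)]
          Ck_on_has_field_derivative[OF open_w_dom d(2)] Ck_on_mult open_w_dom inv Ck_on_const
          Suc.IH[THEN conjunct1] Suc.IH[THEN conjunct2])
  qed
  then show ?thesis ..
qed

end


section \<open>Charts of a level set\<close>

text \<open>\<open>inverse_function_theorem\<close> is about maps from a space to itself. A linear
  isomorphism \<theta> between the two types of equal dimension carries it over to \<Psi>.\<close>

lemma C1_local_inverse:
  fixes \<Psi> :: "'e::euclidean_space \<Rightarrow> 'a::euclidean_space"
  assumes dim: "DIM('e) = DIM('a)" and W: "open W" "z0 \<in> W" and C1: "Ck_on (Suc 0) \<Psi> W"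
    and inj: "inj (fderiv \<Psi> z0)"
  obtains W1 V \<Gamma> where "open W1" "W1 \<subseteq> W" "z0 \<in> W1" "open V" "homeomorphism W1 V \<Psi> \<Gamma>"
    "\<And>p. p \<in> V \<Longrightarrow> \<Gamma> differentiable at p"
proof -
  obtain \<theta> :: "'a \<Rightarrow> 'e" and \<theta>' where \<theta>: "linear \<theta>" "linear \<theta>'" "\<And>x. \<theta>' (\<theta> x) = x" "\<And>y. \<theta> (\<theta>' y) = y"
    using isomorphisms_UNIV_UNIV[OF dim[symmetric]] by metis
  have b\<theta>: "bounded_linear \<theta>" "bounded_linear \<theta>'"
    using \<theta>(1,2) linear_conv_bounded_linear by auto
  define U where "U = \<theta> -` W"
  have U: "open U"
    unfolding U_def using W(1) linear_continuous_on[OF b\<theta>(1)] by (simp add: open_vimage)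
  have x0: "\<theta>' z0 \<in> U" using W(2) by (simp add: U_def \<theta>(4))
  have D: "(\<Psi> has_derivative fderiv \<Psi> z) (at z)" if "z \<in> W" for z
    using has_fderiv Ck_on_differentiable[OF C1 that] by blast
  define F' where "F' x = Blinfun (\<lambda>v. fderiv \<Psi> (\<theta> x) (\<theta> v))" for x
  have F': "blinfun_apply (F' x) v = fderiv \<Psi> (\<theta> x) (\<theta> v)" if "x \<in> U" for x v
    unfolding F'_def
    by (subst bounded_linear_Blinfun_apply)
       (use D[of "\<theta> x"] that in \<open>auto simp: U_def intro: bounded_linear_compose[OF has_derivative_bounded_linear b\<theta>(1)]\<close>)
  have derF: "((\<Psi> \<circ> \<theta>) has_derivative blinfun_apply (F' x)) (at x)" if "x \<in> U" for x
  proof -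
    have "((\<lambda>x. \<Psi> (\<theta> x)) has_derivative (\<lambda>v. fderiv \<Psi> (\<theta> x) (\<theta> v))) (at x)"
      by (rule has_derivative_compose[OF bounded_linear_imp_has_derivative[OF b\<theta>(1)] D])
         (use that in \<open>simp add: U_def\<close>)
    moreover have "blinfun_apply (F' x) = (\<lambda>v. fderiv \<Psi> (\<theta> x) (\<theta> v))"
      using F'[OF that] by auto
    ultimately show ?thesis by (simp add: o_def)
  qed
  have contF: "continuous_on U F'"
  proof (rule continuous_on_blinfun_componentwise)
    fix i :: 'a
    have "continuous_on W (\<lambda>z. fderiv \<Psi> z (\<theta> i))"
      using C1 by simp
    then have "continuous_on U (\<lambda>x. fderiv \<Psi> (\<theta> x) (\<theta> i))"
      by (rule continuous_on_compose2[OF _ linear_continuous_on[OF b\<theta>(1)]]) (auto simp: U_def)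
    then show "continuous_on U (\<lambda>x. blinfun_apply (F' x) i)"
      by (simp add: F' cong: continuous_on_cong)
  qed
  have l0: "linear (fderiv \<Psi> z0)" by (rule has_derivative_linear[OF D[OF W(2)]])
  have "linear (\<lambda>v. fderiv \<Psi> z0 (\<theta> v))" "inj (\<lambda>v. fderiv \<Psi> z0 (\<theta> v))"
    using linear_compose[OF \<theta>(1) l0] inj \<theta>(3) by (auto simp: o_def inj_def) metis
  then obtain L where L: "linear L" "L \<circ> (\<lambda>v. fderiv \<Psi> z0 (\<theta> v)) = id"
    using linear_injective_left_inverse by blast
  have "Blinfun L o\<^sub>L F' (\<theta>' z0) = id_blinfun"
  proof (rule blinfun_eqI)
    fix v
    have "blinfun_apply (Blinfun L) w = L w" for w
      using L(1) linear_conv_bounded_linear bounded_linear_Blinfun_apply by metis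
    then show "blinfun_apply (Blinfun L o\<^sub>L F' (\<theta>' z0)) v = blinfun_apply id_blinfun v"
      using F'[OF x0] fun_cong[OF L(2), of v] by (simp add: \<theta>(4))
  qed
  from inverse_function_theorem[OF U derF contF x0 this]
  obtain U' V G G' where *: "open U'" "U' \<subseteq> U" "\<theta>' z0 \<in> U'" "open V" "homeomorphism U' V (\<Psi> \<circ> \<theta>) G"
    "\<And>p. p \<in> V \<Longrightarrow> (G has_derivative G' p) (at p)"
    by metis
  have img: "\<theta> ` U' = \<theta>' -` U'"
  proof (intro set_eqI iffI)
    show "z \<in> \<theta>' -` U'" if "z \<in> \<theta> ` U'" for z
      using that by (auto simp: \<theta>(3))
    show "z \<in> \<theta> ` U'" if "z \<in> \<theta>' -` U'" for z
      using imageI[of "\<theta>' z" U' \<theta>] that by (simp add: \<theta>(4))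
  qed
  show thesis
  proof
    show "open (\<theta> ` U')"
      unfolding img using *(1) linear_continuous_on[OF b\<theta>(2)] by (simp add: open_vimage)
    show "\<theta> ` U' \<subseteq> W" using *(2) by (auto simp: U_def)
    show "z0 \<in> \<theta> ` U'" using *(3) \<theta>(4) by (metis imageI)
    show "open V" by fact
    show "homeomorphism (\<theta> ` U') V \<Psi> (\<theta> \<circ> G)"
      unfolding homeomorphism_def
    proof (intro conjI ballI)
      show "continuous_on (\<theta> ` U') \<Psi>"
        by (rule continuous_on_subset[OF Ck_on_continuous[OF C1]]) (use *(2) in \<open>auto simp: U_def\<close>)
      show "continuous_on V (\<theta> \<circ> G)"
        by (rule continuous_on_compose) (use *(5) linear_continuous_on[OF b\<theta>(1)] in \<open>auto simp: homeomorphism_def\<close>)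
      show "(\<theta> \<circ> G) (\<Psi> x) = x" if "x \<in> \<theta> ` U'" for x
        using that *(5) by (auto simp: homeomorphism_def)
      show "\<Psi> ((\<theta> \<circ> G) y) = y" if "y \<in> V" for y
        using that *(5) by (auto simp: homeomorphism_def)
      show "\<Psi> ` \<theta> ` U' = V"
        using *(5) unfolding homeomorphism_def image_comp by blast
      have "G ` V = U'"
        using *(5) unfolding homeomorphism_def by blast
      then show "(\<theta> \<circ> G) ` V = \<theta> ` U'"
        unfolding image_comp[symmetric] by simp
    qed
    show "(\<theta> \<circ> G) differentiable at p" if "p \<in> V" for p
      using bounded_linear.has_derivative[OF b\<theta>(1) *(6)[OF that]] by (auto simp: differentiable_def o_def)
  qed
qed

context homogeneous
begin

text \<open>A piece of hyperplane through \<open>y\<close>, tangent to the level set in an ambient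
  chart, is moved along the flow lines onto the level set. Slice point and flow time are local
  coordinates of the manifold because the flow is transverse to the slice; on the level set the
  slice point alone is a coordinate.\<close>

lemma level_set_chart_exists:
  assumes dim: "DIM('b::euclidean_space) + 1 = DIM('a)" and y: "y \<in> topspace X" and l: "f y = l"
  shows "\<exists>d :: ('m, 'b) chart. d \<in> charts_at (submanifold_atlas X A (level_set X f l)) y"
proof -
  let ?M = "level_set X f l"
  have "l > 0" using f_pos[OF y] l by simp
  let ?c = "chart_at A y"
  have cA: "?c \<in> charts_at A y" by (rule chart_at[OF y])
  have c: "?c \<in> A" "y \<in> fst ?c" and chart_c: "topological_chart X ?c"
    using cA chart by (auto simp: charts_at_def)
  define p0 where "p0 = snd ?c y"
  have p0: "p0 \<in> snd ?c ` fst ?c" "chart_inv ?c p0 = y"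
    using c(2) chart_inv_left[OF chart_c] by (auto simp: p0_def)
  define E where "E = fderiv (snd ?c \<circ> (\<lambda>t. m (exp t) y)) 0 1"
  define \<phi> where "\<phi> = fderiv (f \<circ> chart_inv ?c) p0"
  have y1: "m (exp 0) y = y" using action_one[OF y] by simp
  note line = Ck_param_flow_line[OF y, of "Suc 0"]
  have d_line: "(snd ?c \<circ> (\<lambda>t. m (exp t) y)) differentiable at 0"
    by (rule Ck_param_differentiable[OF line]) (use cA action_one[OF y] in auto)
  have d_f: "(f \<circ> chart_inv ?c) differentiable at p0"
    by (rule Ck_on_differentiable[OF f_Ck[OF c(1), of "Suc 0"] p0(1)])
  have lin_\<phi>: "linear \<phi>"
    unfolding \<phi>_def by (rule linear_frechet_derivative[OF d_f])
  \<comment> \<open>df(P) = \<alpha> f is not zero, so the flow direction \<open>E\<close> lies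
    outside the kernel of \<phi>.\<close>
  have \<phi>E: "\<phi> E = \<alpha> * l"
  proof -
    have "((f \<circ> (\<lambda>t. m (exp t) y)) has_derivative
        (\<lambda>u. fderiv (f \<circ> chart_inv ?c) (snd ?c (m (exp 0) y)) (fderiv (snd ?c \<circ> (\<lambda>t. m (exp t) y)) 0 u))) (at 0)"
      by (rule chart_has_derivative[OF chart_c open_UNIV Ck_param_continuous[OF line] _ _ _ d_line])
         (use c(2) d_f in \<open>simp_all add: y1 action_one[OF y] p0_def[symmetric]\<close>)
    moreover have "((f \<circ> (\<lambda>t. m (exp t) y)) has_derivative (\<lambda>s. s * (\<alpha> * l))) (at 0)"
    proof -
      have "f (m (exp s) y) = exp (\<alpha> * s) * l" for s
        using f_action[OF _ y, of "exp s"] l by (simp add: powr_def)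
      then show ?thesis
        by (auto simp: o_def mult_ac intro!: derivative_eq_intros)
    qed
    ultimately have "(\<lambda>u. fderiv (f \<circ> chart_inv ?c) (snd ?c (m (exp 0) y)) (fderiv (snd ?c \<circ> (\<lambda>t. m (exp t) y)) 0 u))
        = (\<lambda>s. s * (\<alpha> * l))"
      by (rule has_derivative_unique)
    from fun_cong[OF this, of 1] show ?thesis
      by (simp add: \<phi>_def E_def p0_def action_one[OF y])
  qed
  \<comment> \<open>The hyperplane orthogonal to \<open>n0\<close> is the kernel of \<phi>; it has
    the dimension of \<open>'b\<close>, and \<iota> parametrizes it by that type.\<close>
  define n0 where "n0 = (\<Sum>k\<in>Basis. \<phi> k *\<^sub>R k)"
  have n0: "n0 \<bullet> v = \<phi> v" for v
    unfolding n0_def by (rule inner_sum_Basis_eq[OF lin_\<phi>])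
  have "n0 \<noteq> 0"
    using n0[of E] \<phi>E alpha_nonzero \<open>l > 0\<close> by auto
  then have "dim (UNIV :: 'b set) = dim {x. n0 \<bullet> x = 0}"
    using dim by (simp add: dim_hyperplane)
  from subspace_isomorphism[OF subspace_UNIV subspace_hyperplane this]
  obtain \<iota> :: "'b \<Rightarrow> 'a" where \<iota>: "linear \<iota>" "range \<iota> = {x. n0 \<bullet> x = 0}" "inj \<iota>"
    by blast
  have \<phi>\<iota>: "\<phi> (\<iota> q) = 0" for q
    using \<iota>(2) n0 by auto
  have b\<iota>: "bounded_linear \<iota>" using \<iota>(1) linear_conv_bounded_linear by auto
  have \<iota>_der: "((\<lambda>q. p0 + \<iota> q) has_derivative \<iota>) (at q)" for q
    using has_derivative_add[OF has_derivative_const bounded_linear_imp_has_derivative[OF b\<iota>]] by simp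
  define Q0 where "Q0 = (\<lambda>q. p0 + \<iota> q) -` (snd ?c ` fst ?c)"
  have Q0: "open Q0"
    unfolding Q0_def using chart_domain(2)[OF chart_c]
    by (intro open_vimage continuous_intros linear_continuous_on[OF b\<iota>])
  have zero_Q0: "0 \<in> Q0" using p0(1) linear_0[OF \<iota>(1)] by (simp add: Q0_def)
  define \<gamma> where "\<gamma> q = chart_inv ?c (p0 + \<iota> q)" for q
  have \<gamma>: "Ck_param X A k Q0 \<gamma>" for k
  proof -
    have "Ck_on k (\<lambda>q. p0 + \<iota> q) Q0"
      by (rule Ck_on_add[OF Q0 Ck_on_const Ck_on_linear[OF Q0 b\<iota>]])
    from Ck_param_compose[OF Ck_param_chart_inv[OF c(1)] Q0 this _ chart] show ?thesis
      by (auto simp: Q0_def \<gamma>_def[abs_def] o_def)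
  qed
  have \<gamma>_c: "snd ?c (\<gamma> q) = p0 + \<iota> q" "\<gamma> q \<in> fst ?c" if "q \<in> Q0" for q
    using that chart_inv_right[OF chart_c] chart_inv_in[OF chart_c] by (auto simp: Q0_def \<gamma>_def)
  have \<gamma>0: "\<gamma> 0 = y" using p0(2) linear_0[OF \<iota>(1)] by (simp add: \<gamma>_def)
  define \<Phi> where "\<Phi> z = m (exp (snd z)) (\<gamma> (fst z))" for z :: "'b \<times> real"
  have \<Phi>: "Ck_param X A k (Q0 \<times> UNIV) \<Phi>" for k
    using Ck_param_flow[OF \<gamma>] by (simp add: \<Phi>_def[abs_def])
  define W where "W = (Q0 \<times> UNIV) \<inter> \<Phi> -` fst ?c"
  have W: "open W"
    unfolding W_def by (rule open_param_preimage[OF chart_c Ck_param_open[OF \<Phi>] Ck_param_continuous[OF \<Phi>]])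
  have \<Phi>0: "\<Phi> (0, 0) = y" by (simp add: \<Phi>_def \<gamma>0 action_one[OF y])
  have z0: "(0, 0) \<in> W" using zero_Q0 c(2) by (simp add: W_def \<Phi>0)
  have \<Psi>_Ck: "Ck_on (Suc 0) (snd ?c \<circ> \<Phi>) W"
    unfolding W_def by (rule Ck_param_Ck_on[OF \<Phi> c(1)])
  have D: "((snd ?c \<circ> \<Phi>) has_derivative fderiv (snd ?c \<circ> \<Phi>) (0, 0)) (at (0, 0))"
    using has_fderiv Ck_on_differentiable[OF \<Psi>_Ck z0] by blast
  have D1: "fderiv (snd ?c \<circ> \<Phi>) (0, 0) (u, 0) = \<iota> u" for u
  proof -
    have "((\<lambda>q. (snd ?c \<circ> \<Phi>) (q, 0)) has_derivative (\<lambda>u. fderiv (snd ?c \<circ> \<Phi>) (0, 0) (u, 0))) (at 0)"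
      by (rule has_derivative_compose[of "\<lambda>q. (q, 0)" "\<lambda>u. (u, 0)", OF _ D])
         (auto intro!: derivative_eq_intros)
    then have "((\<lambda>q. p0 + \<iota> q) has_derivative (\<lambda>u. fderiv (snd ?c \<circ> \<Phi>) (0, 0) (u, 0))) (at 0)"
      by (rule has_derivative_transform_within_open[OF _ Q0 zero_Q0])
         (use \<gamma>_c action_one Ck_param_topspace[OF \<gamma>] in \<open>auto simp: \<Phi>_def\<close>)
    from fun_cong[OF has_derivative_unique[OF this \<iota>_der], of u] show ?thesis .
  qed
  have D2: "fderiv (snd ?c \<circ> \<Phi>) (0, 0) (0, 1) = E"
  proof -
    have "((\<lambda>t. (snd ?c \<circ> \<Phi>) (0, t)) has_derivative (\<lambda>s. fderiv (snd ?c \<circ> \<Phi>) (0, 0) (0, s))) (at 0)"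
      by (rule has_derivative_compose[of "\<lambda>t. (0, t)" "\<lambda>s. (0, s)", OF _ D])
         (auto intro!: derivative_eq_intros)
    from fderiv_eq[OF this] show ?thesis by (simp add: o_def \<Phi>_def E_def \<gamma>0)
  qed
  note lin_D = has_derivative_linear[OF D]
  have "inj (fderiv (snd ?c \<circ> \<Phi>) (0, 0))"
    unfolding linear_injective_0[OF lin_D]
  proof (intro allI impI)
    fix a :: "'b \<times> real" assume a: "fderiv (snd ?c \<circ> \<Phi>) (0, 0) a = 0"
    have "a = (fst a, 0) + snd a *\<^sub>R (0, 1)" by (simp add: prod_eq_iff)
    then have "fderiv (snd ?c \<circ> \<Phi>) (0, 0) a = \<iota> (fst a) + snd a *\<^sub>R E"
      using linear_add[OF lin_D, of "(fst a, 0)" "snd a *\<^sub>R (0, 1)"] linear_scale[OF lin_D, of "snd a" "(0, 1)"]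
      by (simp add: D1 D2)
    with a have *: "\<iota> (fst a) + snd a *\<^sub>R E = 0" by simp
    then have "\<phi> (\<iota> (fst a) + snd a *\<^sub>R E) = 0" by (simp add: linear_0[OF lin_\<phi>])
    then have "snd a * (\<alpha> * l) = 0"
      by (simp add: linear_add[OF lin_\<phi>] linear_scale[OF lin_\<phi>] \<phi>\<iota> \<phi>E)
    then have "snd a = 0" using alpha_nonzero \<open>l > 0\<close> by simp
    moreover from this * have "fst a = 0"
      using \<iota>(3) linear_injective_0[OF \<iota>(1)] by simp
    ultimately show "a = 0" by (simp add: prod_eq_iff)
  qed
  moreover have "DIM('b \<times> real) = DIM('a)" using dim by simp
  ultimately obtain W1 V \<Gamma> where W1: "open W1" "W1 \<subseteq> W" "(0, 0) \<in> W1" and V: "open V"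
    and hom: "homeomorphism W1 V (snd ?c \<circ> \<Phi>) \<Gamma>" and d\<Gamma>: "\<And>p. p \<in> V \<Longrightarrow> \<Gamma> differentiable at p"
    using C1_local_inverse[OF _ W z0 \<Psi>_Ck] by metis
  have \<Gamma>\<Phi>: "\<Gamma> (snd ?c (\<Phi> z)) = z" "snd ?c (\<Phi> z) \<in> V" if "z \<in> W1" for z
    using hom that by (auto simp: homeomorphism_def)
  have \<Phi>\<Gamma>: "snd ?c (\<Phi> (\<Gamma> p)) = p" "\<Gamma> p \<in> W1" if "p \<in> V" for p
    using hom that by (auto simp: homeomorphism_def)
  \<comment> \<open>The factor that moves \<gamma> q onto the level set. Homogeneity of f lets
    \<tau>^\<alpha> f(\<gamma> q) = l be solved explicitly, so smoothness of \<tau> is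
    immediate.\<close>
  define \<tau> where "\<tau> q = ((1 / l) * (f \<circ> \<gamma>) q) powr (- 1 / \<alpha>)" for q
  have f\<gamma>: "f (\<gamma> q) > 0" if "q \<in> Q0" for q
    using f_pos Ck_param_topspace[OF \<gamma> that] by blast
  have \<tau>_pos: "\<tau> q > 0" if "q \<in> Q0" for q
    using f\<gamma>[OF that] \<open>l > 0\<close> by (simp add: \<tau>_def)
  have \<tau>_Ck: "Ck_on k \<tau> Q0" for k
  proof -
    have "Ck_on k (\<lambda>q. (1 / l) * (f \<circ> \<gamma>) q) Q0"
      by (rule Ck_on_mult[OF Q0 Ck_on_const Ck_on_f_param[OF \<gamma>]])
    from Ck_on_chain[OF Q0 open_greaterThan _ Ck_on_powr this] show ?thesis
      using f\<gamma> \<open>l > 0\<close> by (simp add: \<tau>_def[abs_def])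
  qed
  have \<tau>_powr: "\<tau> q powr \<alpha> * f (\<gamma> q) = l" if "q \<in> Q0" for q
  proof -
    have "\<tau> q powr \<alpha> = ((1 / l) * f (\<gamma> q)) powr (- 1)"
      using alpha_nonzero by (simp add: \<tau>_def powr_powr)
    then show ?thesis
      using f\<gamma>[OF that] \<open>l > 0\<close> by (simp add: powr_minus field_simps)
  qed
  define J where "J q = m (\<tau> q) (\<gamma> q)" for q
  have J: "Ck_param X A k Q0 J" for k
    using Ck_param_action[OF \<gamma> \<tau>_Ck \<tau>_pos] by (simp add: J_def[abs_def])
  have J_\<Phi>: "J q = \<Phi> (q, ln (\<tau> q))" if "q \<in> Q0" for q
    using \<tau>_pos[OF that] by (simp add: J_def \<Phi>_def)
  have fJ: "J q \<in> ?M" if "q \<in> Q0" for q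
    using f_action[OF \<tau>_pos[OF that] Ck_param_topspace[OF \<gamma> that]] \<tau>_powr[OF that] Ck_param_topspace[OF J that]
    by (simp add: J_def level_set_def)
  \<comment> \<open>\<open>Q\<close> keeps the slice points whose flow time ln (\<tau> q) leads into
    \<open>W1\<close>, where \<Gamma> inverts the flow coordinates.\<close>
  define Q where "Q = Q0 \<inter> (\<lambda>q. (q, ln (\<tau> q))) -` W1"
  have Q: "open Q"
    unfolding Q_def
    by (rule continuous_open_preimage[OF _ Q0 W1(1)])
       (use Ck_on_continuous[OF \<tau>_Ck] \<tau>_pos in \<open>force intro!: continuous_intros\<close>)
  define N where "N = {x \<in> ?M. x \<in> fst ?c \<and> snd ?c x \<in> V}"
  \<comment> \<open>The chart forgets the flow time, which on the level set is a function of the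
    slice point.\<close>
  define d where "d = (N, \<lambda>x. fst (\<Gamma> (snd ?c x)))"
  have N_Q: "snd d x \<in> Q" "J (snd d x) = x" if x: "x \<in> N" for x
  proof -
    let ?z = "\<Gamma> (snd ?c x)"
    have xV: "snd ?c x \<in> V" "x \<in> fst ?c" "x \<in> topspace X" "f x = l"
      using x by (auto simp: N_def level_set_def)
    have zW: "?z \<in> W1" "?z \<in> W" using \<Phi>\<Gamma>[OF xV(1)] W1(2) by auto
    then have q: "fst ?z \<in> Q0" "\<Phi> ?z \<in> fst ?c" by (auto simp: W_def)
    have \<Phi>z: "\<Phi> ?z = x"
      using chart_inj[OF chart_c] q(2) xV(2) \<Phi>\<Gamma>(1)[OF xV(1)] by (auto dest: inj_onD)
    \<comment> \<open>Since f = l at \<open>x\<close>, the flow time is determined by the slice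
      point, so \<open>x\<close> is the image under \<open>J\<close> of its chart value.\<close>
    have "exp (snd ?z) powr \<alpha> * f (\<gamma> (fst ?z)) = l"
      using f_action[OF _ Ck_param_topspace[OF \<gamma> q(1)], of "exp (snd ?z)"] xV(4) \<Phi>z by (simp add: \<Phi>_def)
    then have "exp (snd ?z) powr \<alpha> = \<tau> (fst ?z) powr \<alpha>"
      using \<tau>_powr[OF q(1)] f\<gamma>[OF q(1)] by (metis mult_right_cancel less_irrefl)
    then have "ln (exp (snd ?z) powr \<alpha>) = ln (\<tau> (fst ?z) powr \<alpha>)" by simp
    then have t: "snd ?z = ln (\<tau> (fst ?z))"
      using alpha_nonzero by (simp add: ln_powr)
    then have z: "(fst ?z, ln (\<tau> (fst ?z))) = ?z" by (metis prod.collapse)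
    show "snd d x \<in> Q"
      using zW(1) q(1) z by (simp add: d_def Q_def)
    show "J (snd d x) = x"
      using J_\<Phi>[OF q(1)] z \<Phi>z by (simp add: d_def)
  qed
  have Q_N: "J q \<in> N" "snd d (J q) = q" if q: "q \<in> Q" for q
  proof -
    have q: "q \<in> Q0" "(q, ln (\<tau> q)) \<in> W1" using q by (auto simp: Q_def)
    then have "\<Phi> (q, ln (\<tau> q)) \<in> fst ?c" using W1(2) by (auto simp: W_def)
    then show "J q \<in> N" "snd d (J q) = q"
      using J_\<Phi>[OF q(1)] fJ[OF q(1)] \<Gamma>\<Phi>[OF q(2)] by (auto simp: N_def d_def)
  qed
  have fst_d: "fst d = N" by (simp add: d_def)
  have img_d: "snd d ` fst d = Q"
    unfolding fst_d
  proof
    show "snd d ` N \<subseteq> Q" using N_Q(1) by auto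
    show "Q \<subseteq> snd d ` N" using Q_N by (metis image_eqI subsetI)
  qed
  have sub: "subtopology (subtopology X ?M) N = subtopology X N"
    by (simp add: subtopology_subtopology N_def Int_absorb1 Collect_mono_iff inf.absorb2 subset_iff)
  have cont_J: "continuous_map (top_of_set Q) (subtopology X N) J"
    using continuous_map_from_subtopology_mono[OF Ck_param_continuous[OF J], of Q] Q_N(1)
    by (auto simp: continuous_map_in_subtopology Q_def)
  have chart_d: "topological_chart (subtopology X ?M) d"
    unfolding topological_chart_def img_d
  proof (intro conjI)
    have "openin (subtopology X (fst ?c)) {x \<in> topspace (subtopology X (fst ?c)). snd ?c x \<in> V}"
      by (rule openin_continuous_map_preimage[OF chart_continuous[OF chart_c]]) (use V in simp)
    then have "openin X {x \<in> fst ?c. snd ?c x \<in> V}"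
      unfolding topspace_chart[OF chart_c] using chart_domain(1)[OF chart_c] openin_trans_full by blast
    then show "openin (subtopology X ?M) (fst d)"
      unfolding openin_subtopology fst_d by (intro exI[of _ "{x \<in> fst ?c. snd ?c x \<in> V}"]) (auto simp: N_def)
    show "open Q" by (rule Q)
    have 1: "continuous_map (subtopology X N) (top_of_set V) (snd ?c)"
      using continuous_map_from_subtopology_mono[OF chart_continuous[OF chart_c], of N]
      by (auto simp: continuous_map_in_subtopology N_def)
    have 2: "continuous_map (top_of_set V) euclidean (\<lambda>p. fst (\<Gamma> p))"
      using hom by (auto simp: homeomorphism_def intro: continuous_on_fst)
    from continuous_map_compose[OF 1 2] have "continuous_map (subtopology X N) euclidean (snd d)"
      by (simp add: d_def o_def)
    then have "continuous_map (subtopology X N) (top_of_set Q) (snd d)"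
      using N_Q(1) by (auto simp: continuous_map_in_subtopology)
    then have "homeomorphic_maps (subtopology X N) (top_of_set Q) (snd d) J"
      using cont_J N_Q(2) Q_N(2) by (auto simp: homeomorphic_maps_def)
    then show "homeomorphic_map (subtopology (subtopology X ?M) (fst d)) (top_of_set Q) (snd d)"
      unfolding fst_d sub by (auto simp: homeomorphic_map_maps)
  qed
  have inv_d: "chart_inv d q = J q" if "q \<in> Q" for q
    using chart_inv_left[OF chart_d, of "J q"] Q_N[OF that] by (simp add: fst_d)
  have J': "Ck_param X A k Q (chart_inv d)" for k
    by (rule Ck_param_cong[OF Ck_param_subset[OF J Q]]) (auto simp: Q_def inv_d chart)
  have "d \<in> submanifold_atlas X A ?M"
    unfolding submanifold_atlas_def mem_Collect_eq img_d
    unfolding fst_d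
  proof (intro conjI ballI)
    show "topological_chart (subtopology X ?M) d" by (rule chart_d)
    have "smooth_on (Q \<inter> chart_inv d -` fst c') (snd c' \<circ> chart_inv d \<circ> chart_inv (Q, id))" if c': "c' \<in> A" for c'
      unfolding smooth_on_def
    proof
      fix k
      show "Ck_on k (snd c' \<circ> chart_inv d \<circ> chart_inv (Q, id)) (Q \<inter> chart_inv d -` fst c')"
        by (rule Ck_on_cong[OF open_param_preimage[OF chart[OF c'] Q Ck_param_continuous[OF J']] _
              Ck_param_Ck_on[OF J' c']]) (auto simp: chart_inv_id)
    qed
    then show "smooth_map (top_of_set Q) (open_atlas Q) X A (chart_inv d)"
      using Ck_param_continuous[OF J'] by (auto simp: smooth_map_def open_atlas_def)
    fix x c' assume x: "x \<in> N" and c': "c' \<in> charts_at A x"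
    have dx: "chart_inv d (snd d x) = x" "snd d x \<in> Q"
      using inv_d N_Q[OF x] by auto
    have xV: "snd ?c x \<in> V" "x \<in> fst ?c" using x by (auto simp: N_def)
    let ?D = "fderiv (snd c' \<circ> chart_inv d) (snd d x)" and ?T = "fderiv (snd ?c \<circ> chart_inv c') (snd c' x)"
    have "((snd ?c \<circ> chart_inv d) has_derivative
        (\<lambda>u. fderiv (snd ?c \<circ> chart_inv c') (snd c' (chart_inv d (snd d x))) (?D u))) (at (snd d x))"
      by (rule chart_has_derivative[OF chart'[OF c'] Q Ck_param_continuous[OF J'] dx(2)])
         (use c' charts_atD(2)[OF c'] c xV Ck_param_differentiable[OF J' dx(2)] transition[OF c', of ?c]
           in \<open>auto simp: dx charts_at_def\<close>)
    then have "((snd ?c \<circ> chart_inv d) has_derivative (\<lambda>u. ?T (?D u))) (at (snd d x))"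
      by (simp add: dx)
    \<comment> \<open>The identity q = fst (\<Gamma> (c (J q))), with c the coordinate map at
      \<open>y\<close>, is differentiated through an arbitrary ambient chart \<open>c'\<close>; this
      exhibits a left inverse of \<open>?D\<close>.\<close>
    from has_derivative_fst[OF has_derivative_compose[OF this, of \<Gamma> "fderiv \<Gamma> (snd ?c x)"]]
    have "((\<lambda>q. fst (\<Gamma> ((snd ?c \<circ> chart_inv d) q))) has_derivative
        (\<lambda>u. fst (fderiv \<Gamma> (snd ?c x) (?T (?D u))))) (at (snd d x))"
      using has_fderiv[OF d\<Gamma>[OF xV(1)]] by (simp add: dx)
    then have "((\<lambda>q. q) has_derivative (\<lambda>u. fst (fderiv \<Gamma> (snd ?c x) (?T (?D u))))) (at (snd d x))"
      by (rule has_derivative_transform_within_open[OF _ Q dx(2)]) (use inv_d Q_N(2) in \<open>auto simp: d_def\<close>)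
    from has_derivative_unique[OF this has_derivative_ident]
    have "fst (fderiv \<Gamma> (snd ?c x) (?T (?D u))) = u" for u by (auto dest: fun_cong)
    then show "inj ?D" by (metis injI)
  qed
  moreover have "y \<in> N"
    using y l c(2) \<Gamma>\<Phi>(2)[OF W1(3)] by (simp add: N_def level_set_def \<Phi>0)
  ultimately show ?thesis
    by (intro exI[of _ d]) (simp add: charts_at_def fst_d)
qed

end


section \<open>Comparison of the sectional curvatures\<close>

lemma dependent_cases:
  fixes u v :: "'a::real_vector"
  assumes "\<not> (\<forall>a b. a *\<^sub>R u + b *\<^sub>R v = 0 \<longrightarrow> a = 0 \<and> b = (0 :: real))"
  obtains "u = 0" | r where "v = r *\<^sub>R u"
proof -
  obtain a b where ab: "a *\<^sub>R u + b *\<^sub>R v = 0" "a \<noteq> 0 \<or> b \<noteq> 0"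
    using assms by blast
  show thesis
  proof (cases "b = 0")
    case True
    then have "u = 0" using ab by auto
    then show thesis by (rule that(1))
  next
    case False
    have "v = (1 / b) *\<^sub>R (b *\<^sub>R v)" using False by simp
    also have "b *\<^sub>R v = - (a *\<^sub>R u)" using ab(1) by (simp add: eq_neg_iff_add_eq_0 add.commute)
    finally have "v = (- a / b) *\<^sub>R u" by simp
    then show thesis by (rule that(2))
  qed
qed

context coord_metric
begin

text \<open>\<open>t \<mapsto> G(u + t v, u + t v)\<close> has no zero, hence negative discriminant; the sign of \<open>G\<close> is irrelevant.\<close>

lemma gram_pos:
  assumes p: "p \<in> S" and indep: "\<forall>a b. a *\<^sub>R u + b *\<^sub>R v = 0 \<longrightarrow> a = 0 \<and> b = 0"
  shows "G p u u * G p v v - (G p u v)\<^sup>2 > 0"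
proof (rule ccontr)
  assume "\<not> ?thesis"
  then have disc: "(G p u v)\<^sup>2 - G p u u * G p v v \<ge> 0" by simp
  have "v \<noteq> 0" using indep[rule_format, of 0 1] by auto
  then have v: "G p v v \<noteq> 0" using definite p by blast
  define r where "r = sqrt ((G p u v)\<^sup>2 - G p u u * G p v v)"
  have r: "r\<^sup>2 = (G p u v)\<^sup>2 - G p u u * G p v v"
    using disc by (simp add: r_def)
  define t where "t = (r - G p u v) / G p v v"
  have tv: "t * G p v v = r - G p u v" using v by (simp add: t_def)
  have "G p (u + t *\<^sub>R v) (u + t *\<^sub>R v) = G p u u + 2 * t * G p u v + t * (t * G p v v)"
    using p sym[OF p, of v u] by (simp add: G_add G_scale algebra_simps)
  also have "\<dots> * G p v v = G p u u * G p v v + 2 * (t * G p v v) * G p u v + (t * G p v v) * (t * G p v v)"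
    by (simp add: algebra_simps)
  also have "\<dots> = 0"
    unfolding tv using r by (simp add: power2_eq_square algebra_simps)
  finally have "G p (u + t *\<^sub>R v) (u + t *\<^sub>R v) = 0" using v by simp
  then have "1 *\<^sub>R u + t *\<^sub>R v = 0" using definite p by fastforce
  then show False using indep by fastforce
qed

lemma coord_metric_cong:
  assumes "\<And>p u v. p \<in> S \<Longrightarrow> G p u v = G' p u v"
  shows "coord_metric S G'"
proof (rule coord_metric.intro)
  have eq: "(\<lambda>u. G' p u v) = (\<lambda>u. G p u v)" if "p \<in> S" for p v
    using assms that by auto
  show "linear (\<lambda>u. G' p u v)" if "p \<in> S" for p v
    unfolding eq[OF that] by (rule linear_left[OF that])
  show "Ck_on 2 (\<lambda>p. G' p u v) S" for u v
    by (rule Ck_on_cong[OF open_S assms C2])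
qed (use assms sym definite open_S in \<open>auto simp flip: assms\<close>)

text \<open>For the projection to the level set of a plane that contains the flow direction: it
  collapses to a line, and both base terms of the curvature comparison vanish.\<close>

lemma degenerate:
  assumes p: "p \<in> S" and "\<not> (\<forall>a b. a *\<^sub>R u + b *\<^sub>R v = 0 \<longrightarrow> a = 0 \<and> b = (0 :: real))"
  shows "curvature_form G p u v = 0" "G p u u * G p v v - (G p u v)\<^sup>2 = 0"
proof -
  have zero: "G p 0 v = 0" "G p 0 0 = 0" for v
    using linear_0[OF linear_left[OF p]] by auto
  show "curvature_form G p u v = 0"
    by (rule dependent_cases[OF assms(2)]) (simp_all add: curvature_form_dependent[OF p])
  show "G p u u * G p v v - (G p u v)\<^sup>2 = 0"
    by (rule dependent_cases[OF assms(2)]) (simp_all add: zero G_scale[OF p] power2_eq_square)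
qed

end

text \<open>A one-dimensional manifold has no tangent planes. Hence, as soon as there is a curvature
  value to estimate, the dimension hypothesis of the theorem leaves only its first
  alternative.\<close>

lemma dependent_dim1:
  fixes u v :: "'a::euclidean_space"
  assumes "DIM('a) = 1"
  shows "\<not> (\<forall>a b. a *\<^sub>R u + b *\<^sub>R v = 0 \<longrightarrow> a = 0 \<and> b = (0 :: real))"
proof -
  obtain e :: 'a where e: "Basis = {e}"
    using assms card_1_singletonE by blast
  have w: "w = (w \<bullet> e) *\<^sub>R e" for w :: 'a
    using euclidean_representation[of w] by (simp add: e)
  show ?thesis
  proof (cases "u = 0")
    case True
    then show ?thesis by (intro notI) (auto dest: spec[of _ 1] spec[of _ 0])
  next
    case False
    have "(v \<bullet> e) *\<^sub>R u = (v \<bullet> e * (u \<bullet> e)) *\<^sub>R e" "(u \<bullet> e) *\<^sub>R v = (u \<bullet> e * (v \<bullet> e)) *\<^sub>R e"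
      using arg_cong[OF w[of u], of "scaleR (v \<bullet> e)"] arg_cong[OF w[of v], of "scaleR (u \<bullet> e)"]
      by (simp_all only: scaleR_scaleR)
    then have "(v \<bullet> e) *\<^sub>R u + (- (u \<bullet> e)) *\<^sub>R v = 0"
      by (simp add: mult.commute)
    moreover have "u \<bullet> e \<noteq> 0" using False w[of u] by auto
    ultimately show ?thesis by fastforce
  qed
qed

context manifold
begin

text \<open>Needed for two factors: the constant 1 gives g in a chart at a point of the level set,
  and v \<circ> f gives the conformal metric on \<open>U\<close>.\<close>

lemma coord_metric_scaled:
  assumes c: "c \<in> A" and g: "pseudo_riemannian X A g" "definite_metric X A g"
    and U: "openin X U" and k: "\<And>x. x \<in> U \<Longrightarrow> k x \<noteq> 0"
    and kC: "Ck_on 2 (k \<circ> chart_inv c) (snd c ` (fst c \<inter> U))"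
  shows "coord_metric (snd c ` (fst c \<inter> U)) (metric_coord A (scale_metric k g) c)"
proof (rule coord_metric.intro)
  let ?S = "snd c ` (fst c \<inter> U)"
  show S: "open ?S" by (rule chart_open_image[OF chart[OF c] U])
  have S_in: "chart_inv c p \<in> topspace X" "c \<in> charts_at A (chart_inv c p)" "chart_inv c p \<in> U" if "p \<in> ?S" for p
    using that chart_inv_left[OF chart[OF c]] openin_subset[OF chart_domain(1)[OF chart[OF c]]] c
    by (auto simp: charts_at_def)
  have tangent: "tvec_of A c (chart_inv c p) u \<in> tangent_space A (chart_inv c p)" if "p \<in> ?S" for p u
    by (rule tvec_of_tangent[OF S_in(2)[OF that]])
  have bil: "g x (lincomb a \<xi> b \<eta>) \<zeta> = a * g x \<xi> \<zeta> + b * g x \<eta> \<zeta>" "g x \<xi> \<eta> = g x \<eta> \<xi>"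
    if "x \<in> topspace X" "\<xi> \<in> tangent_space A x" "\<eta> \<in> tangent_space A x" "\<zeta> \<in> tangent_space A x" for x \<xi> \<eta> \<zeta> a b
    using g(1) that unfolding pseudo_riemannian_def by blast+
  show "linear (\<lambda>u. metric_coord A (scale_metric k g) c p u v)" if p: "p \<in> ?S" for p v
  proof (rule linearI)
    note b = bil(1)[OF S_in(1)[OF p] tangent[OF p] tangent[OF p] tangent[OF p, of v]]
    note l = lincomb_tvec_of[OF S_in(2)[OF p]]
    show "metric_coord A (scale_metric k g) c p (u + u') v
        = metric_coord A (scale_metric k g) c p u v + metric_coord A (scale_metric k g) c p u' v" for u u'
      using b[of 1 u 1 u'] by (simp add: metric_coord_def scale_metric_def l algebra_simps)
    show "metric_coord A (scale_metric k g) c p (r *\<^sub>R u) v = r *\<^sub>R metric_coord A (scale_metric k g) c p u v" for r u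
      using b[of r u 0 u] by (simp add: metric_coord_def scale_metric_def l)
  qed
  show "metric_coord A (scale_metric k g) c p u v = metric_coord A (scale_metric k g) c p v u" if p: "p \<in> ?S" for p u v
    using bil(2)[OF S_in(1)[OF p] tangent[OF p] tangent[OF p] tangent[OF p]]
    by (simp add: metric_coord_def scale_metric_def)
  show "metric_coord A (scale_metric k g) c p u u \<noteq> 0" if p: "p \<in> ?S" "u \<noteq> 0" for p u
  proof -
    have "tvec_of A c (chart_inv c p) u \<noteq> (\<lambda>_. 0)"
      using tvec_of_eq_zero[OF S_in(2)[OF p(1)]] p(2) by simp
    then have "g (chart_inv c p) (tvec_of A c (chart_inv c p) u) (tvec_of A c (chart_inv c p) u) \<noteq> 0"
      using g(2) S_in(1)[OF p(1)] tangent[OF p(1), of u] unfolding definite_metric_def by (metis less_irrefl)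
    then show ?thesis
      using k[OF S_in(3)[OF p(1)]] by (simp add: metric_coord_def scale_metric_def)
  qed
  show "Ck_on 2 (\<lambda>p. metric_coord A (scale_metric k g) c p u v) ?S" for u v
  proof -
    have "Ck_on 2 (\<lambda>p. metric_coord A g c p u v) ?S"
    proof (rule Ck_on_subset[OF smooth_on_Ck])
      show "smooth_on (snd c ` fst c) (\<lambda>p. metric_coord A g c p u v)"
        using g(1) c by (simp add: pseudo_riemannian_def)
    qed auto
    from Ck_on_mult[OF S kC this] show ?thesis
      by (simp add: metric_coord_def scale_metric_def)
  qed
qed

text \<open>The pullback passes through tangent vectors of the level set. Functoriality for the
  inclusion removes them and leaves the ambient metric on derivatives of the parametrization
  \<open>chart_inv d\<close>.\<close>

lemma metric_coord_submanifold:
  fixes d :: "('m, 'b::euclidean_space) chart"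
  assumes d: "d \<in> submanifold_atlas X A N" and q: "q \<in> snd d ` fst d"
  shows "metric_coord (submanifold_atlas X A N) (pullback (submanifold_atlas X A N) A id g) d q u v
    = g (chart_inv d q) (pushforward A (chart_inv d) q u) (pushforward A (chart_inv d) q v)"
proof -
  let ?B = "submanifold_atlas X A N :: ('m, 'b) atlas"
  interpret B: c1_atlas "subtopology X N" ?B by (rule submanifold_c1_atlas)
  note chart_d = B.chart[OF d]
  have dy: "d \<in> charts_at ?B (chart_inv d q)"
    using chart_inv_in[OF chart_d q] d by (simp add: charts_at_def)
  have qd: "snd d (chart_inv d q) = q" by (rule chart_inv_right[OF chart_d q])
  have "differential ?B A id (chart_inv d q) (pushforward ?B (chart_inv d) q w) = pushforward A (id \<circ> chart_inv d) q w" for w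
  proof (rule differential_pushforward[OF B.c1_atlas_axioms chart_domain(2)[OF chart_d] chart_inv_continuous[OF chart_d] q])
    show "charts_at ?B (chart_inv d q) \<noteq> {}" using dy by blast
    show "(snd e \<circ> chart_inv d) differentiable at q" if "e \<in> charts_at ?B (chart_inv d q)" for e
      using B.transition[OF dy that] by (simp add: qd)
    show "(snd c' \<circ> id \<circ> chart_inv e) differentiable at (snd e (chart_inv d q))"
      if e: "e \<in> charts_at ?B (chart_inv d q)" and c': "c' \<in> charts_at A (id (chart_inv d q))" for e c'
      using Ck_param_differentiable[where q = "snd e (chart_inv d q)" and c = c' and k = 0,
          OF submanifold_chart_param[OF charts_atD(1)[OF e]]]
        charts_atD(2)[OF e] c' B.chart_inv_at[OF e] by simp
  qed
  then show ?thesis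
    by (simp add: B.metric_coord_pushforward[OF d q] pullback_def)
qed

end

context homogeneous
begin

text \<open>One exact identity for K - C yields all three claims by its sign, since the factor r is
  positive. The first alternative stands apart because a plane that contains the flow direction
  determines no plane tangent to the level set.\<close>

theorem sectional_curvature_comparison:
  fixes B :: "('m, 'b::euclidean_space) atlas"
  assumes definite: "definite_metric X A g" and l: "l > 0"
    and dim: "DIM('b) = DIM('a) - 1 \<or> DIM('a) = 1"
    and B_def: "B = submanifold_atlas X A (level_set X f l)"
    and gl_def: "gl = pullback B A id g"
    and \<Delta>: "(C / \<alpha>, C1, C2) \<in> Delta1 \<union> Delta2 \<union> Delta3" and \<sigma>: "\<sigma> \<in> {1, -1}"
    and U_def: "U = {x \<in> topspace X. f x \<in> w_dom (C / \<alpha>) C1 C2}"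
    and h_def: "h = scale_metric (v_fun \<sigma> (C / \<alpha>) C1 C2 \<circ> f) g"
    and K: "K \<in> sectional_curvatures A U h"
  shows "K = C \<or> (\<exists>K'\<in>sectional_curvatures B (level_set X f l) gl. \<exists>r>0. K - C = r * (l * K' - \<alpha> * C1))"
proof -
  let ?s = "C / \<alpha>" and ?M = "level_set X f l"
  define w where "w = w_fun \<sigma> ?s C1 C2"
  define y where "y = w_slope \<sigma> ?s C1 C2"
  define D where "D = w_dom ?s C1 C2"
  have openD: "open D" unfolding D_def by (rule open_w_dom[OF \<Delta> \<sigma>])
  have D_pos: "r > 0" if "r \<in> D" for r using that w_dom_subset[OF \<Delta> \<sigma>] by (auto simp: D_def)
  have w_pos': "w r > 0" if "r \<in> D" for r using w_pos[OF \<Delta> \<sigma>] that by (simp add: w_def D_def)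
  have y_sq: "(y r)\<^sup>2 = 4 * (C1 - ?s * w r)" if "r \<in> D" for r
    using w_slope_sq[OF \<Delta> \<sigma>] that by (simp add: w_def y_def D_def)
  have dw: "(w has_real_derivative y r * w r / r) (at r)" if "r \<in> D" for r
    using w_has_derivative[OF \<Delta> \<sigma>] that unfolding w_def y_def D_def by blast
  have dy: "(y has_real_derivative - 2 * ?s * w r / r) (at r)" if "r \<in> D" for r
    using w_slope_has_derivative[OF \<Delta> \<sigma>] that unfolding w_def y_def D_def by blast
  let ?v = "v_fun \<sigma> ?s C1 C2"
  have v: "?v r = w r / r" for r by (simp add: v_fun_def w_def)
  have v_Ck: "Ck_on k ?v D" for k
  proof -
    have 1: "Ck_on k (\<lambda>r. w r * r powr (-1)) D"
      by (rule Ck_on_mult[OF openD _ Ck_on_subset[OF Ck_on_powr]])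
         (use Ck_on_w[OF \<Delta> \<sigma>] D_pos in \<open>auto simp: w_def D_def\<close>)
    have 2: "w r * r powr (-1) = ?v r" if "r \<in> D" for r
      unfolding v using D_pos[OF that] by (simp add: powr_minus divide_inverse)
    show ?thesis by (rule Ck_on_cong[OF openD 2 1])
  qed
  have "openin X {x \<in> topspace X. f x \<in> D}"
    by (rule openin_continuous_map_preimage[of X euclidean])
       (use f_continuous openD in \<open>auto simp: continuous_map_in_subtopology\<close>)
  then have openU: "openin X U" by (simp add: U_def D_def)
  have U_top: "U \<subseteq> topspace X" by (auto simp: U_def)
  obtain x a' b' where x: "x \<in> U"
    and K_eq: "K = sectional_coord (metric_coord A h (chart_at A x)) (snd (chart_at A x) x) a' b'"
    and indep: "\<forall>a b. a *\<^sub>R a' + b *\<^sub>R b' = 0 \<longrightarrow> a = 0 \<and> b = (0 :: real)"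
    using K sectional_curvatures_alt[of U h] charts_at_nonempty U_top by blast
  have xX: "x \<in> topspace X" and fx: "f x \<in> D" using x by (auto simp: U_def D_def)
  let ?c = "chart_at A x"
  have c: "?c \<in> A" "x \<in> fst ?c" using chart_at[OF xX] by (simp_all add: charts_at_def)
  note chart_c = chart[OF c(1)]
  have dim': "DIM('b) + 1 = DIM('a)" "DIM('a) \<noteq> 1"
  proof -
    show "DIM('a) \<noteq> 1"
      using dependent_dim1[of a' b'] indep by blast
    moreover have "DIM('a) > 0" by simp
    ultimately show "DIM('b) + 1 = DIM('a)" using dim by linarith
  qed
  \<comment> \<open>The flow multiplies f by exp (\<alpha> t), so flowing back for the time t0 takes
    \<open>x\<close> to the level l.\<close>
  define t0 where "t0 = ln (f x / l) / \<alpha>"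
  define y0 where "y0 = m (exp (- t0)) x"
  have y0: "y0 \<in> topspace X" using action_in[OF _ xX] by (simp add: y0_def)
  have "f x > 0" by (rule f_pos[OF xX])
  have fy0: "f y0 = l"
  proof -
    have "f y0 = exp (- t0) powr \<alpha> * f x" using f_action[OF _ xX] by (simp add: y0_def)
    also have "exp (- t0) powr \<alpha> = exp (- ln (f x / l))"
      using alpha_nonzero by (simp add: powr_def t0_def)
    also have "\<dots> = l / f x"
      using \<open>f x > 0\<close> l by (simp add: exp_minus)
    finally show ?thesis using \<open>f x > 0\<close> by simp
  qed
  have y0M: "y0 \<in> ?M" using y0 fy0 by (simp add: level_set_def)
  have x_y0: "m (exp t0) y0 = x"
    using action_exp[OF xX, of t0 "- t0"] action_one[OF xX] by (simp add: y0_def)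
  have M_charts: "charts_at B z \<noteq> {}" if "z \<in> ?M" for z
    using level_set_chart_exists[where 'b = 'b, OF dim'(1)] that by (fastforce simp: level_set_def B_def)
  interpret B: c1_atlas "subtopology X ?M" B
    unfolding B_def by (rule submanifold_c1_atlas)
  \<comment> \<open>The chart in which the definition of sectional curvature evaluates
    \<open>gl\<close> at \<open>y0\<close>. Taking q from it means that this curvature is read off
    without a change of chart.\<close>
  define d where "d = chart_at B y0"
  have d: "d \<in> B" "y0 \<in> fst d"
    using chart_at_nonempty_in[OF M_charts[OF y0M]] by (simp_all add: d_def charts_at_def)
  note chart_d = B.chart[OF d(1)]
  define J where "J = chart_inv d"
  define Qd where "Qd = snd d ` fst d"
  have J: "Ck_param X A k Qd J" for k
    unfolding J_def Qd_def by (rule submanifold_chart_param[OF d(1)[unfolded B_def]])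
  have JM: "f (J q) = l" if "q \<in> Qd" for q
  proof -
    have "J q \<in> fst d" using chart_inv_in[OF chart_d] that by (simp add: J_def Qd_def)
    then have "J q \<in> ?M" using openin_subset[OF chart_domain(1)[OF chart_d]] by auto
    then show ?thesis by (simp add: level_set_def)
  qed
  define q0 where "q0 = snd d y0"
  have q0: "q0 \<in> Qd" "J q0 = y0"
    using d(2) chart_inv_left[OF chart_d] by (auto simp: q0_def Qd_def J_def)
  define F where "F z = m (exp (snd z)) (J (fst z))" for z :: "'b \<times> real"
  have F: "Ck_param X A k (Qd \<times> UNIV) F" for k
    using Ck_param_flow[OF J] by (simp add: F_def[abs_def])
  have F0: "F (q0, t0) = x" by (simp add: F_def q0 x_y0)
  have fF: "f (F z) = l * exp (\<alpha> * snd z)" if "fst z \<in> Qd" for z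
    using f_action[OF _ Ck_param_topspace[OF J that], of "exp (snd z)"] JM[OF that]
    by (simp add: F_def powr_def mult.commute)

  let ?c1 = "chart_at A y0"
  have c1: "?c1 \<in> A" "y0 \<in> fst ?c1" using chart_at[OF y0] by (simp_all add: charts_at_def)
  \<comment> \<open>Cut down so that \<open>J\<close> stays in one ambient chart: there \<gamma> is
    the pullback of the single coordinate metric \<open>Gg\<close>, from which it inherits
    definiteness and two derivatives.\<close>
  define Q where "Q = Qd \<inter> J -` fst ?c1"
  have Q: "open Q"
    unfolding Q_def by (rule open_param_preimage[OF chart[OF c1(1)] Ck_param_open[OF J] Ck_param_continuous[OF J]])
  have q0Q: "q0 \<in> Q" using q0 c1(2) by (simp add: Q_def)
  define W where "W = ((Qd \<times> UNIV) \<inter> F -` fst ?c) \<inter> (Q \<times> UNIV) \<inter> {z. l * exp (\<alpha> * snd z) \<in> D}"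
  have W: "open W"
  proof -
    have "continuous_on UNIV (\<lambda>z :: 'b \<times> real. l * exp (\<alpha> * snd z))"
      by (intro continuous_intros)
    from open_vimage[OF openD this] have "open {z :: 'b \<times> real. l * exp (\<alpha> * snd z) \<in> D}"
      by (simp add: vimage_def)
    then show ?thesis
      unfolding W_def using open_Times[OF Q open_UNIV]
      by (intro open_Int open_param_preimage[OF chart_c Ck_param_open[OF F] Ck_param_continuous[OF F]])
  qed
  have W_D: "l * exp (\<alpha> * snd z) \<in> D" "fst z \<in> Q" "fst z \<in> Qd" "F z \<in> fst ?c" "F z \<in> U" if "z \<in> W" for z
  proof -
    show *: "l * exp (\<alpha> * snd z) \<in> D" "fst z \<in> Q" "fst z \<in> Qd" "F z \<in> fst ?c"
      using that by (auto simp: W_def)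
    have "z \<in> Qd \<times> UNIV" using *(3) by (cases z) auto
    then show "F z \<in> U"
      using Ck_param_topspace[OF F] fF[OF *(3)] *(1) by (simp add: U_def D_def)
  qed
  have z0: "(q0, t0) \<in> W"
  proof -
    have "l * exp (\<alpha> * t0) = f x" using fF[of "(q0, t0)"] q0(1) F0 by simp
    then show ?thesis using q0 q0Q c(2) fx F0 by (simp add: W_def)
  qed

  define Gg where "Gg = metric_coord A g ?c1"
  have Gg: "coord_metric (snd ?c1 ` (fst ?c1 \<inter> topspace X)) Gg"
  proof -
    have "scale_metric (\<lambda>_. 1) g = g" by (simp add: scale_metric_def)
    then show ?thesis
      unfolding Gg_def
      using coord_metric_scaled[OF c1(1) _ definite openin_topspace, of "\<lambda>_. 1"] pair
      by (simp add: homogeneous_pair_def o_def)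
  qed
  define \<gamma> where "\<gamma> = metric_coord B gl d"
  have \<gamma>_J: "\<gamma> q u v = g (J q) (pushforward A J q u) (pushforward A J q v)" if "q \<in> Qd" for q u v
    using metric_coord_submanifold[OF d(1)[unfolded B_def], of q g u v] that
    by (simp add: \<gamma>_def gl_def B_def J_def Qd_def)
  have imm: "coord_immersion (snd ?c1 ` (fst ?c1 \<inter> topspace X)) Gg Q (snd ?c1 \<circ> J)"
  proof (intro coord_immersion.intro[OF Gg] coord_immersion_axioms.intro)
    show "Ck_on 3 (snd ?c1 \<circ> J) Q"
      unfolding Q_def by (rule Ck_param_Ck_on[OF J c1(1)])
    show "(snd ?c1 \<circ> J) q \<in> snd ?c1 ` (fst ?c1 \<inter> topspace X)" if "q \<in> Q" for q
      using that Ck_param_topspace[OF J] by (auto simp: Q_def)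
    show "inj (fderiv (snd ?c1 \<circ> J) q)" if "q \<in> Q" for q
    proof -
      have q: "q \<in> Qd" "?c1 \<in> charts_at A (J q)" using that c1 by (auto simp: Q_def charts_at_def)
      have "J q \<in> fst d" using chart_inv_in[OF chart_d] q(1) by (simp add: J_def Qd_def)
      moreover have "snd d (J q) = q" using chart_inv_right[OF chart_d] q(1) by (simp add: J_def Qd_def)
      ultimately show ?thesis
        using d(1) q(2) unfolding B_def submanifold_atlas_def J_def by fastforce
    qed
  qed (rule Q)
  have \<gamma>: "coord_metric Q \<gamma>"
  proof (rule coord_metric.coord_metric_cong[OF coord_immersion.coord_metric_pullback[OF imm]])
    fix q u v assume "q \<in> Q"
    then have q: "q \<in> Qd" "?c1 \<in> charts_at A (J q)" using c1 by (auto simp: Q_def charts_at_def)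
    have "pushforward A J q u = tvec_of A ?c1 (J q) (fderiv (snd ?c1 \<circ> J) q u)" for u
      by (rule pushforward_eq_tvec_of[OF Ck_param_open[OF J] Ck_param_continuous[OF J] q Ck_param_differentiable[OF J q]])
    then show "pullback_coord Gg (snd ?c1 \<circ> J) q u v = \<gamma> q u v"
      using chart_inv_at[OF q(2)]
      by (simp add: pullback_coord_def Gg_def metric_coord_def \<gamma>_J[OF q(1)])
  qed

  define S where "S = snd ?c ` (fst ?c \<inter> U)"
  define Gh where "Gh = metric_coord A h ?c"
  have Gh: "coord_metric S Gh"
    unfolding S_def Gh_def h_def
  proof (rule coord_metric_scaled[OF c(1) _ definite openU])
    show "pseudo_riemannian X A g" using pair by (simp add: homogeneous_pair_def)
    show "(?v \<circ> f) x \<noteq> 0" if "x \<in> U" for x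
    proof -
      have "f x \<in> D" using that by (simp add: U_def D_def)
      then show ?thesis using w_pos'[of "f x"] D_pos[of "f x"] by (simp add: v)
    qed
    have "Ck_on 2 (\<lambda>p. ?v ((f \<circ> chart_inv ?c) p)) (snd ?c ` (fst ?c \<inter> U))"
    proof (rule Ck_on_compose[OF chart_open_image[OF chart_c openU] openD _ v_Ck])
      show "(f \<circ> chart_inv ?c) ` snd ?c ` (fst ?c \<inter> U) \<subseteq> D"
        using chart_inv_left[OF chart_c] by (auto simp: U_def D_def)
      show "Ck_on 2 (f \<circ> chart_inv ?c) (snd ?c ` (fst ?c \<inter> U))"
        by (rule Ck_on_subset[OF f_Ck[OF c(1)]]) auto
    qed
    then show "Ck_on 2 (?v \<circ> f \<circ> chart_inv ?c) (snd ?c ` (fst ?c \<inter> U))"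
      by (simp add: o_def)
  qed
  define \<kappa> where "\<kappa> = \<alpha> * l"
  have \<kappa>: "\<kappa> \<noteq> 0" using alpha_nonzero l by (simp add: \<kappa>_def)
  \<comment> \<open>At f = l exp (\<alpha> t) the conformal factor is v(f) = w(f) / f, and the flow
    metric carries exp (\<alpha> t) = f / l; the product is w(f) / l.\<close>
  define \<rho> where "\<rho> t = w (l * exp (\<alpha> * t)) / l" for t
  \<comment> \<open>Half the logarithmic derivative of \<rho>: y is the derivative of log w with
    respect to log f, and log f has derivative \<alpha> along the flow.\<close>
  define \<eta> where "\<eta> t = \<alpha> / 2 * y (l * exp (\<alpha> * t))" for t
  define \<Phi> where "\<Phi> = snd ?c \<circ> F"
  define H where "H = pullback_coord Gh \<Phi>"
  have \<Phi>_C3: "Ck_on 3 \<Phi> W"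
    unfolding \<Phi>_def by (rule Ck_on_subset[OF Ck_param_Ck_on[OF F c(1)]]) (auto simp: W_def)
  have \<Phi>_S: "\<Phi> z \<in> S" if "z \<in> W" for z
    using W_D(4,5)[OF that] by (simp add: \<Phi>_def S_def)
  have \<Phi>_inv: "chart_inv ?c (\<Phi> z) = F z" if "z \<in> W" for z
    using chart_inv_left[OF chart_c W_D(4)[OF that]] by (simp add: \<Phi>_def)
  have H_eq: "H z a b = \<rho> (snd z) * (\<gamma> (fst z) (fst a) (fst b) + \<kappa> * (snd a * snd b))" if z: "z \<in> W" for z a b
  proof -
    have zQ: "z \<in> Qd \<times> UNIV" using W_D(3)[OF z] by (cases z) auto
    have cz: "?c \<in> charts_at A (F z)" using W_D(4)[OF z] c by (simp add: charts_at_def)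
    have push: "tvec_of A ?c (F z) (fderiv \<Phi> z e) = pushforward A F z e" for e
      unfolding \<Phi>_def
      by (rule pushforward_eq_tvec_of[OF Ck_param_open[OF F] Ck_param_continuous[OF F] zQ cz
            Ck_param_differentiable[OF F zQ cz], symmetric])
    have "H z a b = ?v (f (F z)) * g (F z) (pushforward A F z a) (pushforward A F z b)"
      by (simp add: H_def pullback_coord_def Gh_def metric_coord_def \<Phi>_inv[OF z] h_def scale_metric_def push)
    also have "g (F z) (pushforward A F z a) (pushforward A F z b) =
        exp (\<alpha> * snd z) * (\<gamma> (fst z) (fst a) (fst b) + \<kappa> * (snd a * snd b))"
      using metric_flow[OF J W_D(3)[OF z] JM, of "snd z" a b]
      by (simp add: F_def[abs_def] \<gamma>_J[OF W_D(3)[OF z]] \<kappa>_def)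
    also have "?v (f (F z)) * (exp (\<alpha> * snd z) * (\<gamma> (fst z) (fst a) (fst b) + \<kappa> * (snd a * snd b)))
        = \<rho> (snd z) * (\<gamma> (fst z) (fst a) (fst b) + \<kappa> * (snd a * snd b))"
      using l by (simp add: v \<rho>_def fF[OF W_D(3)[OF z]])
    finally show ?thesis .
  qed
  have \<rho>_pos: "\<rho> (snd z) > 0" if "z \<in> W" for z
    using w_pos'[OF W_D(1)[OF that]] l by (simp add: \<rho>_def)

  interpret \<gamma>: coord_metric Q \<gamma> by (rule \<gamma>)
  have dim_eq: "DIM('b \<times> real) = DIM('a)" using dim' by simp
  have lin_\<Phi>: "linear (fderiv \<Phi> z)" if "z \<in> W" for z
    using \<Phi>_C3 that by (intro linear_frechet_derivative) (simp add: numeral_3_eq_3)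
  text \<open>A kernel vector \<open>a\<close> is \<open>H\<close>-orthogonal to all \<open>b\<close>, in particular to \<open>(fst a, 0)\<close> and \<open>(0, 1)\<close>.\<close>
  have inj_\<Phi>: "inj (fderiv \<Phi> z)" if z: "z \<in> W" for z
    unfolding linear_injective_0[OF lin_\<Phi>[OF z]]
  proof (intro allI impI)
    fix a assume a: "fderiv \<Phi> z a = 0"
    have "H z a b = 0" for b
      using linear_0[OF coord_metric.linear_left[OF Gh \<Phi>_S[OF z]]] by (simp add: H_def pullback_coord_def a)
    then have *: "\<gamma> (fst z) (fst a) (fst b) + \<kappa> * (snd a * snd b) = 0" for b
      using H_eq[OF z] \<rho>_pos[OF z] by (metis mult_eq_0_iff less_irrefl)
    have "\<gamma> (fst z) (fst a) 0 = 0"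
      using linear_0[OF \<gamma>.linear_right[OF W_D(2)[OF z]]] .
    then have "snd a = 0" using *[of "(0, 1)"] \<kappa> by simp
    moreover have "fst a = 0"
      using *[of "(fst a, 0)"] \<gamma>.definite[OF W_D(2)[OF z]] by auto
    ultimately show "a = 0" by (simp add: prod_eq_iff)
  qed
  \<comment> \<open>Source and target are different types of equal dimension. Composition with a
    linear isomorphism \<open>k\<close> gives an endomorphism, for which injectivity implies
    surjectivity.\<close>
  have surj_\<Phi>: "surj (fderiv \<Phi> z)" if z: "z \<in> W" for z
  proof -
    obtain k :: "'a \<Rightarrow> 'b \<times> real" where k: "linear k" "inj k" "surj k"
      using isomorphisms_UNIV_UNIV[OF dim_eq[symmetric]] by (metis injI surjI)
    have "inj (fderiv \<Phi> z \<circ> k)" using inj_compose[OF inj_\<Phi>[OF z] k(2)] .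
    then have "surj (fderiv \<Phi> z \<circ> k)"
      using linear_injective_imp_surjective[OF linear_compose[OF k(1) lin_\<Phi>[OF z]]] by blast
    then show ?thesis unfolding surj_def comp_apply by blast
  qed
  interpret diffeo: coord_diffeo S Gh W \<Phi>
    by (intro coord_diffeo.intro coord_immersion.intro coord_immersion_axioms.intro coord_diffeo_axioms.intro
        Gh W \<Phi>_C3 \<Phi>_S inj_\<Phi> surj_\<Phi>)
  interpret H: coord_metric W H
    unfolding H_def by (rule diffeo.coord_metric_pullback)
  obtain a b where ab: "fderiv \<Phi> (q0, t0) a = a'" "fderiv \<Phi> (q0, t0) b = b'"
    using surj_\<Phi>[OF z0] by (metis surjD)
  have indep_ab: "\<forall>r s. r *\<^sub>R a + s *\<^sub>R b = 0 \<longrightarrow> r = 0 \<and> s = (0 :: real)"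
  proof (intro allI impI)
    fix r s assume "r *\<^sub>R a + s *\<^sub>R b = 0"
    then have "fderiv \<Phi> (q0, t0) (r *\<^sub>R a + s *\<^sub>R b) = 0" using linear_0[OF lin_\<Phi>[OF z0]] by simp
    then show "r = 0 \<and> s = 0"
      using indep by (simp add: linear_add[OF lin_\<Phi>[OF z0]] linear_scale[OF lin_\<Phi>[OF z0]] ab)
  qed
  define den where "den = H (q0, t0) a a * H (q0, t0) b b - (H (q0, t0) a b)\<^sup>2"
  have den: "den > 0"
    unfolding den_def by (rule H.gram_pos[OF z0 indep_ab])
  have "\<Phi> (q0, t0) = snd ?c x" by (simp add: \<Phi>_def F0)
  then have "K = sectional_coord Gh (\<Phi> (q0, t0)) (fderiv \<Phi> (q0, t0) a) (fderiv \<Phi> (q0, t0) b)"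
    by (simp add: K_eq Gh_def ab)
  also have "\<dots> = sectional_coord H (q0, t0) a b"
    unfolding H_def by (rule diffeo.sectional_coord_pullback[OF z0, symmetric])
  also have "\<dots> = curvature_form H (q0, t0) a b / den"
    unfolding den_def by (rule H.sectional_coord_eq[OF z0])
  finally have K_H: "K = curvature_form H (q0, t0) a b / den" .

  define u where "u = fst a"
  define u' where "u' = fst b"
  define Ag where "Ag = \<gamma> q0 u u * \<gamma> q0 u' u' - (\<gamma> q0 u u')\<^sup>2"
  define Br where "Br = (snd a)\<^sup>2 * \<gamma> q0 u' u' + (snd b)\<^sup>2 * \<gamma> q0 u u - 2 * snd a * snd b * \<gamma> q0 u u'"
  have d_arg: "((\<lambda>t. l * exp (\<alpha> * t)) has_real_derivative \<alpha> * (l * exp (\<alpha> * t))) (at t)" for t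
    by (auto intro!: derivative_eq_intros)
  have d\<rho>: "(\<rho> has_real_derivative 2 * \<eta> (snd z) * \<rho> (snd z)) (at (snd z))" if "z \<in> W" for z
    using DERIV_cdivide[OF DERIV_chain2[OF dw[OF W_D(1)[OF that]] d_arg], of l] D_pos[OF W_D(1)[OF that]] l
    by (simp add: \<rho>_def[abs_def] \<eta>_def field_simps)
  have d\<eta>: "(\<eta> has_real_derivative - C * \<kappa> * \<rho> (snd z)) (at (snd z))" if "z \<in> W" for z
    using DERIV_cmult[OF DERIV_chain2[OF dy[OF W_D(1)[OF that]] d_arg], of "\<alpha> / 2"] D_pos[OF W_D(1)[OF that]]
      l alpha_nonzero
    by (simp add: \<rho>_def \<eta>_def[abs_def] \<kappa>_def field_simps)
  have N: "curvature_form H (q0, t0) a b =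
      \<rho> t0 * (curvature_form \<gamma> q0 u u' - (- C * \<kappa> * \<rho> t0) * Br - (\<eta> t0)\<^sup>2 / \<kappa> * Ag)"
    using conformal_product_curvature_form[OF \<gamma> H.coord_metric_axioms \<kappa> W_D(2) H_eq d\<rho>
        d\<eta>[unfolded mult.assoc, folded mult.assoc] z0, of a b]
    by (simp add: u_def u'_def Ag_def Br_def)
  have \<eta>_sq: "(\<eta> t0)\<^sup>2 / \<kappa> = \<alpha> * C1 / l - C * \<rho> t0"
    using y_sq[OF W_D(1)[OF z0]] alpha_nonzero l
    by (simp add: \<eta>_def \<kappa>_def \<rho>_def power_mult_distrib power_divide) (simp add: power2_eq_square field_simps)
  have den_eq: "den = (\<rho> t0)\<^sup>2 * (Ag + \<kappa> * Br)"
    unfolding den_def H_eq[OF z0] Ag_def Br_def u_def u'_def fst_conv snd_conv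
    by (simp add: power2_eq_square algebra_simps)
  \<comment> \<open>The terms with \<open>Br\<close> cancel because \<eta>' = - C \<kappa> \<rho>;
    by \<open>\<eta>_sq\<close> the part of \<eta>^2 / \<kappa> that depends on \<rho> cancels
    against C times the \<open>Ag\<close> part of \<open>den\<close>.\<close>
  have diff: "curvature_form H (q0, t0) a b - C * den = \<rho> t0 * (curvature_form \<gamma> q0 u u' - \<alpha> * C1 / l * Ag)"
    unfolding N den_eq \<eta>_sq by (simp add: power2_eq_square algebra_simps)
  have KC: "K - C = \<rho> t0 * (curvature_form \<gamma> q0 u u' - \<alpha> * C1 / l * Ag) / den"
    using den unfolding K_H diff[symmetric] by (simp add: field_simps)
  show ?thesis
  proof (cases "\<forall>r s. r *\<^sub>R u + s *\<^sub>R u' = 0 \<longrightarrow> r = 0 \<and> s = (0 :: real)")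
    case True
    have Ag: "Ag > 0"
      unfolding Ag_def by (rule \<gamma>.gram_pos[OF q0Q True])
    define K' where "K' = sectional_coord \<gamma> q0 u u'"
    have K': "curvature_form \<gamma> q0 u u' = K' * Ag"
      using Ag \<gamma>.sectional_coord_eq[OF q0Q, of u u'] by (simp add: K'_def Ag_def)
    have "K' \<in> sectional_curvatures B ?M gl"
      by (subst B.sectional_curvatures_alt[OF M_charts])
         (use y0M True in \<open>auto simp: K'_def \<gamma>_def d_def q0_def\<close>)
    moreover have "\<rho> t0 * Ag / (l * den) > 0"
      using \<rho>_pos[OF z0] Ag den l by simp
    moreover have "K - C = \<rho> t0 * Ag / (l * den) * (l * K' - \<alpha> * C1)"
      unfolding KC K' using l den by (simp add: field_simps)
    ultimately show ?thesis by blast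
  next
    \<comment> \<open>The plane contains the flow direction. Then K = C whatever the curvature of
      the level set is.\<close>
    case False
    from \<gamma>.degenerate[OF q0Q this] have "K - C = 0"
      unfolding KC Ag_def by simp
    then show ?thesis by simp
  qed
qed

end

theorem corollary3p15:
  fixes X :: "'m topology"
    and A :: "('m, 'a::euclidean_space) atlas"
    and m :: "real \<Rightarrow> 'm \<Rightarrow> 'm"
    and g h :: "('m, 'a) metric"
    and f :: "'m \<Rightarrow> real"
    and B :: "('m, 'b::euclidean_space) atlas"
    and g\<^sub>l :: "('m, 'b) metric"
    and U :: "'m set"
    and \<alpha> l C C1 C2 \<sigma> :: real
  assumes "smooth_manifold X A"
    and "smooth_free_action X A m"
    and "homogeneous_pair X A m \<alpha> g f"
    and "definite_metric X A g"
    and "l > 0"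
    and "DIM('b) = DIM('a) - 1 \<or> DIM('a) = 1"
    and "B = submanifold_atlas X A (level_set X f l)"
    and "g\<^sub>l = pullback B A id g"
    and "(C / \<alpha>, C1, C2) \<in> Delta1 \<union> Delta2 \<union> Delta3"
    and "\<sigma> \<in> {1, -1}"
    and "U = {x \<in> topspace X. f x \<in> w_dom (C / \<alpha>) C1 C2}"
    and "h = scale_metric (v_fun \<sigma> (C / \<alpha>) C1 C2 \<circ> f) g"
  shows "((\<forall>K\<in>sectional_curvatures B (level_set X f l) g\<^sub>l. l * K \<ge> \<alpha> * C1) \<longrightarrow>
            (\<forall>K\<in>sectional_curvatures A U h. K \<ge> C)) \<and>
         ((\<forall>K\<in>sectional_curvatures B (level_set X f l) g\<^sub>l. l * K \<le> \<alpha> * C1) \<longrightarrow>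
            (\<forall>K\<in>sectional_curvatures A U h. K \<le> C)) \<and>
         ((\<forall>K\<in>sectional_curvatures B (level_set X f l) g\<^sub>l. l * K = \<alpha> * C1) \<longrightarrow>
            (\<forall>K\<in>sectional_curvatures A U h. K = C))"
proof -
  interpret homogeneous X A m \<alpha> g f
    using assms(1-3) by unfold_locales
  have cmp: "K = C \<or> (\<exists>K'\<in>sectional_curvatures B (level_set X f l) g\<^sub>l. \<exists>r>0. K - C = r * (l * K' - \<alpha> * C1))"
    if "K \<in> sectional_curvatures A U h" for K
    by (rule sectional_curvature_comparison[OF assms(4-12) that])
  show ?thesis
  proof (intro conjI impI ballI)
    fix K assume *: "\<forall>K\<in>sectional_curvatures B (level_set X f l) g\<^sub>l. l * K \<ge> \<alpha> * C1"
      and K: "K \<in> sectional_curvatures A U h"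
    show "K \<ge> C"
      using cmp[OF K] * by (smt (verit) mult_nonneg_nonneg)
  next
    fix K assume *: "\<forall>K\<in>sectional_curvatures B (level_set X f l) g\<^sub>l. l * K \<le> \<alpha> * C1"
      and K: "K \<in> sectional_curvatures A U h"
    show "K \<le> C"
      using cmp[OF K] * by (smt (verit) mult_nonneg_nonpos)
  next
    fix K assume *: "\<forall>K\<in>sectional_curvatures B (level_set X f l) g\<^sub>l. l * K = \<alpha> * C1"
      and K: "K \<in> sectional_curvatures A U h"
    show "K = C"
      using cmp[OF K] * by fastforce
  qed
qed

end
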